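(* Let $K=\mathbb{C}(t)$ and let $C\subset \mathbb{A}^2_K$ be an irreducible curve over $K$. If $C$ has at least two distinct points at infinity, then for every integer $b\geq 1$, $$\dim C(b)\leq 1.$$
   Context: For a quasi-affine variety $X\subset \mathbb{A}^n_K$ and an integer $b\ge1$, $X(b)=\{(a_1,\ldots,a_n)\in X(K): a_i\in\mathbb{C}[t],\ \deg a_i<b \text{ for all } i\}$ is the set of integral points of height less than $b$. Identifying polynomials of degree $<b$ with their coefficient vectors in $\mathbb{C}^b$, $X(b)$ is naturally a quasi-affine variety over $\mathbb{C}$ in $\mathbb{A}^{bn}_{\mathbb{C}}$, with equations obtained by expanding the equations of $X$ in powers of $t$; $\dim X(b)$ is its dimension. The points at infinity of $C$ are the points (over an algebraic closure of $K$) in which the Zariski closure of $C$ in $\mathbb{P}^2_K$ meets the line at infinity $\mathbb{P}^2_K\setminus\mathbb{A}^2_K$. *)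

theory Defs
  imports
    "HOL-Analysis.Abstract_Topology"
    "HOL-Analysis.Function_Topology"
    "HOL-Library.Extended_Real"
    "HOL-Library.FuncSet"
    "HOL-Library.Poly_Mapping"
    "HOL-Computational_Algebra.Polynomial_Factorial"
    "HOL-Algebra.Algebraic_Closure_Type"
begin

type_synonym ('i, 'k) mpoly = "('i \<Rightarrow>\<^sub>0 nat) \<Rightarrow>\<^sub>0 'k"

definition vars :: "('i, 'k::zero) mpoly \<Rightarrow> 'i set" where
  "vars f = (\<Union>m\<in>Poly_Mapping.keys f. Poly_Mapping.keys m)"

definition homogeneous :: "('i, 'k::zero) mpoly \<Rightarrow> bool" where
  "homogeneous f \<longleftrightarrow>
     (\<exists>d. \<forall>m\<in>Poly_Mapping.keys f. (\<Sum>i\<in>Poly_Mapping.keys m. Poly_Mapping.lookup m i) = d)"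

(* The map e embeds the field of coefficients into the field of the coordinates. *)
definition eval_mpoly ::
    "('k::zero \<Rightarrow> 'l::comm_semiring_1) \<Rightarrow> ('i \<Rightarrow> 'l) \<Rightarrow> ('i, 'k) mpoly \<Rightarrow> 'l" where
  "eval_mpoly e x f =
     (\<Sum>m\<in>Poly_Mapping.keys f.
        e (Poly_Mapping.lookup f m) *
        (\<Prod>i\<in>Poly_Mapping.keys m. x i ^ Poly_Mapping.lookup m i))"

definition irreducible_top :: "'a topology \<Rightarrow> bool" where
  "irreducible_top T \<longleftrightarrow>
     topspace T \<noteq> {} \<and>
     (\<forall>A B. closedin T A \<longrightarrow> closedin T B \<longrightarrow> A \<union> B = topspace T \<longrightarrow>
        A = topspace T \<or> B = topspace T)"

(* The empty space has dimension -\<infinity>. *)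
definition krull_dim :: "'a topology \<Rightarrow> ereal" where
  "krull_dim T =
     (SUP n \<in> {n. \<exists>Z :: nat \<Rightarrow> 'a set.
                  (\<forall>i\<le>n. closedin T (Z i) \<and> irreducible_top (subtopology T (Z i))) \<and>
                  (\<forall>i<n. Z i \<subset> Z (Suc i))}.
        ereal (real n))"

text \<open>
  A variety over a field \<open>k\<close> is represented by its set of points over an algebraically closed
  extension \<open>l\<close> of \<open>k\<close>, given by an embedding \<open>e\<close> of \<open>k\<close> into \<open>l\<close>. The Zariski topologies below
  only use polynomials with coefficients in \<open>k\<close>, so that for \<open>l\<close> an algebraic closure of \<open>k\<close> their
  irreducible closed sets correspond to the integral closed subschemes over \<open>k\<close> (which need not be
  geometrically irreducible).
\<close>

definition affine_zariski ::
    "('k::zero \<Rightarrow> 'l::comm_semiring_1) \<Rightarrow> 'i set \<Rightarrow> ('i \<Rightarrow> 'l) topology" where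
  "affine_zariski e I =
     topology_generated_by
       {{x \<in> I \<rightarrow>\<^sub>E UNIV. eval_mpoly e x f \<noteq> 0} | f. vars f \<subseteq> I}"

definition quasi_affine ::
    "('k::zero \<Rightarrow> 'l::comm_semiring_1) \<Rightarrow> 'i set \<Rightarrow> ('i \<Rightarrow> 'l) set \<Rightarrow> bool" where
  "quasi_affine e I V \<longleftrightarrow>
     (\<exists>A U. closedin (affine_zariski e I) A \<and> openin (affine_zariski e I) U \<and> V = A \<inter> U)"

definition variety_dim ::
    "('k::zero \<Rightarrow> 'l::comm_semiring_1) \<Rightarrow> 'i set \<Rightarrow> ('i \<Rightarrow> 'l) set \<Rightarrow> ereal" where
  "variety_dim e I V = krull_dim (subtopology (affine_zariski e I) V)"

definition irreducible_curve ::
    "('k::zero \<Rightarrow> 'l::comm_semiring_1) \<Rightarrow> 'i set \<Rightarrow> ('i \<Rightarrow> 'l) set \<Rightarrow> bool" where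
  "irreducible_curve e I C \<longleftrightarrow>
     quasi_affine e I C \<and>
     irreducible_top (subtopology (affine_zariski e I) C) \<and>
     variety_dim e I C = 1"

definition proj_rel :: "nat \<Rightarrow> ((nat \<Rightarrow> 'l::field) \<times> (nat \<Rightarrow> 'l)) set" where
  "proj_rel n =
     {(v, w). v \<in> {..n} \<rightarrow>\<^sub>E UNIV \<and> (\<exists>i\<le>n. v i \<noteq> 0) \<and>
              (\<exists>c. c \<noteq> 0 \<and> w = (\<lambda>i\<in>{..n}. c * v i))}"

definition proj_space :: "nat \<Rightarrow> (nat \<Rightarrow> 'l::field) set set" where
  "proj_space n = {v \<in> {..n} \<rightarrow>\<^sub>E UNIV. \<exists>i\<le>n. v i \<noteq> 0} // proj_rel n"

definition proj_zariski :: "('k::zero \<Rightarrow> 'l::field) \<Rightarrow> nat \<Rightarrow> (nat \<Rightarrow> 'l) set topology" where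
  "proj_zariski e n =
     topology_generated_by
       {{P \<in> proj_space n. \<forall>v\<in>P. eval_mpoly e v f \<noteq> 0} | f. vars f \<subseteq> {..n} \<and> homogeneous f}"

definition affine_to_proj :: "nat \<Rightarrow> (nat \<Rightarrow> 'l::field) \<Rightarrow> (nat \<Rightarrow> 'l) set" where
  "affine_to_proj n x = proj_rel n `` {\<lambda>i\<in>{..n}. if i < n then x i else 1}"

definition points_at_infinity ::
    "('k::zero \<Rightarrow> 'l::field) \<Rightarrow> nat \<Rightarrow> (nat \<Rightarrow> 'l) set \<Rightarrow> (nat \<Rightarrow> 'l) set set" where
  "points_at_infinity e n V =
     (proj_zariski e n) closure_of (affine_to_proj n ` V) \<inter>
     (proj_space n - affine_to_proj n ` ({..<n} \<rightarrow>\<^sub>E UNIV))"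

type_synonym Ct = "complex poly fract"

text \<open>
  The points of \<open>V(b)\<close>, for \<open>V\<close> in affine \<open>n\<close>-space over \<open>\<complex>(t)\<close>, as a subset of affine
  \<open>n b\<close>-space over \<open>\<complex>\<close>: the coordinate with index \<open>(i, j)\<close> is the coefficient of \<open>t\<close> to the
  \<open>j\<close> in the \<open>i\<close>-th polynomial. For \<open>b \<ge> 1\<close>, the condition on \<open>degree\<close> includes the zero
  polynomial, as \<open>degree 0 = 0\<close>.
\<close>

definition bounded_integral_points ::
    "nat \<Rightarrow> (nat \<Rightarrow> Ct alg_closure) set \<Rightarrow> nat \<Rightarrow> (nat \<times> nat \<Rightarrow> complex) set" where
  "bounded_integral_points n V b =
     {\<lambda>ij\<in>{..<n} \<times> {..<b}. Polynomial.coeff (a (fst ij)) (snd ij) | a :: nat \<Rightarrow> complex poly.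
        (\<forall>i<n. Polynomial.degree (a i) < b) \<and>
        (\<lambda>i\<in>{..<n}. to_ac (to_fract (a i))) \<in> V}"

definition dim_bounded_integral_points ::
    "nat \<Rightarrow> (nat \<Rightarrow> Ct alg_closure) set \<Rightarrow> nat \<Rightarrow> ereal" where
  "dim_bounded_integral_points n V b =
     variety_dim (\<lambda>c::complex. c) ({..<n} \<times> {..<b}) (bounded_integral_points n V b)"

end

theory Submission
  imports Defs "HOL-Computational_Algebra.Field_as_Ring"
begin

text \<open>
  If \<open>C(b)\<close> had a chain of irreducible closed subsets of length two, then an ultrapower of \<open>\<complex>(t)\<close>
  would contain a point of \<open>C\<close> with coordinates polynomial in \<open>t\<close>, whose coefficients lie in an
  extension \<open>F\<close> of \<open>\<complex>\<close> and generate a field of transcendence degree at least two over \<open>\<complex>\<close>. Every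
  valuation ring \<open>V\<close> of \<open>F\<close> over \<open>\<complex>\<close> has a Gauss extension \<open>W\<close>, trivial on \<open>\<complex>(t)\<close>, and if a
  coefficient has a pole at \<open>V\<close>, then \<open>W\<close> is centred at a point at infinity of \<open>C\<close>. This point is
  rational over \<open>\<complex>(t)\<close>. As \<open>C\<close> has a second point at infinity, the points at infinity split into
  two nonempty parts, and Runge's method gives regular functions \<open>\<Phi>\<close> and \<open>\<Psi>\<close> on \<open>C\<close> such that at
  every place at infinity one of them vanishes and the other one has a pole.

  If all coefficients of the value of \<open>\<Phi>\<close>, as a polynomial in \<open>t\<close>, were algebraic over \<open>\<complex>\<close>, this
  value could neither have a pole nor vanish at any \<open>W\<close>, so that no place would be at infinity and
  all coefficients of the point would be constant. The same argument over the field generated by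
  a transcendental coefficient of \<open>\<Phi>\<close> shows that \<open>\<Psi>\<close> has a coefficient algebraically independent
  of it. Hence there is a \<open>V\<close> at which both have poles, and then \<open>\<Phi>\<close> and \<open>\<Psi>\<close> both have poles at
  \<open>W\<close>, a contradiction.
\<close>

section \<open>Valuation rings\<close>

text \<open>The points at infinity of \<open>C\<close> may be conjugate over \<complex>(t). Then the
  equation f(0, z) = 0 of these points may be irreducible over \<complex>(t), and Runge's method has
  nothing to separate. This is why one rational point is found first: its root is split off with
  full multiplicity, and the second point at infinity makes the cofactor nonconstant. A generic
  point would need function fields and valuations moving between types. The ultrapower is one field
  containing \<complex>(t) and all coefficients, so subrings, subfields and valuation rings are
  plain subsets of it. Algebraic dependence is measured by valuations as well: x is algebraic over k
  iff every valuation ring containing k contains x. The coordinates x - c y and y, with c outside a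
  finite set, make y integral over \<complex>(t)[x - c y] and keep the points at infinity off the
  line x = c y, so that the single chart s = 1/(x - c y), z = y/(x - c y) shows all of infinity as s
  = 0.\<close>

definition ring_set :: "'a::comm_ring_1 set \<Rightarrow> bool" where
  "ring_set R \<longleftrightarrow> 1 \<in> R \<and> (\<forall>x\<in>R. \<forall>y\<in>R. x - y \<in> R \<and> x * y \<in> R)"

definition ideal_set :: "'a::comm_ring_1 set \<Rightarrow> 'a set \<Rightarrow> bool" where
  "ideal_set R I \<longleftrightarrow> I \<subseteq> R \<and> 0 \<in> I \<and> (\<forall>a\<in>I. \<forall>b\<in>I. a + b \<in> I) \<and> (\<forall>r\<in>R. \<forall>a\<in>I. r * a \<in> I)"

definition field_set :: "'a::field set \<Rightarrow> bool" where
  "field_set k \<longleftrightarrow> ring_set k \<and> (\<forall>x\<in>k. inverse x \<in> k)"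

definition polys_over :: "'a::zero set \<Rightarrow> 'a poly set" where
  "polys_over S = {p. \<forall>i. coeff p i \<in> S}"

lemma ring_set_one: "ring_set R \<Longrightarrow> 1 \<in> R"
  and ring_set_diff: "ring_set R \<Longrightarrow> x \<in> R \<Longrightarrow> y \<in> R \<Longrightarrow> x - y \<in> R"
  and ring_set_mult: "ring_set R \<Longrightarrow> x \<in> R \<Longrightarrow> y \<in> R \<Longrightarrow> x * y \<in> R"
  by (auto simp: ring_set_def)

lemma ring_set_zero: "ring_set R \<Longrightarrow> 0 \<in> R"
  using ring_set_diff[of R 1 1] ring_set_one[of R] by simp

lemma ring_set_uminus: "ring_set R \<Longrightarrow> x \<in> R \<Longrightarrow> - x \<in> R"
  using ring_set_diff[of R 0 x] ring_set_zero[of R] by simp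

lemma ring_set_add: "ring_set R \<Longrightarrow> x \<in> R \<Longrightarrow> y \<in> R \<Longrightarrow> x + y \<in> R"
  using ring_set_diff[of R x "- y"] ring_set_uminus[of R y] by simp

lemma ring_set_power: "ring_set R \<Longrightarrow> x \<in> R \<Longrightarrow> x ^ n \<in> R"
  by (induction n) (auto simp: ring_set_one ring_set_mult)

lemma ring_set_sum: "ring_set R \<Longrightarrow> (\<And>i. i \<in> A \<Longrightarrow> f i \<in> R) \<Longrightarrow> sum f A \<in> R"
  by (induction A rule: infinite_finite_induct) (auto simp: ring_set_zero ring_set_add)

lemma ring_set_prod: "ring_set R \<Longrightarrow> (\<And>i. i \<in> A \<Longrightarrow> f i \<in> R) \<Longrightarrow> prod f A \<in> R"
  by (induction A rule: infinite_finite_induct) (auto simp: ring_set_one ring_set_mult)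

lemmas ring_set_intros = ring_set_one ring_set_zero ring_set_diff ring_set_mult
  ring_set_uminus ring_set_add ring_set_power ring_set_sum ring_set_prod

lemma ideal_set_subset: "ideal_set R I \<Longrightarrow> x \<in> I \<Longrightarrow> x \<in> R"
  and ideal_set_zero: "ideal_set R I \<Longrightarrow> 0 \<in> I"
  and ideal_set_add: "ideal_set R I \<Longrightarrow> x \<in> I \<Longrightarrow> y \<in> I \<Longrightarrow> x + y \<in> I"
  and ideal_set_mult: "ideal_set R I \<Longrightarrow> r \<in> R \<Longrightarrow> x \<in> I \<Longrightarrow> r * x \<in> I"
  by (auto simp: ideal_set_def)

lemma ideal_set_mult2: "ideal_set R I \<Longrightarrow> r \<in> R \<Longrightarrow> x \<in> I \<Longrightarrow> x * r \<in> I"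
  using ideal_set_mult[of R I r x] by (simp add: mult.commute)

lemma ideal_set_uminus: "ring_set R \<Longrightarrow> ideal_set R I \<Longrightarrow> x \<in> I \<Longrightarrow> - x \<in> I"
  using ideal_set_mult[of R I "-1" x] ring_set_uminus[of R 1] ring_set_one[of R] by simp

lemma ideal_set_diff: "ring_set R \<Longrightarrow> ideal_set R I \<Longrightarrow> x \<in> I \<Longrightarrow> y \<in> I \<Longrightarrow> x - y \<in> I"
  using ideal_set_add[of R I x "- y"] ideal_set_uminus[of R I y] by simp

lemma ideal_set_sum: "ideal_set R I \<Longrightarrow> (\<And>i. i \<in> A \<Longrightarrow> f i \<in> I) \<Longrightarrow> sum f A \<in> I"
  by (induction A rule: infinite_finite_induct) (auto simp: ideal_set_zero ideal_set_add)

lemma ideal_set_power: "ring_set R \<Longrightarrow> ideal_set R I \<Longrightarrow> x \<in> I \<Longrightarrow> n > 0 \<Longrightarrow> x ^ n \<in> I"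
  by (cases n) (auto intro!: ideal_set_mult2 ring_set_power dest: ideal_set_subset)

lemma field_set_ring: "field_set k \<Longrightarrow> ring_set k"
  and field_set_inverse: "field_set k \<Longrightarrow> x \<in> k \<Longrightarrow> inverse x \<in> k"
  by (auto simp: field_set_def)

lemma field_set_divide: "field_set k \<Longrightarrow> x \<in> k \<Longrightarrow> y \<in> k \<Longrightarrow> x / y \<in> k"
  unfolding divide_inverse by (intro ring_set_mult field_set_ring field_set_inverse)

lemma polys_overI: "(\<And>i. coeff p i \<in> S) \<Longrightarrow> p \<in> polys_over S"
  and polys_overD: "p \<in> polys_over S \<Longrightarrow> coeff p i \<in> S"
  by (auto simp: polys_over_def)

lemma polys_over_mono: "A \<subseteq> B \<Longrightarrow> p \<in> polys_over A \<Longrightarrow> p \<in> polys_over B"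
  by (auto simp: polys_over_def)

lemma ring_set_polys_over:
  assumes R: "ring_set R"
  shows "ring_set (polys_over R)"
  unfolding ring_set_def
proof (intro conjI ballI)
  show "1 \<in> polys_over R"
    using ring_set_one[OF R] ring_set_zero[OF R] by (auto simp: polys_over_def)
next
  fix p q assume "p \<in> polys_over R" "q \<in> polys_over R"
  then have "coeff p i \<in> R" "coeff q i \<in> R" for i by (auto dest: polys_overD)
  then show "p - q \<in> polys_over R" "p * q \<in> polys_over R"
    by (auto simp: polys_over_def coeff_mult intro!: ring_set_sum[OF R] ring_set_mult[OF R] ring_set_diff[OF R])
qed

lemma poly_altdef_le: "degree p \<le> n \<Longrightarrow> poly p (x::'a::comm_semiring_1) = (\<Sum>i\<le>n. coeff p i * x ^ i)"
  unfolding poly_altdef by (intro sum.mono_neutral_left) (auto simp: coeff_eq_0)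

lemma polys_over_const: "ring_set R \<Longrightarrow> a \<in> R \<Longrightarrow> [:a:] \<in> polys_over R"
  by (auto simp: polys_over_def coeff_pCons split: nat.splits intro: ring_set_intros)

lemma polys_over_pCons: "p \<in> polys_over S \<Longrightarrow> a \<in> S \<Longrightarrow> pCons a p \<in> polys_over S"
  by (auto simp: polys_over_def coeff_pCons split: nat.splits)

lemma polys_over_monom: "0 \<in> S \<Longrightarrow> a \<in> S \<Longrightarrow> monom a n \<in> polys_over S"
  by (auto simp: polys_over_def)

lemma polys_over_smult: "ring_set R \<Longrightarrow> a \<in> R \<Longrightarrow> p \<in> polys_over R \<Longrightarrow> smult a p \<in> polys_over R"
  by (auto simp: polys_over_def intro: ring_set_intros)

lemma polys_over_reflect: "0 \<in> S \<Longrightarrow> p \<in> polys_over S \<Longrightarrow> reflect_poly p \<in> polys_over S"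
  by (auto simp: polys_over_def coeff_reflect_poly)

lemma poly_in_ring_set: "ring_set R \<Longrightarrow> p \<in> polys_over R \<Longrightarrow> x \<in> R \<Longrightarrow> poly p x \<in> R"
  unfolding poly_altdef by (intro ring_set_intros polys_overD)

lemma ideal_set_polys_over:
  assumes I: "ideal_set R I"
  shows "ideal_set (polys_over R) (polys_over I)"
  unfolding ideal_set_def[of "polys_over R"]
proof (intro conjI ballI)
  show "polys_over I \<subseteq> polys_over R"
    using ideal_set_subset[OF I] by (auto simp: polys_over_def)
  show "0 \<in> polys_over I" using ideal_set_zero[OF I] by (auto simp: polys_over_def)
next
  fix p q assume "p \<in> polys_over I" "q \<in> polys_over I"
  then show "p + q \<in> polys_over I" by (auto simp: polys_over_def intro: ideal_set_add[OF I])
next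
  fix p q assume "p \<in> polys_over R" "q \<in> polys_over I"
  then have "coeff p i \<in> R" "coeff q i \<in> I" for i by (auto dest: polys_overD)
  then show "p * q \<in> polys_over I"
    by (auto simp: polys_over_def coeff_mult intro!: ideal_set_sum[OF I] ideal_set_mult[OF I])
qed

lemma ring_set_image_poly:
  assumes "ring_set A"
  shows "ring_set ((\<lambda>p. poly p x) ` A)"
  unfolding ring_set_def
proof (intro conjI ballI)
  show "1 \<in> (\<lambda>p. poly p x) ` A"
    using ring_set_one[OF assms] by (intro image_eqI[of _ _ 1]) auto
next
  fix u v assume "u \<in> (\<lambda>p. poly p x) ` A" "v \<in> (\<lambda>p. poly p x) ` A"
  then obtain p q where pq: "p \<in> A" "q \<in> A" "u = poly p x" "v = poly q x" by auto
  show "u - v \<in> (\<lambda>p. poly p x) ` A"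
    using pq by (intro image_eqI[of _ _ "p - q"]) (auto intro: ring_set_diff[OF assms])
  show "u * v \<in> (\<lambda>p. poly p x) ` A"
    using pq by (intro image_eqI[of _ _ "p * q"]) (auto intro: ring_set_mult[OF assms])
qed

lemma ideal_set_image_poly:
  assumes "ideal_set A J"
  shows "ideal_set ((\<lambda>p. poly p x) ` A) ((\<lambda>p. poly p x) ` J)"
  unfolding ideal_set_def
proof (intro conjI ballI)
  show "(\<lambda>p. poly p x) ` J \<subseteq> (\<lambda>p. poly p x) ` A"
    using ideal_set_subset[OF assms] by auto
  show "0 \<in> (\<lambda>p. poly p x) ` J"
    using ideal_set_zero[OF assms] by (intro image_eqI[of _ _ 0]) auto
next
  fix u v assume "u \<in> (\<lambda>p. poly p x) ` J" "v \<in> (\<lambda>p. poly p x) ` J"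
  then obtain p q where pq: "p \<in> J" "q \<in> J" "u = poly p x" "v = poly q x" by auto
  show "u + v \<in> (\<lambda>p. poly p x) ` J"
    using pq by (intro image_eqI[of _ _ "p + q"]) (auto intro: ideal_set_add[OF assms])
next
  fix u v assume "u \<in> (\<lambda>p. poly p x) ` A" "v \<in> (\<lambda>p. poly p x) ` J"
  then obtain p q where pq: "p \<in> A" "q \<in> J" "u = poly p x" "v = poly q x" by auto
  show "u * v \<in> (\<lambda>p. poly p x) ` J"
    using pq by (intro image_eqI[of _ _ "p * q"]) (auto intro: ideal_set_mult[OF assms])
qed

section \<open>Chevalley's extension theorem\<close>

definition valuation_ring :: "'a::field set \<Rightarrow> bool" where
  "valuation_ring V \<longleftrightarrow> ring_set V \<and> (\<forall>x. x \<in> V \<or> inverse x \<in> V)"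

text \<open>For a valuation ring these are the nonunits of \<open>V\<close>: a nonzero element whose
  inverse is outside \<open>V\<close> lies in \<open>V\<close> itself. Since
  \<open>inverse 0 = 0\<close>, zero is listed apart.\<close>

definition max_ideal :: "'a::field set \<Rightarrow> 'a set" where
  "max_ideal V = {x. x = 0 \<or> inverse x \<notin> V}"

text \<open>Chevalley's argument. If neither \<open>x\<close> nor \<open>inverse x\<close> is in
  \<open>V\<close>, maximality forces \<open>m\<close> to generate the unit ideal in V[x] and in
  V[1/x]; of two such relations of least degree, the shorter one lowers the degree of the longer
  one.\<close>

lemma maximal_pair_valuation_ring:
  fixes V m :: "'a::field set"
  assumes R: "ring_set V" and I: "ideal_set V m" and one: "1 \<notin> m"
    and maxi: "\<And>V' m'. ring_set V' \<Longrightarrow> ideal_set V' m' \<Longrightarrow> 1 \<notin> m' \<Longrightarrow> V \<subseteq> V' \<Longrightarrow> m \<subseteq> m' \<Longrightarrow> V' = V"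
  shows "valuation_ring V"
proof -
  define E where "E x n \<longleftrightarrow> (\<exists>p\<in>polys_over m. degree p \<le> n \<and> poly p x = 1)" for x n
  have ext: "\<exists>n. E x n" if "x \<notin> V" for x
  proof (rule ccontr)
    assume no: "\<nexists>n. E x n"
    let ?V = "(\<lambda>p. poly p x) ` polys_over V" and ?m = "(\<lambda>p. poly p x) ` polys_over m"
    have "1 \<notin> ?m" using no unfolding E_def by (metis imageE order_refl)
    moreover have "V \<subseteq> ?V"
    proof
      fix a assume "a \<in> V"
      then show "a \<in> ?V" using polys_over_const[OF R] by (intro image_eqI[of _ _ "[:a:]"]) auto
    qed
    moreover have "m \<subseteq> ?m"
    proof
      fix a assume "a \<in> m"
      then have "[:a:] \<in> polys_over m"
        using ideal_set_zero[OF I] by (auto simp: polys_over_def coeff_pCons split: nat.splits)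
      then show "a \<in> ?m" by (intro image_eqI[of _ _ "[:a:]"]) auto
    qed
    moreover have "ring_set ?V" "ideal_set ?V ?m"
      using ring_set_image_poly[OF ring_set_polys_over[OF R]]
        ideal_set_image_poly[OF ideal_set_polys_over[OF I]] by blast+
    ultimately have "?V = V" by (intro maxi)
    moreover have "x \<in> ?V"
      using polys_over_pCons[OF polys_over_const[OF R ring_set_one[OF R]] ring_set_zero[OF R]]
      by (intro image_eqI[of _ _ "[:0, 1:]"]) auto
    ultimately show False using that by simp
  qed
  \<comment> \<open>A relation for 1/u, where u = 1 - a, multiplied by u^n puts u^n into
    \<open>m\<close>, although u^n is 1 modulo \<open>m\<close>.\<close>
  have unit: "inverse (1 - a) \<in> V" if a: "a \<in> m" for a
  proof (rule ccontr)
    assume "inverse (1 - a) \<notin> V"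
    then obtain n p where p: "p \<in> polys_over m" "degree p \<le> n" "poly p (inverse (1 - a)) = 1"
      using ext unfolding E_def by blast
    define u where "u = 1 - a"
    have u: "u \<in> V" "u \<noteq> 0"
      using a one ideal_set_subset[OF I] R by (auto simp: u_def intro: ring_set_intros)
    have "u ^ n = u ^ n * poly p (inverse u)" using p by (simp add: u_def)
    also have "\<dots> = (\<Sum>i\<le>degree p. coeff p i * u ^ (n - i))"
      unfolding poly_altdef sum_distrib_left
    proof (intro sum.cong refl)
      fix i assume "i \<in> {..degree p}"
      then have "i \<le> n" using p by auto
      then show "u ^ n * (coeff p i * inverse u ^ i) = coeff p i * u ^ (n - i)"
        using u by (simp add: power_diff field_simps)
    qed
    also have "\<dots> \<in> m"
      by (intro ideal_set_sum[OF I] ideal_set_mult2[OF I] polys_overD[OF p(1)]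
          ring_set_power[OF R] u)
    finally have un: "u ^ n \<in> m" .
    have "1 - u ^ n \<in> m"
    proof -
      have "1 - u ^ n = (1 - u) * (\<Sum>i<n. u ^ i)" by (rule one_diff_power_eq)
      also have "\<dots> \<in> m" unfolding u_def
        using a u by (intro ideal_set_mult2[OF I] ring_set_sum[OF R] ring_set_power[OF R])
          (auto simp: u_def)
      finally show ?thesis .
    qed
    then have "1 - u ^ n + u ^ n \<in> m" using un by (rule ideal_set_add[OF I])
    then show False using one by simp
  qed
  \<comment> \<open>The constant term of the relation for 1/x is absorbed, as 1 minus an element of
    \<open>m\<close> is a unit. The relation then expresses x^n by lower powers and replaces the
    leading term of the relation for x.\<close>
  have reduce: "E x (n - 1)" if x: "x \<noteq> 0" and En: "E x n" and Ek: "E (inverse x) k" and kn: "k \<le> n" for x n k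
  proof (cases n)
    case 0
    then show ?thesis using En by simp
  next
    case (Suc n')
    from En obtain p where p: "p \<in> polys_over m" "degree p \<le> n" "poly p x = 1"
      unfolding E_def by auto
    from Ek obtain q where q: "q \<in> polys_over m" "degree q \<le> k" "poly q (inverse x) = 1"
      unfolding E_def by auto
    define c where "c = inverse (1 - coeff q 0)"
    have q0: "coeff q 0 \<in> m" using q by (auto intro: polys_overD)
    have c: "c \<in> V" "1 - coeff q 0 \<noteq> 0" using unit[OF q0] q0 one by (auto simp: c_def)
    have "1 = (\<Sum>j\<le>k. coeff q j * inverse x ^ j)"
      using q by (simp add: poly_altdef_le[OF q(2)])
    also have "\<dots> = coeff q 0 + (\<Sum>j\<in>{1..k}. coeff q j * inverse x ^ j)"
      by (simp add: atMost_atLeast0 sum.atLeast_Suc_atMost)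
    finally have "1 - coeff q 0 = (\<Sum>j\<in>{1..k}. coeff q j * inverse x ^ j)" by (rule diff_eq_eq[THEN iffD2, OF trans]) simp
    then have "1 = c * (\<Sum>j\<in>{1..k}. coeff q j * inverse x ^ j)"
      using c(2) unfolding c_def by (metis left_inverse)
    then have "x ^ n = x ^ n * (c * (\<Sum>j\<in>{1..k}. coeff q j * inverse x ^ j))" by simp
    also have "\<dots> = (\<Sum>j\<in>{1..k}. c * coeff q j * x ^ (n - j))"
      unfolding sum_distrib_left
    proof (intro sum.cong refl)
      fix j assume "j \<in> {1..k}"
      then have "j \<le> n" using kn by auto
      then show "x ^ n * (c * (coeff q j * inverse x ^ j)) = c * coeff q j * x ^ (n - j)"
        using x by (simp add: power_diff field_simps)
    qed
    finally have xn: "x ^ n = (\<Sum>j\<in>{1..k}. c * coeff q j * x ^ (n - j))" .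
    define p' where "p' = p - monom (coeff p n) n + (\<Sum>j\<in>{1..k}. monom (coeff p n * (c * coeff q j)) (n - j))"
    have "poly p' x = poly p x - coeff p n * x ^ n + coeff p n * x ^ n"
      by (subst (2) xn) (simp add: p'_def poly_monom poly_sum sum_distrib_left mult.assoc)
    then have "poly p' x = 1" using p by simp
    moreover have "coeff p' i \<in> m" for i
    proof -
      have "c * coeff q j \<in> V" "coeff p j \<in> m" for j
        using ring_set_mult[OF R c(1) ideal_set_subset[OF I polys_overD[OF q(1)]]] polys_overD[OF p(1)]
        by auto
      then show ?thesis
        unfolding p'_def coeff_add coeff_diff coeff_sum coeff_monom
        by (intro ideal_set_add[OF I] ideal_set_diff[OF R I] ideal_set_sum[OF I])
          (simp_all add: ideal_set_zero[OF I] ideal_set_mult2[OF I])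
    qed
    moreover have "degree p' \<le> n - 1"
    proof (rule degree_le, intro allI impI)
      fix i assume i: "n - 1 < i"
      have "coeff p i - (if n = i then coeff p n else 0) = 0"
        using i p(2) by (auto simp: coeff_eq_0)
      then show "coeff p' i = 0"
        unfolding p'_def coeff_add coeff_diff coeff_sum coeff_monom using i kn
        by (auto intro!: sum.neutral)
    qed
    ultimately show ?thesis unfolding E_def by (auto intro: polys_overI)
  qed
  have E0: "\<not> E x 0" for x
  proof
    assume "E x 0"
    then obtain p where "p \<in> polys_over m" "degree p = 0" "poly p x = 1" by (auto simp: E_def)
    then show False using one by (metis coeff_pCons_0 degree_eq_zeroE poly_const_conv polys_overD)
  qed
  have "x \<in> V \<or> inverse x \<in> V" for x
  proof (rule ccontr)
    assume "\<not> (x \<in> V \<or> inverse x \<in> V)"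
    then have nin: "x \<notin> V" "inverse x \<notin> V" by auto
    define n where "n = (LEAST n. E x n)"
    define k where "k = (LEAST n. E (inverse x) n)"
    have En: "E x n" and Ek: "E (inverse x) k"
      unfolding n_def k_def using ext[OF nin(1)] ext[OF nin(2)] by (auto intro: LeastI_ex)
    have x: "x \<noteq> 0" using nin ring_set_zero[OF R] by auto
    have "n > 0" "k > 0" using E0 En Ek by (metis gr0I)+
    show False
    proof (cases "k \<le> n")
      case True
      then have "E x (n - 1)" using reduce[OF x En Ek] by simp
      then show False using \<open>n > 0\<close> not_less_Least[of "n - 1" "E x"] by (simp add: n_def)
    next
      case False
      then have "E (inverse x) (k - 1)" using reduce[of "inverse x" k n] x En Ek by simp
      then show False using \<open>k > 0\<close> not_less_Least[of "k - 1" "E (inverse x)"] by (simp add: k_def)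
    qed
  qed
  then show ?thesis using R by (simp add: valuation_ring_def)
qed

text \<open>Zorn's lemma for pairs of a ring and a proper ideal. In the maximal pair no element of
  the ideal is a unit, so the ideal lies in \<open>max_ideal V\<close>.\<close>

lemma exists_valuation_ring:
  fixes R I :: "'a::field set"
  assumes R: "ring_set R" and I: "ideal_set R I" and one: "1 \<notin> I"
  obtains V where "valuation_ring V" "R \<subseteq> V" "I \<subseteq> max_ideal V"
proof -
  \<comment> \<open>A pair is coded as one set of elements tagged with a Boolean, so that the order
    on pairs is inclusion of sets.\<close>
  define r where "r S = {x::'a. (x, True) \<in> S}" for S
  define i where "i S = {x::'a. (x, False) \<in> S}" for S
  define Fam where "Fam = {S. ring_set (r S) \<and> ideal_set (r S) (i S) \<and> 1 \<notin> i S \<and> R \<subseteq> r S \<and> I \<subseteq> i S}"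
  define pr where "pr A B = A \<times> {True} \<union> B \<times> {False}" for A B :: "'a set"
  have pr: "r (pr A B) = A" "i (pr A B) = B" for A B by (auto simp: r_def i_def pr_def)
  have pr': "S \<subseteq> pr (r S) (i S)" for S
  proof
    fix y assume "y \<in> S"
    then show "y \<in> pr (r S) (i S)" by (cases y; cases "snd y") (auto simp: pr_def r_def i_def)
  qed
  have ri_mono: "r S \<subseteq> r S'" "i S \<subseteq> i S'" if "S \<subseteq> S'" for S S'
    using that by (auto simp: r_def i_def)
  have "\<exists>M\<in>Fam. \<forall>N\<in>Fam. M \<subseteq> N \<longrightarrow> N = M"
  proof (rule subset_Zorn_nonempty)
    show "Fam \<noteq> {}" using R I one pr unfolding Fam_def by (metis (mono_tags, lifting) empty_Collect_eq subset_refl)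
  next
    fix C assume C: "C \<noteq> {}" "subset.chain Fam C"
    have CF: "\<And>S. S \<in> C \<Longrightarrow> S \<in> Fam" and tot: "\<And>S S'. S \<in> C \<Longrightarrow> S' \<in> C \<Longrightarrow> S \<subseteq> S' \<or> S' \<subseteq> S"
      using C(2) unfolding subset_chain_def by auto
    have rU: "r (\<Union>C) = (\<Union>S\<in>C. r S)" and iU: "i (\<Union>C) = (\<Union>S\<in>C. i S)" by (auto simp: r_def i_def)
    have common: "\<exists>S\<in>C. x \<in> a S \<and> y \<in> b S"
      if xy: "x \<in> (\<Union>S\<in>C. a S)" "y \<in> (\<Union>S\<in>C. b S)" and ab: "a \<in> {r, i}" "b \<in> {r, i}" for x y a b
    proof -
      obtain S S' where S: "S \<in> C" "x \<in> a S" "S' \<in> C" "y \<in> b S'" using xy by blast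
      have mono: "a T \<subseteq> a T'" "b T \<subseteq> b T'" if "T \<subseteq> T'" for T T'
        using ri_mono[OF that] ab by auto
      from tot[OF S(1,3)] show ?thesis
      proof
        assume "S \<subseteq> S'" then show ?thesis using mono(1)[of S S'] S by auto
      next
        assume "S' \<subseteq> S" then show ?thesis using mono(2)[of S' S] S by auto
      qed
    qed
    obtain S0 where S0: "S0 \<in> C" using C(1) by auto
    have F: "ring_set (r S)" "ideal_set (r S) (i S)" "1 \<notin> i S" "R \<subseteq> r S" "I \<subseteq> i S" if "S \<in> C" for S
      using CF[OF that] by (auto simp: Fam_def)
    have sub: "r S \<subseteq> r (\<Union>C)" "i S \<subseteq> i (\<Union>C)" if "S \<in> C" for S
      using that unfolding rU iU by auto
    have "ring_set (r (\<Union>C))"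
      unfolding ring_set_def
    proof (intro conjI ballI)
      show "1 \<in> r (\<Union>C)" using ring_set_one[OF F(1)[OF S0]] sub[OF S0] by auto
    next
      fix x y assume "x \<in> r (\<Union>C)" "y \<in> r (\<Union>C)"
      then obtain S where S: "S \<in> C" "x \<in> r S" "y \<in> r S" using common[of x r y r] unfolding rU by auto
      then show "x - y \<in> r (\<Union>C)" "x * y \<in> r (\<Union>C)"
        using sub[OF S(1)] F(1)[OF S(1)] by (auto intro: ring_set_diff ring_set_mult)
    qed
    moreover have "ideal_set (r (\<Union>C)) (i (\<Union>C))"
      unfolding ideal_set_def
    proof (intro conjI ballI)
      show "i (\<Union>C) \<subseteq> r (\<Union>C)" unfolding rU iU using ideal_set_subset[OF F(2)] by (intro UN_mono) auto
      show "0 \<in> i (\<Union>C)" using ideal_set_zero[OF F(2)[OF S0]] sub[OF S0] by auto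
    next
      fix x y assume "x \<in> i (\<Union>C)" "y \<in> i (\<Union>C)"
      then obtain S where S: "S \<in> C" "x \<in> i S" "y \<in> i S" using common[of x i y i] unfolding iU by auto
      then show "x + y \<in> i (\<Union>C)"
        using sub[OF S(1)] F(2)[OF S(1)] by (auto intro: ideal_set_add)
    next
      fix x y assume "x \<in> r (\<Union>C)" "y \<in> i (\<Union>C)"
      then obtain S where S: "S \<in> C" "x \<in> r S" "y \<in> i S" using common[of x r y i] unfolding rU iU by auto
      then show "x * y \<in> i (\<Union>C)"
        using sub[OF S(1)] F(2)[OF S(1)] by (auto intro: ideal_set_mult)
    qed
    moreover have "1 \<notin> i (\<Union>C)" using F(3) unfolding iU by auto
    moreover have "R \<subseteq> r (\<Union>C)" "I \<subseteq> i (\<Union>C)" by (rule order_trans[OF F(4)[OF S0] sub(1)[OF S0]], rule order_trans[OF F(5)[OF S0] sub(2)[OF S0]])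
    ultimately show "\<Union>C \<in> Fam" by (simp add: Fam_def)
  qed
  then obtain M where M: "M \<in> Fam" "\<And>N. N \<in> Fam \<Longrightarrow> M \<subseteq> N \<Longrightarrow> N = M" by blast
  have MF: "ring_set (r M)" "ideal_set (r M) (i M)" "1 \<notin> i M" "R \<subseteq> r M" "I \<subseteq> i M"
    using M(1) by (auto simp: Fam_def)
  have "valuation_ring (r M)"
  proof (rule maximal_pair_valuation_ring[OF MF(1-3)])
    fix V' m' assume *: "ring_set V'" "ideal_set V' m'" "1 \<notin> m'" "r M \<subseteq> V'" "i M \<subseteq> m'"
    have "pr V' m' \<in> Fam" using * MF unfolding Fam_def by (auto simp: pr)
    moreover have "M \<subseteq> pr V' m'" using order_trans[OF pr'[of M], of "pr V' m'"] *(4,5) by (auto simp: pr_def)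
    ultimately show "V' = r M" using M(2) pr(1) by metis
  qed
  moreover have "I \<subseteq> max_ideal (r M)"
  proof
    fix x assume "x \<in> I"
    then have x: "x \<in> i M" using MF by auto
    show "x \<in> max_ideal (r M)"
    proof (rule ccontr)
      assume "x \<notin> max_ideal (r M)"
      then have "x \<noteq> 0" "inverse x \<in> r M" by (auto simp: max_ideal_def)
      then show False using ideal_set_mult[OF MF(2) _ x, of "inverse x"] MF(3) by simp
    qed
  qed
  ultimately show thesis using MF(4) that by blast
qed

lemma valuation_ring_ring: "valuation_ring V \<Longrightarrow> ring_set V"
  by (simp add: valuation_ring_def)

lemma valuation_ring_inverse: "valuation_ring V \<Longrightarrow> x \<notin> V \<Longrightarrow> inverse x \<in> V"
  by (auto simp: valuation_ring_def)

lemma max_ideal_subset: "valuation_ring V \<Longrightarrow> x \<in> max_ideal V \<Longrightarrow> x \<in> V"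
  by (auto simp: valuation_ring_def max_ideal_def intro: ring_set_zero)

lemma inverse_max_ideal: "valuation_ring V \<Longrightarrow> x \<notin> V \<Longrightarrow> inverse x \<in> max_ideal V"
  by (auto simp: max_ideal_def)

lemma one_notin_max_ideal: "valuation_ring V \<Longrightarrow> 1 \<notin> max_ideal V"
  by (auto simp: max_ideal_def valuation_ring_def ring_set_one)

lemma ideal_max_ideal:
  assumes V: "valuation_ring V"
  shows "ideal_set V (max_ideal V)"
  unfolding ideal_set_def
proof (intro conjI ballI)
  note R = valuation_ring_ring[OF V]
  show "max_ideal V \<subseteq> V" using max_ideal_subset[OF V] by auto
  show "0 \<in> max_ideal V" by (simp add: max_ideal_def)
  have mult: "r * x \<in> max_ideal V" if "r \<in> V" "x \<in> max_ideal V" for r x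
  proof (rule ccontr)
    assume "r * x \<notin> max_ideal V"
    then have "r * x \<noteq> 0" "inverse (r * x) \<in> V" by (auto simp: max_ideal_def)
    then have "r * inverse (r * x) \<in> V" using that R by (auto intro: ring_set_mult)
    moreover have "r * inverse (r * x) = inverse x" using \<open>r * x \<noteq> 0\<close> by (simp add: field_simps)
    ultimately have "inverse x \<in> V" by (metis (no_types))
    then show False using that(2) \<open>r * x \<noteq> 0\<close> by (auto simp: max_ideal_def)
  qed
  then show "r * x \<in> max_ideal V" if "r \<in> V" "x \<in> max_ideal V" for r x using that .
  have add: "x + y \<in> max_ideal V" if xy: "x \<in> max_ideal V" "y \<in> max_ideal V" "y \<noteq> 0" and d: "x / y \<in> V" for x y
  proof -
    have "x + y = (x / y + 1) * y" using xy by (simp add: field_simps)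
    then show ?thesis using mult[OF ring_set_add[OF R d ring_set_one[OF R]] xy(2)] by simp
  qed
  show "x + y \<in> max_ideal V" if xy: "x \<in> max_ideal V" "y \<in> max_ideal V" for x y
  proof (cases "x = 0 \<or> y = 0")
    case True
    then show ?thesis using xy by auto
  next
    case False
    have "x / y \<in> V \<or> y / x \<in> V"
      using V False unfolding valuation_ring_def by (metis inverse_divide)
    then show ?thesis using add[OF xy] add[OF xy(2,1)] False by (auto simp: add.commute)
  qed
qed

lemma max_ideal_prime:
  assumes V: "valuation_ring V" and xy: "x \<in> V" "y \<in> V" "x * y \<in> max_ideal V"
  shows "x \<in> max_ideal V \<or> y \<in> max_ideal V"
  using xy valuation_ring_ring[OF V] by (auto simp: max_ideal_def intro: ring_set_mult)

lemma poly_at_pole: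
  assumes V: "valuation_ring V" and x: "x \<notin> V" and p: "p \<in> polys_over V" "degree p \<le> n"
  shows "poly p x * inverse x ^ n - coeff p n \<in> max_ideal V"
proof -
  note R = valuation_ring_ring[OF V] and I = ideal_max_ideal[OF V]
  have x0: "x \<noteq> 0" using x ring_set_zero[OF R] by auto
  have "poly p x * inverse x ^ n = (\<Sum>i\<le>n. coeff p i * inverse x ^ (n - i))"
    unfolding poly_altdef_le[OF p(2)] sum_distrib_right
    using x0 by (intro sum.cong) (auto simp: power_diff field_simps)
  also have "\<dots> = (\<Sum>i<n. coeff p i * inverse x ^ (n - i)) + coeff p n"
    by (simp add: lessThan_Suc_atMost[symmetric])
  finally have "poly p x * inverse x ^ n - coeff p n = (\<Sum>i<n. coeff p i * inverse x ^ (n - i))" by simp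
  also have "\<dots> \<in> max_ideal V"
    using inverse_max_ideal[OF V x] polys_overD[OF p(1)]
    by (intro ideal_set_sum[OF I] ideal_set_mult[OF I] ideal_set_power[OF R I]) auto
  finally show ?thesis .
qed

lemma unit_lead_coeff_pole:
  assumes V: "valuation_ring V" and x: "x \<notin> V" and p: "p \<in> polys_over V" "p \<noteq> 0"
    and l: "lead_coeff p \<notin> max_ideal V"
  shows "poly p x \<noteq> 0"
proof
  assume "poly p x = 0"
  then have "- lead_coeff p \<in> max_ideal V" using poly_at_pole[OF V x p(1), of "degree p"] by simp
  then show False
    using ideal_set_uminus[OF valuation_ring_ring[OF V] ideal_max_ideal[OF V]] l by fastforce
qed

lemma field_set_unit:
  assumes "valuation_ring V" "field_set k" "k \<subseteq> V" "x \<in> k" "x \<noteq> 0"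
  shows "x \<notin> max_ideal V"
  using assms field_set_inverse by (auto simp: max_ideal_def)

section \<open>Poles of transcendental elements\<close>

definition alg_over :: "'a::field set \<Rightarrow> 'a \<Rightarrow> bool" where
  "alg_over k x \<longleftrightarrow> (\<exists>p\<in>polys_over k. p \<noteq> 0 \<and> poly p x = 0)"

lemma alg_over_self:
  assumes "field_set k" "x \<in> k"
  shows "alg_over k x"
  unfolding alg_over_def
  using assms by (intro bexI[of _ "[:-x, 1:]"])
    (auto intro!: polys_over_pCons polys_over_const ring_set_intros field_set_ring)

lemma alg_over_in_valuation_ring:
  assumes V: "valuation_ring V" and k: "field_set k" "k \<subseteq> V" and x: "alg_over k x"
  shows "x \<in> V"
proof (rule ccontr)
  assume "x \<notin> V"
  obtain p where p: "p \<in> polys_over k" "p \<noteq> 0" "poly p x = 0" using x by (auto simp: alg_over_def)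
  then have "lead_coeff p \<notin> max_ideal V" by (intro field_set_unit[OF V k] polys_overD) auto
  then show False using unit_lead_coeff_pole[OF V \<open>x \<notin> V\<close> polys_over_mono[OF k(2) p(1)] p(2)] p(3) by simp
qed

lemma alg_over_inverse:
  assumes k: "field_set k" and x: "alg_over k x"
  shows "alg_over k (inverse x)"
proof (cases "x = 0")
  case True
  then show ?thesis using x by simp
next
  case False
  obtain p where p: "p \<in> polys_over k" "p \<noteq> 0" "poly p x = 0" using x by (auto simp: alg_over_def)
  have "poly (reflect_poly p) (inverse x) = 0"
    using p False by (subst poly_reflect_poly_nz) auto
  moreover have "reflect_poly p \<noteq> 0" using p by simp
  moreover have "reflect_poly p \<in> polys_over k"
    using p by (auto intro: polys_over_reflect ring_set_zero field_set_ring[OF k])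
  ultimately show ?thesis unfolding alg_over_def by blast
qed

text \<open>In k[1/x] the element 1/x generates a proper ideal, because x is transcendental; a
  valuation ring whose maximal ideal contains 1/x does not contain x.\<close>

lemma exists_pole:
  assumes k: "field_set k" and x: "\<not> alg_over k x"
  obtains V where "valuation_ring V" "k \<subseteq> V" "x \<notin> V"
proof -
  note R = field_set_ring[OF k]
  define y where "y = inverse x"
  have x0: "x \<noteq> 0" using x alg_over_self[OF k ring_set_zero[OF R]] by auto
  let ?R = "(\<lambda>p. poly p y) ` polys_over k"
  let ?J = "{p \<in> polys_over k. coeff p 0 = 0}"
  have "ideal_set (polys_over k) ?J"
    using ring_set_polys_over[OF R] by (auto simp: ideal_set_def coeff_mult intro: ring_set_intros)
  then have I: "ideal_set ?R ((\<lambda>p. poly p y) ` ?J)" by (rule ideal_set_image_poly)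
  have "1 \<notin> (\<lambda>p. poly p y) ` ?J"
  proof
    assume "1 \<in> (\<lambda>p. poly p y) ` ?J"
    then obtain p where p: "p \<in> polys_over k" "coeff p 0 = 0" "poly p y = 1" by auto
    have "1 - p \<noteq> 0" using p(2) by (auto simp: poly_eq_iff dest: spec[of _ 0])
    moreover have "poly (1 - p) y = 0" using p by simp
    moreover have "1 - p \<in> polys_over k" using p ring_set_polys_over[OF R] by (auto intro: ring_set_intros)
    ultimately have "alg_over k y" unfolding alg_over_def by blast
    then have "alg_over k x" using alg_over_inverse[OF k, of y] by (simp add: y_def)
    then show False using x by simp
  qed
  from exists_valuation_ring[OF ring_set_image_poly[OF ring_set_polys_over[OF R]] I this]
  obtain V where V: "valuation_ring V" "?R \<subseteq> V" "(\<lambda>p. poly p y) ` ?J \<subseteq> max_ideal V" .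
  have "k \<subseteq> V"
  proof
    fix a assume "a \<in> k"
    then have "[:a:] \<in> polys_over k" using polys_over_const[OF R] by auto
    then have "poly [:a:] y \<in> V" using V(2) by blast
    then show "a \<in> V" by simp
  qed
  moreover have "[:0, 1:] \<in> ?J"
    using polys_over_pCons[OF polys_over_const[OF R ring_set_one[OF R]] ring_set_zero[OF R]] by simp
  then have "poly [:0, 1:] y \<in> max_ideal V" using V(3) by blast
  then have "x \<notin> V" using x0 by (auto simp: y_def max_ideal_def)
  ultimately show thesis using V(1) that by blast
qed

text \<open>This criterion carries the whole theory of algebraic dependence below: that algebraic
  elements form a field, and transitivity, follow from valuation rings being rings.\<close>

lemma alg_over_iff:
  assumes "field_set k"
  shows "alg_over k x \<longleftrightarrow> (\<forall>V. valuation_ring V \<longrightarrow> k \<subseteq> V \<longrightarrow> x \<in> V)"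
  using assms by (metis alg_over_in_valuation_ring exists_pole)

lemma field_set_alg_over:
  assumes k: "field_set k"
  shows "field_set {x. alg_over k x}"
  unfolding field_set_def
proof
  show "ring_set {x. alg_over k x}"
    unfolding ring_set_def alg_over_iff[OF k]
    by (auto intro: ring_set_intros valuation_ring_ring)
  show "\<forall>x\<in>{x. alg_over k x}. inverse x \<in> {x. alg_over k x}"
    using alg_over_inverse[OF k] by auto
qed

lemma alg_over_unit:
  assumes V: "valuation_ring V" and k: "field_set k" "k \<subseteq> V" and x: "alg_over k x" "x \<noteq> 0"
  shows "x \<notin> max_ideal V"
  using alg_over_in_valuation_ring[OF V k alg_over_inverse[OF k(1) x(1)]] x(2)
  by (auto simp: max_ideal_def)

definition field_adjoin :: "'a::field set \<Rightarrow> 'a \<Rightarrow> 'a set" where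
  "field_adjoin k a = {poly p a / poly q a | p q. p \<in> polys_over k \<and> q \<in> polys_over k \<and> poly q a \<noteq> 0}"

lemma field_adjoinI:
  "p \<in> polys_over k \<Longrightarrow> q \<in> polys_over k \<Longrightarrow> poly q a \<noteq> 0 \<Longrightarrow> poly p a / poly q a \<in> field_adjoin k a"
  by (auto simp: field_adjoin_def)

lemma field_adjoin_poly:
  assumes "field_set k" "p \<in> polys_over k"
  shows "poly p a \<in> field_adjoin k a"
  using field_adjoinI[OF assms(2), of 1 a] ring_set_one[OF ring_set_polys_over[OF field_set_ring[OF assms(1)]]]
  by simp

lemma field_adjoin_superset: "field_set k \<Longrightarrow> k \<subseteq> field_adjoin k a"
  using field_adjoin_poly[of k "[:_:]" a] polys_over_const field_set_ring by fastforce

lemma field_adjoin_self: "field_set k \<Longrightarrow> a \<in> field_adjoin k a"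
  using field_adjoin_poly[of k "[:0, 1:]" a]
  by (auto intro!: polys_over_pCons polys_over_const field_set_ring ring_set_intros)

lemma field_set_adjoin:
  assumes k: "field_set k"
  shows "field_set (field_adjoin k a)"
proof -
  note P = ring_set_polys_over[OF field_set_ring[OF k]]
  show ?thesis
    unfolding field_set_def ring_set_def
  proof (intro conjI ballI)
    show "1 \<in> field_adjoin k a" using field_adjoin_poly[OF k ring_set_one[OF P], of a] by simp
  next
    fix x y assume "x \<in> field_adjoin k a" "y \<in> field_adjoin k a"
    then obtain p q p' q' where *: "p \<in> polys_over k" "q \<in> polys_over k" "poly q a \<noteq> 0" "x = poly p a / poly q a"
       "p' \<in> polys_over k" "q' \<in> polys_over k" "poly q' a \<noteq> 0" "y = poly p' a / poly q' a"
      unfolding field_adjoin_def by auto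
    have "x - y = poly (p * q' - p' * q) a / poly (q * q') a" using *(3,7) by (simp add: *(4,8) diff_frac_eq)
    also have "\<dots> \<in> field_adjoin k a" using * P by (intro field_adjoinI) (auto intro: ring_set_intros)
    finally show "x - y \<in> field_adjoin k a" .
    have "x * y = poly (p * p') a / poly (q * q') a" by (simp add: *(4,8))
    also have "\<dots> \<in> field_adjoin k a" using * P by (intro field_adjoinI) (auto intro: ring_set_intros)
    finally show "x * y \<in> field_adjoin k a" .
  next
    fix x assume "x \<in> field_adjoin k a"
    then obtain p q where *: "p \<in> polys_over k" "q \<in> polys_over k" "poly q a \<noteq> 0" "x = poly p a / poly q a"
      unfolding field_adjoin_def by auto
    show "inverse x \<in> field_adjoin k a"
    proof (cases "poly p a = 0")
      case True
      then show ?thesis using * field_adjoin_poly[OF k ring_set_zero[OF P], of a] by simp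
    next
      case False
      then show ?thesis using field_adjoinI[OF *(2,1) False] * by simp
    qed
  qed
qed

lemma field_adjoin_least:
  assumes k: "field_set k'" "k \<subseteq> k'" "a \<in> k'"
  shows "field_adjoin k a \<subseteq> k'"
  using k unfolding field_adjoin_def
  by (auto intro!: field_set_divide poly_in_ring_set field_set_ring dest: polys_over_mono)

text \<open>The second pole is created by composing a place trivial on \<open>k(a)\<close> with one of \<open>k(a)\<close>.\<close>

lemma exists_two_poles:
  assumes k: "field_set k" and a: "\<not> alg_over k a" and b: "\<not> alg_over (field_adjoin k a) b"
  obtains V where "valuation_ring V" "k \<subseteq> V" "a \<notin> V" "b \<notin> V"
proof -
  note R = field_set_ring[OF k] and F = field_set_adjoin[OF k, of a]
  obtain W where W: "valuation_ring W" "field_adjoin k a \<subseteq> W" "b \<notin> W"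
    using exists_pole[OF F b] .
  note RW = valuation_ring_ring[OF W(1)] and IW = ideal_max_ideal[OF W(1)]
  define y where "y = inverse a"
  have a0: "a \<noteq> 0" using a alg_over_self[OF k ring_set_zero[OF R]] by auto
  have polyF: "poly p y \<in> field_adjoin k a" if "p \<in> polys_over k" for p
    using that field_adjoin_self[OF k, of a] field_adjoin_superset[OF k, of a]
    by (auto simp: y_def intro!: poly_in_ring_set field_set_ring[OF F] field_set_inverse[OF F]
        dest: polys_over_mono)
  \<comment> \<open>The preimage of k[1/a] under the residue map of \<open>W\<close>, which is
    injective on k(a); \<open>?I\<close> is the preimage of the ideal generated by 1/a.\<close>
  let ?R = "{poly p y + m | p m. p \<in> polys_over k \<and> m \<in> max_ideal W}"
  let ?I = "{poly p y + m | p m. p \<in> polys_over k \<and> coeff p 0 = 0 \<and> m \<in> max_ideal W}"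
  note P = ring_set_polys_over[OF R]
  have prod: "poly p y * m' + poly p' y * m + m * m' \<in> max_ideal W"
    if "p \<in> polys_over k" "p' \<in> polys_over k" "m \<in> max_ideal W" "m' \<in> max_ideal W" for p p' m m'
    using that polyF[of p] polyF[of p'] W(2) max_ideal_subset[OF W(1), of m]
    by (intro ideal_set_add[OF IW] ideal_set_mult[OF IW]) auto
  have mult: "(poly p y + m) * (poly p' y + m') = poly (p * p') y + (poly p y * m' + poly p' y * m + m * m')"
    for p p' m m' by (simp add: algebra_simps)
  have "ring_set ?R"
    unfolding ring_set_def
  proof (intro conjI ballI)
    have "1 = poly 1 y + 0" "(0::'a) \<in> max_ideal W" by (simp_all add: max_ideal_def)
    then show "1 \<in> ?R" using ring_set_one[OF P] by blast
  next
    fix x z assume "x \<in> ?R" "z \<in> ?R"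
    then obtain p m p' m' where *: "p \<in> polys_over k" "m \<in> max_ideal W" "x = poly p y + m"
      "p' \<in> polys_over k" "m' \<in> max_ideal W" "z = poly p' y + m'" by auto
    have "x - z = poly (p - p') y + (m - m')" using * by simp
    moreover have "p - p' \<in> polys_over k" "m - m' \<in> max_ideal W"
      using * by (auto intro: ring_set_diff[OF P] ideal_set_diff[OF RW IW])
    ultimately show "x - z \<in> ?R" by blast
    show "x * z \<in> ?R" unfolding *(3,6) mult using * prod ring_set_mult[OF P] by blast
  qed
  moreover have "ideal_set ?R ?I"
    unfolding ideal_set_def
  proof (intro conjI ballI)
    show "?I \<subseteq> ?R" by auto
    have "0 = poly 0 y + 0" "(0::'a) \<in> max_ideal W" by (simp_all add: max_ideal_def)
    then show "0 \<in> ?I" using ring_set_zero[OF P] coeff_0 by blast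
  next
    fix x z assume "x \<in> ?I" "z \<in> ?I"
    then obtain p m p' m' where *: "p \<in> polys_over k" "coeff p 0 = 0" "m \<in> max_ideal W" "x = poly p y + m"
      "p' \<in> polys_over k" "coeff p' 0 = 0" "m' \<in> max_ideal W" "z = poly p' y + m'" by auto
    have "x + z = poly (p + p') y + (m + m')" "coeff (p + p') 0 = 0" using * by simp_all
    moreover have "p + p' \<in> polys_over k" "m + m' \<in> max_ideal W"
      using * by (auto intro: ring_set_add[OF P] ideal_set_add[OF IW])
    ultimately show "x + z \<in> ?I" by blast
  next
    fix x z assume "x \<in> ?R" "z \<in> ?I"
    then obtain p m p' m' where *: "p \<in> polys_over k" "m \<in> max_ideal W" "x = poly p y + m"
      "p' \<in> polys_over k" "coeff p' 0 = 0" "m' \<in> max_ideal W" "z = poly p' y + m'" by auto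
    have "coeff (p * p') 0 = 0" using * by (simp add: coeff_mult)
    then show "x * z \<in> ?I" unfolding *(3,7) mult using * prod ring_set_mult[OF P] by blast
  qed
  moreover have "1 \<notin> ?I"
  proof
    assume "1 \<in> ?I"
    then obtain p m where *: "p \<in> polys_over k" "coeff p 0 = 0" "m \<in> max_ideal W" "1 = poly p y + m" by auto
    \<comment> \<open>The value of 1 - p at y is a nonzero element of k(a), hence a unit of
      \<open>W\<close>, and cannot equal \<open>m\<close>.\<close>
    have q: "1 - p \<in> polys_over k" using * ring_set_one[OF P] by (auto intro: ring_set_diff[OF P])
    have m: "poly (1 - p) y = m" using * by (simp add: algebra_simps)
    have "coeff (1 - p) 0 = 1" using * by simp
    then have "1 - p \<noteq> 0" by force
    moreover have "\<not> alg_over k y" using a alg_over_inverse[OF k, of y] by (auto simp: y_def)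
    ultimately have "poly (1 - p) y \<noteq> 0" using q by (auto simp: alg_over_def)
    then show False using field_set_unit[OF W(1) F W(2) polyF[OF q]] m *(3) by simp
  qed
  ultimately obtain V where V: "valuation_ring V" "?R \<subseteq> V" "?I \<subseteq> max_ideal V"
    by (rule exists_valuation_ring)
  have zero: "(0::'a) \<in> max_ideal W" by (simp add: max_ideal_def)
  have "k \<subseteq> V"
  proof
    fix c assume "c \<in> k"
    then have "c = poly [:c:] y + 0" "[:c:] \<in> polys_over k" using polys_over_const[OF R] by auto
    then have "c \<in> ?R" using zero by blast
    then show "c \<in> V" using V(2) by auto
  qed
  moreover have "y = poly [:0, 1:] y + 0" "[:0, 1:] \<in> polys_over k" "coeff [:0, 1::'a:] 0 = 0"
    using polys_over_pCons[OF polys_over_const[OF R ring_set_one[OF R]] ring_set_zero[OF R]] by simp_all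
  then have "y \<in> ?I" using zero by blast
  then have "y \<in> max_ideal V" using V(3) by blast
  then have "a \<notin> V" using a0 by (auto simp: y_def max_ideal_def)
  moreover have "inverse b = poly 0 y + inverse b" "inverse b \<in> max_ideal W" using inverse_max_ideal[OF W(1,3)] by auto
  then have "inverse b \<in> ?I" using ring_set_zero[OF P] coeff_0 by blast
  then have "inverse b \<in> max_ideal V" using V(3) by blast
  then have "b \<notin> V"
    using W(3) ring_set_zero[OF RW] by (auto simp: max_ideal_def)
  ultimately show thesis using V(1) that by blast
qed

section \<open>Gauss extensions\<close>

lemma max_valuation_element:
  assumes V: "valuation_ring V" and A: "finite A" "A \<noteq> {}" "0 \<notin> A"
  shows "\<exists>a\<in>A. \<forall>b\<in>A. b / a \<in> V"
  using A
proof (induction A rule: finite_ne_induct)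
  case (singleton x)
  then show ?case using ring_set_one[OF valuation_ring_ring[OF V]] by simp
next
  case (insert x A)
  note R = valuation_ring_ring[OF V]
  obtain a where a: "a \<in> A" "\<forall>b\<in>A. b / a \<in> V" using insert by auto
  have nz: "x \<noteq> 0" "a \<noteq> 0" using insert a by auto
  show ?case
  proof (cases "x / a \<in> V")
    case True
    then show ?thesis using a by auto
  next
    case False
    then have "a / x \<in> V" using valuation_ring_inverse[OF V False] by simp
    moreover have "b / x = (b / a) * (a / x)" for b using nz by simp
    ultimately have "b / x \<in> V" if "b \<in> A" for b using ring_set_mult[OF R] a(2) that by metis
    moreover have "x / x \<in> V" using nz ring_set_one[OF R] by simp
    ultimately show ?thesis by blast
  qed
qed

text \<open>A content exists over every valuation ring, discrete or not: among finitely many nonzero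
  coefficients one divides all the others.\<close>

lemma primitive_factor:
  assumes V: "valuation_ring V" and F: "field_set F" and p: "p \<in> polys_over F" "p \<noteq> 0"
  obtains a q where "a \<in> F" "a \<noteq> 0" "p = smult a q" "q \<in> polys_over (V \<inter> F)" "\<exists>i. coeff q i = 1"
proof -
  let ?A = "{coeff p i |i. i \<le> degree p} - {0}"
  have "lead_coeff p \<in> ?A" using p by auto
  then have "?A \<noteq> {}" by blast
  then obtain a where a: "a \<in> ?A" "\<forall>b\<in>?A. b / a \<in> V"
    using max_valuation_element[OF V, of ?A] by auto
  then obtain i where i: "a = coeff p i" by auto
  have aF: "a \<in> F" "a \<noteq> 0" using a polys_overD[OF p(1)] by auto
  let ?q = "smult (inverse a) p"
  have "coeff ?q j \<in> V \<inter> F" for j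
  proof
    show "coeff ?q j \<in> F"
      using aF field_set_inverse[OF F] polys_overD[OF p(1)] ring_set_mult[OF field_set_ring[OF F]] by auto
    show "coeff ?q j \<in> V"
    proof (cases "coeff p j = 0")
      case True
      then show ?thesis using ring_set_zero[OF valuation_ring_ring[OF V]] by simp
    next
      case False
      then have "coeff p j \<in> ?A" using le_degree by auto
      then have "coeff p j / a \<in> V" using a(2) by blast
      then show ?thesis by (simp add: field_simps)
    qed
  qed
  then have "?q \<in> polys_over (V \<inter> F)" by (rule polys_overI)
  moreover have "coeff ?q i = 1" using aF i by simp
  moreover have "p = smult a ?q" using aF by simp
  ultimately show thesis using that aF by blast
qed

text \<open>Gauss's lemma: if i and j are the first indices of unit coefficients, then coefficient i
  + j of the product is a unit plus elements of the maximal ideal.\<close>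

lemma primitive_mult:
  assumes V: "valuation_ring V" and p: "p \<in> polys_over V" "q \<in> polys_over V"
    and i: "\<exists>i. coeff p i \<notin> max_ideal V" and j: "\<exists>i. coeff q i \<notin> max_ideal V"
  shows "\<exists>i. coeff (p * q) i \<notin> max_ideal V"
proof -
  note R = valuation_ring_ring[OF V] and I = ideal_max_ideal[OF V]
  define i where "i = (LEAST i. coeff p i \<notin> max_ideal V)"
  define j where "j = (LEAST i. coeff q i \<notin> max_ideal V)"
  have i: "coeff p i \<notin> max_ideal V" and ii: "\<And>k. k < i \<Longrightarrow> coeff p k \<in> max_ideal V"
    unfolding i_def using LeastI_ex[OF assms(4)] not_less_Least by blast+
  have j: "coeff q j \<notin> max_ideal V" and jj: "\<And>k. k < j \<Longrightarrow> coeff q k \<in> max_ideal V"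
    unfolding j_def using LeastI_ex[OF assms(5)] not_less_Least by blast+
  have "coeff (p * q) (i + j) = coeff p i * coeff q j + (\<Sum>k\<in>{..i + j} - {i}. coeff p k * coeff q (i + j - k))"
    unfolding coeff_mult by (subst sum.remove[of _ i]) auto
  moreover have "(\<Sum>k\<in>{..i + j} - {i}. coeff p k * coeff q (i + j - k)) \<in> max_ideal V"
  proof (rule ideal_set_sum[OF I])
    fix k assume "k \<in> {..i + j} - {i}"
    then consider "k < i" | "i + j - k < j" by force
    then show "coeff p k * coeff q (i + j - k) \<in> max_ideal V"
      using ii[of k] jj[of "i + j - k"] polys_overD[OF p(1)] polys_overD[OF p(2)]
      by cases (auto intro: ideal_set_mult[OF I] ideal_set_mult2[OF I])
  qed
  moreover have "coeff p i * coeff q j \<notin> max_ideal V"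
    using max_ideal_prime[OF V polys_overD[OF p(1)] polys_overD[OF p(2)]] i j by blast
  ultimately have "coeff (p * q) (i + j) \<notin> max_ideal V"
    using ideal_set_diff[OF R I] by (metis add_diff_cancel_right')
  then show ?thesis by blast
qed

text \<open>The Gauss valuation of a polynomial is the least valuation of its coefficients. On F(t)
  its ring consists of the quotients p(t)/q(t) with p integral and q primitive; Chevalley's theorem
  extends it to the ambient field, which may be larger than F(t).\<close>

lemma exists_Gauss_extension:
  fixes V F :: "'a::field set"
  assumes V: "valuation_ring V" and F: "field_set F"
    and t: "\<And>p. p \<in> polys_over F \<Longrightarrow> poly p t = 0 \<Longrightarrow> p = 0"
  obtains W where "valuation_ring W"
    "\<And>p. p \<in> polys_over F \<Longrightarrow> poly p t \<in> W \<longleftrightarrow> (\<forall>i. coeff p i \<in> V)"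
    "\<And>p. p \<in> polys_over F \<Longrightarrow> poly p t \<in> max_ideal W \<longleftrightarrow> (\<forall>i. coeff p i \<in> max_ideal V)"
proof -
  note R = valuation_ring_ring[OF V] and I = ideal_max_ideal[OF V] and RF = field_set_ring[OF F]
  have RV: "ring_set (V \<inter> F)" using R RF by (auto simp: ring_set_def)
  have IV: "ideal_set (V \<inter> F) (max_ideal V \<inter> F)"
    using I RF ring_set_zero[OF RF] by (auto simp: ideal_set_def intro: ring_set_add ring_set_mult)
  note RP = ring_set_polys_over[OF RV] and IP = ideal_set_polys_over[OF IV]
  define Prim where "Prim = {q \<in> polys_over (V \<inter> F). \<exists>i. coeff q i \<notin> max_ideal V}"
  have prim_mult: "p * q \<in> Prim" if "p \<in> Prim" "q \<in> Prim" for p q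
    using primitive_mult[OF V, of p q] that ring_set_mult[OF RP]
    by (auto simp: Prim_def intro: polys_over_mono[of "V \<inter> F" V])
  have one_prim: "1 \<in> Prim"
    using ring_set_one[OF RP] one_notin_max_ideal[OF V] by (auto simp: Prim_def intro: exI[of _ 0])
  have prim_nz: "poly q t \<noteq> 0" if "q \<in> Prim" for q
    using that t[of q] polys_over_mono[of "V \<inter> F" F q] by (auto simp: Prim_def max_ideal_def)
  let ?frac = "\<lambda>A. {poly p t / poly q t |p q. p \<in> A \<and> q \<in> Prim}"
  let ?R = "?frac (polys_over (V \<inter> F))" and ?I = "?frac (polys_over (max_ideal V \<inter> F))"
  have fracI: "poly p t / poly q t \<in> ?frac A" if "p \<in> A" "q \<in> Prim" for p q A using that by blast
  have PrimD: "q \<in> polys_over (V \<inter> F)" if "q \<in> Prim" for q using that by (simp add: Prim_def)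
  have sub: "poly p t / poly q t - poly p' t / poly q' t = poly (p * q' - p' * q) t / poly (q * q') t"
    and add: "poly p t / poly q t + poly p' t / poly q' t = poly (p * q' + p' * q) t / poly (q * q') t"
    and mul: "(poly p t / poly q t) * (poly p' t / poly q' t) = poly (p * p') t / poly (q * q') t"
    if "q \<in> Prim" "q' \<in> Prim" for p q p' q'
    using prim_nz[OF that(1)] prim_nz[OF that(2)] by (simp_all add: diff_frac_eq add_frac_eq)
  have "ring_set ?R"
    unfolding ring_set_def
  proof (intro conjI ballI)
    show "1 \<in> ?R" using fracI[OF ring_set_one[OF RP] one_prim] by simp
  next
    fix x y assume "x \<in> ?R" "y \<in> ?R"
    then obtain p q p' q' where *: "x = poly p t / poly q t" "y = poly p' t / poly q' t"
      "p \<in> polys_over (V \<inter> F)" "q \<in> Prim" "p' \<in> polys_over (V \<inter> F)" "q' \<in> Prim" by blast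
    show "x - y \<in> ?R"
      unfolding *(1,2) sub[OF *(4,6)] using *(3-) PrimD
      by (intro fracI prim_mult ring_set_diff[OF RP] ring_set_mult[OF RP]) auto
    show "x * y \<in> ?R"
      unfolding *(1,2) mul[OF *(4,6)] using *(3-)
      by (intro fracI prim_mult ring_set_mult[OF RP]) auto
  qed
  moreover have "ideal_set ?R ?I"
    unfolding ideal_set_def
  proof (intro conjI ballI)
    show "?I \<subseteq> ?R" using ideal_set_subset[OF IP] by blast
    show "0 \<in> ?I" using fracI[OF ideal_set_zero[OF IP] one_prim] by simp
  next
    fix x y assume "x \<in> ?I" "y \<in> ?I"
    then obtain p q p' q' where *: "x = poly p t / poly q t" "y = poly p' t / poly q' t"
      "p \<in> polys_over (max_ideal V \<inter> F)" "q \<in> Prim" "p' \<in> polys_over (max_ideal V \<inter> F)" "q' \<in> Prim" by blast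
    show "x + y \<in> ?I"
      unfolding *(1,2) add[OF *(4,6)] using *(3-) PrimD
      by (intro fracI prim_mult ideal_set_add[OF IP] ideal_set_mult2[OF IP]) auto
  next
    fix x y assume "x \<in> ?R" "y \<in> ?I"
    then obtain p q p' q' where *: "x = poly p t / poly q t" "y = poly p' t / poly q' t"
      "p \<in> polys_over (V \<inter> F)" "q \<in> Prim" "p' \<in> polys_over (max_ideal V \<inter> F)" "q' \<in> Prim" by blast
    show "x * y \<in> ?I"
      unfolding *(1,2) mul[OF *(4,6)] using *(3-)
      by (intro fracI prim_mult ideal_set_mult[OF IP]) auto
  qed
  moreover have "1 \<notin> ?I"
  proof
    assume "1 \<in> ?I"
    then obtain p q where *: "1 = poly p t / poly q t" "p \<in> polys_over (max_ideal V \<inter> F)" "q \<in> Prim" by blast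
    have "poly (p - q) t = 0" using *(1) prim_nz[OF *(3)] by (simp add: field_simps)
    moreover have "p - q \<in> polys_over F"
      using *(2) PrimD[OF *(3)] ring_set_diff[OF ring_set_polys_over[OF RF]]
      by (auto intro: polys_over_mono[of "V \<inter> F" F] polys_over_mono[of "max_ideal V \<inter> F" F])
    ultimately have "p - q = 0" using t by blast
    then show False using *(2,3) by (auto simp: Prim_def polys_over_def)
  qed
  ultimately obtain W where W: "valuation_ring W" "?R \<subseteq> W" "?I \<subseteq> max_ideal W"
    by (rule exists_valuation_ring)
  have inW: "poly p t \<in> W" if "p \<in> polys_over (V \<inter> F)" for p
  proof -
    have "poly p t / poly 1 t \<in> W" using W(2) fracI[OF that one_prim] by blast
    then show ?thesis by simp
  qed
  have inM: "poly p t \<in> max_ideal W" if "p \<in> polys_over (max_ideal V \<inter> F)" for p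
  proof -
    have "poly p t / poly 1 t \<in> max_ideal W" using W(3) fracI[OF that one_prim] by blast
    then show ?thesis by simp
  qed
  \<comment> \<open>\<open>W\<close> restricts to \<open>V\<close> on \<open>F\<close>: if a were in
    \<open>W\<close> but not in \<open>V\<close>, then 1/a would be in the maximal ideal of
    \<open>V\<close>, hence in that of \<open>W\<close>.\<close>
  have const: "a \<in> W \<longleftrightarrow> a \<in> V" "a \<in> max_ideal W \<longleftrightarrow> a \<in> max_ideal V" if "a \<in> F" for a
  proof -
    have V1: "a \<in> W" if "a \<in> V" "a \<in> F" for a
      using inW[OF polys_over_const[OF RV, of a]] that by simp
    have M1: "a \<in> max_ideal W" if "a \<in> max_ideal V" "a \<in> F" for a
      using inM[of "[:a:]"] that ideal_set_zero[OF IV]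
      by (auto simp: polys_over_def coeff_pCons split: nat.splits)
    have M2: "a \<in> V" if aW: "a \<in> W" "a \<in> F" for a
    proof (rule ccontr)
      assume "a \<notin> V"
      then have "inverse a \<in> max_ideal W"
        using M1[of "inverse a"] inverse_max_ideal[OF V] field_set_inverse[OF F aW(2)] by auto
      then show False using aW \<open>a \<notin> V\<close> ring_set_zero[OF R] by (auto simp: max_ideal_def)
    qed
    show "a \<in> W \<longleftrightarrow> a \<in> V" using V1 M2 that by blast
    show "a \<in> max_ideal W \<longleftrightarrow> a \<in> max_ideal V"
      using V1[of "inverse a"] M2[of "inverse a"] that field_set_inverse[OF F that]
      by (auto simp: max_ideal_def)
  qed
  have main: "(poly p t \<in> W \<longleftrightarrow> (\<forall>i. coeff p i \<in> V)) \<and>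
    (poly p t \<in> max_ideal W \<longleftrightarrow> (\<forall>i. coeff p i \<in> max_ideal V))" if p: "p \<in> polys_over F" for p
  proof (cases "p = 0")
    case True
    then show ?thesis using ring_set_zero[OF R] ring_set_zero[OF valuation_ring_ring[OF W(1)]]
      by (simp add: max_ideal_def)
  next
    case False
    obtain a q where aq: "a \<in> F" "a \<noteq> 0" "p = smult a q" "q \<in> polys_over (V \<inter> F)" "\<exists>i. coeff q i = 1"
      using primitive_factor[OF V F p False] .
    obtain i where i: "coeff q i = 1" using aq by auto
    \<comment> \<open>A primitive q has a unit of \<open>W\<close> as its value at t, so that p(t) =
      a q(t) has the same valuation as the content a.\<close>
    have qP: "q \<in> Prim" using aq(4) i one_notin_max_ideal[OF V] by (auto simp: Prim_def intro: exI[of _ i])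
    have "poly 1 t / poly q t \<in> W" using W(2) fracI[OF ring_set_one[OF RP] qP] by blast
    then have qinv: "inverse (poly q t) \<in> W" by (simp add: field_simps)
    have pa: "poly p t = a * poly q t" "a = poly p t * inverse (poly q t)"
      using aq(3) prim_nz[OF qP] by simp_all
    note RW = valuation_ring_ring[OF W(1)] and IW = ideal_max_ideal[OF W(1)]
    have "poly p t \<in> W \<longleftrightarrow> a \<in> W"
      using ring_set_mult[OF RW] inW[OF aq(4)] qinv pa by metis
    also have "\<dots> \<longleftrightarrow> (\<forall>i. coeff p i \<in> V)"
      unfolding const(1)[OF aq(1)]
      using aq(3,4) i ring_set_mult[OF R] by (auto simp: polys_over_def dest: spec[of _ i])
    finally have 1: "poly p t \<in> W \<longleftrightarrow> (\<forall>i. coeff p i \<in> V)" .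
    have "poly p t \<in> max_ideal W \<longleftrightarrow> a \<in> max_ideal W"
      using ideal_set_mult2[OF IW] inW[OF aq(4)] qinv pa by metis
    also have "\<dots> \<longleftrightarrow> (\<forall>i. coeff p i \<in> max_ideal V)"
      unfolding const(2)[OF aq(1)]
      using aq(3,4) i ideal_set_mult2[OF I] by (auto simp: polys_over_def dest: spec[of _ i])
    finally show ?thesis using 1 by blast
  qed
  then show thesis using that W(1) by blast
qed

section \<open>Evaluation of polynomials along homomorphisms\<close>

definition hom_fun :: "('a::comm_ring_1 \<Rightarrow> 'b::comm_ring_1) \<Rightarrow> bool" where
  "hom_fun \<phi> \<longleftrightarrow> \<phi> 0 = 0 \<and> \<phi> 1 = 1 \<and> (\<forall>x y. \<phi> (x + y) = \<phi> x + \<phi> y) \<and> (\<forall>x y. \<phi> (x * y) = \<phi> x * \<phi> y)"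

lemma hom_fun_0: "hom_fun \<phi> \<Longrightarrow> \<phi> 0 = 0"
  and hom_fun_1: "hom_fun \<phi> \<Longrightarrow> \<phi> 1 = 1"
  and hom_fun_add: "hom_fun \<phi> \<Longrightarrow> \<phi> (x + y) = \<phi> x + \<phi> y"
  and hom_fun_mult: "hom_fun \<phi> \<Longrightarrow> \<phi> (x * y) = \<phi> x * \<phi> y"
  by (auto simp: hom_fun_def)

lemma hom_fun_minus: "hom_fun \<phi> \<Longrightarrow> \<phi> (- x) = - \<phi> x"
  using hom_fun_add[of \<phi> x "- x"] hom_fun_0[of \<phi>] by (simp add: eq_neg_iff_add_eq_0 add.commute)

lemma hom_fun_diff: "hom_fun \<phi> \<Longrightarrow> \<phi> (x - y) = \<phi> x - \<phi> y"
  using hom_fun_add[of \<phi> x "- y"] hom_fun_minus[of \<phi> y] by simp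

lemma hom_fun_power: "hom_fun \<phi> \<Longrightarrow> \<phi> (x ^ n) = \<phi> x ^ n"
  by (induction n) (auto simp: hom_fun_1 hom_fun_mult)

lemma hom_fun_sum: "hom_fun \<phi> \<Longrightarrow> \<phi> (sum f A) = (\<Sum>x\<in>A. \<phi> (f x))"
  by (induction A rule: infinite_finite_induct) (auto simp: hom_fun_0 hom_fun_add)

lemma hom_fun_prod: "hom_fun \<phi> \<Longrightarrow> \<phi> (prod f A) = (\<Prod>x\<in>A. \<phi> (f x))"
  by (induction A rule: infinite_finite_induct) (auto simp: hom_fun_1 hom_fun_mult)

lemmas hom_funs = hom_fun_0 hom_fun_1 hom_fun_add hom_fun_mult hom_fun_minus hom_fun_diff
  hom_fun_power hom_fun_sum hom_fun_prod

lemma hom_fun_id: "hom_fun (\<lambda>x. x)"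
  by (simp add: hom_fun_def)

lemma hom_fun_comp: "hom_fun \<phi> \<Longrightarrow> hom_fun \<psi> \<Longrightarrow> hom_fun (\<lambda>x. \<phi> (\<psi> x))"
  by (simp add: hom_fun_def)

lemma hom_fun_inverse:
  fixes \<phi> :: "'a::field \<Rightarrow> 'b::field"
  assumes "hom_fun \<phi>"
  shows "\<phi> (inverse x) = inverse (\<phi> x)"
proof (cases "x = 0")
  case False
  then have "\<phi> x * \<phi> (inverse x) = 1" using assms by (simp add: hom_fun_mult[symmetric] hom_fun_1)
  then show ?thesis by (metis inverse_unique)
qed (simp add: hom_fun_0[OF assms])

lemma hom_fun_divide:
  fixes \<phi> :: "'a::field \<Rightarrow> 'b::field"
  shows "hom_fun \<phi> \<Longrightarrow> \<phi> (x / y) = \<phi> x / \<phi> y"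
  by (simp add: divide_inverse hom_fun_mult hom_fun_inverse)

lemma hom_fun_eq_0_iff:
  fixes \<phi> :: "'a::field \<Rightarrow> 'b::field"
  assumes "hom_fun \<phi>"
  shows "\<phi> x = 0 \<longleftrightarrow> x = 0"
  using hom_fun_mult[OF assms, of x "inverse x"] hom_fun_0[OF assms] hom_fun_1[OF assms]
  by (cases "x = 0") auto

lemma field_set_range_hom:
  fixes \<phi> :: "'a::field \<Rightarrow> 'b::field"
  assumes "hom_fun \<phi>"
  shows "field_set (range \<phi>)"
  unfolding field_set_def ring_set_def
  using hom_fun_1[OF assms, symmetric]
  by (auto simp: hom_fun_inverse[OF assms, symmetric] hom_fun_diff[OF assms, symmetric]
      hom_fun_mult[OF assms, symmetric])

lemma ring_set_range_hom: "hom_fun \<phi> \<Longrightarrow> ring_set (range \<phi>)"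
  unfolding ring_set_def using hom_fun_1[of \<phi>, symmetric]
  by (auto simp: hom_fun_diff[symmetric] hom_fun_mult[symmetric])

text \<open>Iterated as \<open>evalp (evalp \<phi> s) z\<close>, it evaluates a polynomial in two
  variables, the inner one (that of the coefficients) at s and the outer one at z.\<close>

definition evalp :: "('a::comm_ring_1 \<Rightarrow> 'b::comm_ring_1) \<Rightarrow> 'b \<Rightarrow> 'a poly \<Rightarrow> 'b" where
  "evalp \<phi> x p = poly (map_poly \<phi> p) x"

lemma evalp_0: "evalp \<phi> x 0 = 0"
  by (simp add: evalp_def)

lemma evalp_pCons: "hom_fun \<phi> \<Longrightarrow> evalp \<phi> x (pCons a p) = \<phi> a + x * evalp \<phi> x p"
  by (simp add: evalp_def map_poly_pCons hom_fun_0)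

lemma evalp_const: "hom_fun \<phi> \<Longrightarrow> evalp \<phi> x [:a:] = \<phi> a"
  by (simp add: evalp_pCons evalp_0)

lemma evalp_X: "hom_fun \<phi> \<Longrightarrow> evalp \<phi> x [:0, 1:] = x"
  by (simp add: evalp_pCons evalp_0 hom_fun_0 hom_fun_1)

lemma evalp_altdef:
  assumes "hom_fun \<phi>" "degree p \<le> n"
  shows "evalp \<phi> x p = (\<Sum>i\<le>n. \<phi> (coeff p i) * x ^ i)"
proof -
  have "degree (map_poly \<phi> p) \<le> n"
    using assms by (intro degree_le) (auto simp: coeff_map_poly hom_fun_0 coeff_eq_0)
  then show ?thesis
    unfolding evalp_def by (subst poly_altdef_le) (auto simp: coeff_map_poly hom_fun_0[OF assms(1)])
qed

lemma hom_fun_evalp: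
  assumes h: "hom_fun \<phi>"
  shows "hom_fun (evalp \<phi> x)"
proof -
  have add: "evalp \<phi> x (p + q) = evalp \<phi> x p + evalp \<phi> x q" for p q
    using degree_add_le_max[of p q]
    by (simp add: evalp_altdef[OF h, of _ "max (degree p) (degree q)"] hom_funs[OF h] sum.distrib ring_distribs)
  have smult: "evalp \<phi> x (smult a q) = \<phi> a * evalp \<phi> x q" for a q
    by (induction q) (auto simp: evalp_0 evalp_pCons[OF h] hom_funs[OF h] algebra_simps)
  have "evalp \<phi> x (p * q) = evalp \<phi> x p * evalp \<phi> x q" for p q
    by (induction p) (auto simp: evalp_0 evalp_pCons[OF h] add smult hom_funs[OF h] algebra_simps)
  moreover have "evalp \<phi> x 1 = 1" using evalp_const[OF h, of x 1] hom_fun_1[OF h] by (simp add: one_pCons)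
  ultimately show ?thesis using add by (simp add: hom_fun_def evalp_0)
qed

lemma evalp_smult: "hom_fun \<phi> \<Longrightarrow> evalp \<phi> x (smult a q) = \<phi> a * evalp \<phi> x q"
  using hom_fun_mult[OF hom_fun_evalp, of \<phi> x "[:a:]" q] by (simp add: evalp_const)

lemma evalp_monom: "hom_fun \<phi> \<Longrightarrow> evalp \<phi> x (monom a n) = \<phi> a * x ^ n"
  by (induction n) (auto simp: monom_0 monom_Suc evalp_0 evalp_const evalp_pCons hom_fun_0 mult.commute)

lemma evalp_in_ring_set:
  assumes "hom_fun \<phi>" "ring_set S" "range \<phi> \<subseteq> S" "x \<in> S"
  shows "evalp \<phi> x p \<in> S"
  unfolding evalp_altdef[OF assms(1) order_refl]
  using assms by (intro ring_set_sum ring_set_mult ring_set_power) auto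

lemma evalp_compose:
  assumes "hom_fun \<phi>" "hom_fun \<psi>"
  shows "\<psi> (evalp \<phi> x p) = evalp (\<lambda>a. \<psi> (\<phi> a)) (\<psi> x) p"
  unfolding evalp_altdef[OF assms(1) order_refl] evalp_altdef[OF hom_fun_comp[OF assms(2,1)] order_refl]
  by (simp add: hom_funs[OF assms(2)])

lemma hom_fun_map_poly: "hom_fun \<phi> \<Longrightarrow> hom_fun (map_poly \<phi>)"
  unfolding hom_fun_def
proof (intro conjI allI; elim conjE)
  assume "\<phi> 0 = 0" "\<phi> 1 = 1" "\<forall>x y. \<phi> (x + y) = \<phi> x + \<phi> y" "\<forall>x y. \<phi> (x * y) = \<phi> x * \<phi> y"
  then have h: "hom_fun \<phi>" by (simp add: hom_fun_def)
  show "map_poly \<phi> 0 = 0" by simp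
  show "map_poly \<phi> 1 = 1" by (simp add: map_poly_1 hom_funs[OF h])
  show "map_poly \<phi> (p + q) = map_poly \<phi> p + map_poly \<phi> q" for p q
    by (rule poly_eqI) (simp add: coeff_map_poly hom_funs[OF h])
  show "map_poly \<phi> (p * q) = map_poly \<phi> p * map_poly \<phi> q" for p q
    by (rule poly_eqI) (simp add: coeff_map_poly coeff_mult hom_funs[OF h])
qed

lemma evalp_lift:
  assumes "hom_fun \<phi>"
  shows "evalp (evalp \<phi> s) z (map_poly (\<lambda>c. [:c:]) g) = evalp \<phi> z g"
  by (induction g) (auto simp: evalp_0 map_poly_pCons evalp_pCons[OF hom_fun_evalp[OF assms]]
      evalp_pCons[OF assms])

lemma monic_division:
  fixes f p :: "'a::idom poly"
  assumes "lead_coeff f = 1"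
  obtains q r where "p = f * q + r" "r = 0 \<or> degree r < degree f"
proof -
  obtain q r where qr: "pseudo_divmod p f = (q, r)" by fastforce
  have "f \<noteq> 0" using assms by auto
  then show thesis using pseudo_divmod[OF _ qr] assms that by auto
qed

text \<open>A homogeneous linear system with more unknowns (\<open>I\<close>) than equations
  (\<open>J\<close>) has a nontrivial solution, by eliminating one equation and one unknown
  \<open>m\<close> at a time.\<close>

lemma linear_dependence:
  fixes v :: "'i \<Rightarrow> 'j \<Rightarrow> 'k::field"
  assumes "finite J" "finite I" "card J < card I"
  shows "\<exists>l. (\<exists>i\<in>I. l i \<noteq> 0) \<and> (\<forall>j\<in>J. (\<Sum>i\<in>I. l i * v i j) = 0)"
  using assms
proof (induction J arbitrary: I v rule: finite_induct)
  case empty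
  then obtain i where "i \<in> I" by (metis card_gt_0_iff ex_in_conv less_nat_zero_code card.empty)
  then show ?case by (intro exI[of _ "\<lambda>_. 1"]) auto
next
  case (insert j J)
  show ?case
  proof (cases "\<forall>i\<in>I. v i j = 0")
    case True
    from insert have "card J < card I" by auto
    from insert.IH[OF insert.prems(1) this, of v] show ?thesis using True by auto
  next
    case False
    then obtain m where m: "m \<in> I" "v m j \<noteq> 0" by auto
    define w where "w i k = v i k - v i j / v m j * v m k" for i k
    have "card J < card (I - {m})" using insert m by (auto simp: card_Diff_singleton)
    from insert.IH[OF _ this, of w] insert.prems
    obtain l where l: "\<exists>i\<in>I - {m}. l i \<noteq> 0" "\<forall>k\<in>J. (\<Sum>i\<in>I - {m}. l i * w i k) = 0" by auto
    define c where "c = - (\<Sum>i\<in>I - {m}. l i * (v i j / v m j))"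
    define l' where "l' = l(m := c)"
    have split: "(\<Sum>i\<in>I. l' i * v i k) = c * v m k + (\<Sum>i\<in>I - {m}. l i * v i k)" for k
      using insert.prems(1) m(1) by (subst sum.remove[of _ m]) (auto simp: l'_def intro!: sum.cong)
    have "(\<Sum>i\<in>I. l' i * v i k) = (\<Sum>i\<in>I - {m}. l i * w i k)" for k
      unfolding split c_def w_def
      by (simp add: sum_distrib_right sum_subtractf right_diff_distrib mult.assoc)
    moreover have "w i j = 0" for i using m by (simp add: w_def)
    ultimately have "\<forall>k\<in>insert j J. (\<Sum>i\<in>I. l' i * v i k) = 0" using l(2) by auto
    moreover have "\<exists>i\<in>I. l' i \<noteq> 0" using l(1) by (auto simp: l'_def)
    ultimately show ?thesis by blast
  qed
qed

lemma ideal_unit_cancel: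
  assumes "valuation_ring V" "e \<in> V" "e \<notin> max_ideal V" "e * x \<in> max_ideal V"
  shows "x \<in> max_ideal V"
proof -
  have "e \<noteq> 0" "inverse e \<in> V" using assms(3) by (auto simp: max_ideal_def)
  then have "inverse e * (e * x) \<in> max_ideal V"
    using assms ideal_set_mult[OF ideal_max_ideal] by blast
  then show ?thesis using \<open>e \<noteq> 0\<close> by (simp add: mult.assoc[symmetric])
qed

lemma monic_root_in_valuation_ring:
  assumes V: "valuation_ring V" and p: "p \<in> polys_over V" "lead_coeff p = 1" "poly p z = 0"
  shows "z \<in> V"
  using unit_lead_coeff_pole[OF V _ p(1)] p one_notin_max_ideal[OF V] by (metis leading_coeff_0_iff zero_neq_one)

text \<open>Since f is monic in z, the element z is integral over the constants and s; so the
  coordinate ring of the chart is regular at every place where s vanishes.\<close>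

lemma chart_in_valuation_ring:
  assumes h\<phi>: "hom_fun \<phi>" and monic: "lead_coeff f = 1" and root: "evalp (evalp \<phi> s) z f = 0"
    and V: "valuation_ring V" "range \<phi> \<subseteq> V" "s \<in> max_ideal V"
  shows "evalp (evalp \<phi> s) z q \<in> V"
proof -
  note hs = hom_fun_evalp[OF h\<phi>, of s] and R = valuation_ring_ring[OF V(1)]
  define d where "d = degree f"
  have c: "evalp \<phi> s c \<in> V" for c
    using max_ideal_subset[OF V(1,3)] by (intro evalp_in_ring_set[OF h\<phi> R V(2)])
  have lc: "coeff (map_poly (evalp \<phi> s) f) d = 1"
    using monic by (simp add: coeff_map_poly evalp_0 d_def hom_fun_1[OF hs])
  moreover have "degree (map_poly (evalp \<phi> s) f) \<le> d"
    by (intro degree_le) (auto simp: coeff_map_poly evalp_0 coeff_eq_0 d_def)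
  ultimately have "degree (map_poly (evalp \<phi> s) f) = d"
    by (intro antisym le_degree) auto
  then have "z \<in> V"
    using lc root c
    by (intro monic_root_in_valuation_ring[OF V(1), of "map_poly (evalp \<phi> s) f"])
      (auto simp: polys_over_def coeff_map_poly evalp_0 evalp_def[of "evalp \<phi> s"] ring_set_zero[OF R])
  then show ?thesis
    using c by (auto intro!: evalp_in_ring_set[OF hs R])
qed

text \<open>The polynomials f and f(0, z) agree modulo s, and f vanishes at the point.\<close>

lemma special_fibre:
  fixes \<phi> :: "'k::field \<Rightarrow> 'm::field" and f :: "'k poly poly"
  assumes h\<phi>: "hom_fun \<phi>" and root: "evalp (evalp \<phi> s) z f = 0"
  shows "\<exists>r. evalp \<phi> z (map_poly (\<lambda>c. poly c 0) f) = s * evalp (evalp \<phi> s) z r"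
proof -
  note hs = hom_fun_evalp[OF h\<phi>, of s]
  define E where "E = evalp (evalp \<phi> s) z"
  have hE: "hom_fun E" unfolding E_def by (rule hom_fun_evalp[OF hs])
  define f0 where "f0 = map_poly (\<lambda>c. poly c 0) f"
  let ?q = "map_poly (\<lambda>c. [:c:]) f0 - f"
  have "[:0, 1:] dvd coeff ?q i" for i
  proof -
    have "poly (coeff ?q i) 0 = 0" by (simp add: f0_def coeff_map_poly)
    then show ?thesis using poly_eq_0_iff_dvd[of "coeff ?q i" 0] by simp
  qed
  then have "[:[:0, 1:]:] dvd ?q" using const_poly_dvd_iff by blast
  then obtain r where r: "?q = [:[:0, 1:]:] * r" by (rule dvdE)
  have "E ?q = evalp \<phi> z f0"
    by (simp add: hom_fun_diff[OF hE]) (simp add: E_def root evalp_lift[OF h\<phi>])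
  moreover have "E [:[:0, 1:]:] = s"
    unfolding E_def by (simp add: evalp_const[OF hs] evalp_X[OF h\<phi>])
  ultimately have "evalp \<phi> z f0 = s * E r" unfolding r hom_fun_mult[OF hE] by simp
  then show ?thesis unfolding f0_def E_def by blast
qed

section \<open>Runge's functions\<close>

text \<open>Runge's construction. Near \<open>s = 0\<close> the curve \<open>f(s, z) = 0\<close> splits into a part where \<open>g(z)\<close>
  vanishes and one where \<open>h(z)\<close> vanishes, and the function sought is a polynomial in \<open>x = 1/s\<close> and
  \<open>y = z/s\<close> that vanishes on the first part and has a pole on the second. Lifting the idempotents of
  \<open>k[z]/(gh)\<close> gives \<open>e, e'\<close> with \<open>e + e' = 1\<close>, \<open>ee'\<close> divisible by a high power of \<open>s\<close>, and the
  polynomial parts \<open>\<Phi>\<^sub>n\<close> of \<open>x\<^sup>n e'\<close> have the required poles; on the first part their poles are of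
  order less than \<open>d\<close>, and a suitable linear combination of \<open>d\<^sup>2 + 1\<close> of them vanishes.\<close>

theorem exists_Runge_function:
  fixes \<phi> :: "'k::field \<Rightarrow> 'm::field" and f :: "'k poly poly"
  assumes h\<phi>: "hom_fun \<phi>" and s: "s \<noteq> 0" and monic: "lead_coeff f = 1"
    and root: "evalp (evalp \<phi> s) z f = 0"
    and gh: "map_poly (\<lambda>c. poly c 0) f = g * h" and coprime: "u * g + v * h = 1"
  obtains \<Phi> where
    "\<And>S. ring_set S \<Longrightarrow> range \<phi> \<subseteq> S \<Longrightarrow> inverse s \<in> S \<Longrightarrow> z / s \<in> S \<Longrightarrow> \<Phi> \<in> S"
    "\<And>V. valuation_ring V \<Longrightarrow> range \<phi> \<subseteq> V \<Longrightarrow> s \<in> max_ideal V \<Longrightarrow> evalp \<phi> z g \<in> max_ideal V \<Longrightarrow>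
       \<Phi> \<in> max_ideal V"
    "\<And>V. valuation_ring V \<Longrightarrow> range \<phi> \<subseteq> V \<Longrightarrow> s \<in> max_ideal V \<Longrightarrow> evalp \<phi> z h \<in> max_ideal V \<Longrightarrow>
       \<Phi> \<notin> V"
proof -
  define E where "E = evalp (evalp \<phi> s) z"
  have hs: "hom_fun (evalp \<phi> s)" by (rule hom_fun_evalp[OF h\<phi>])
  have hE: "hom_fun E" unfolding E_def by (rule hom_fun_evalp[OF hs])
  define B where "B = range E"
  have RB: "ring_set B" unfolding B_def by (rule ring_set_range_hom[OF hE])
  note RB_intros = ring_set_intros[OF RB]
  define d where "d = degree f"
  have d: "d > 0"
  proof (rule ccontr)
    assume "\<not> d > 0"
    then have "f = [:1:]" using monic by (auto simp: d_def elim!: degree_eq_zeroE)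
    then show False using root by (simp add: evalp_const[OF hs] hom_fun_1[OF hs])
  qed
  have Ec: "E [:[:c:]:] = \<phi> c" "E [:[:0, 1:]:] = s" "E [:0, 1:] = z" for c
    unfolding E_def by (simp_all add: evalp_const[OF hs] evalp_const[OF h\<phi>] evalp_X[OF h\<phi>] evalp_X[OF hs])
  have inB: "\<phi> c \<in> B" "s \<in> B" "z \<in> B" for c
    unfolding B_def using Ec by (metis rangeI)+
  have lift: "E (map_poly (\<lambda>c. [:c:]) p) = evalp \<phi> z p" for p
    unfolding E_def by (rule evalp_lift[OF h\<phi>])
  have zB: "evalp \<phi> z p \<in> B" for p
    unfolding lift[symmetric] B_def by simp
  have BV: "B \<subseteq> V" if V: "valuation_ring V" "range \<phi> \<subseteq> V" "s \<in> max_ideal V" for V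
    using chart_in_valuation_ring[OF h\<phi> monic root V] by (auto simp: B_def E_def)
  define G where "G = evalp \<phi> z g"
  define H where "H = evalp \<phi> z h"
  have GB: "G \<in> B" "H \<in> B" unfolding G_def H_def by (rule zB)+
  obtain r0 where r0: "r0 \<in> B" "G * H = s * r0"
    using special_fibre[OF h\<phi> root] unfolding gh hom_fun_mult[OF hom_fun_evalp[OF h\<phi>]]
    by (auto simp: B_def E_def G_def H_def)
  have UV: "evalp \<phi> z u * G + evalp \<phi> z v * H = 1"
    using arg_cong[OF coprime, of "evalp \<phi> z"]
    by (simp add: hom_funs[OF hom_fun_evalp[OF h\<phi>]] G_def H_def)
  \<comment> \<open>Lifting of idempotents: the expansion of (e + e')^3 = 1 splits into the halves
    e^2 (1 + 2 e') and e'^2 (1 + 2 e), whose product is divisible by (e e')^2. That H divides e and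
    G divides e' is carried along, as it decides which of them vanishes on which part.\<close>
  have idem: "\<exists>e e' c a a'. e \<in> B \<and> e' \<in> B \<and> c \<in> B \<and> a \<in> B \<and> a' \<in> B \<and> e + e' = 1 \<and>
      e * e' = s ^ (2 ^ k) * c \<and> e = H * a \<and> e' = G * a'" for k
  proof (induction k)
    case 0
    let ?e = "H * evalp \<phi> z v" and ?e' = "G * evalp \<phi> z u"
    have "?e * ?e' = (G * H) * (evalp \<phi> z v * evalp \<phi> z u)" by (simp add: algebra_simps)
    then have "?e * ?e' = s ^ 2 ^ 0 * (r0 * (evalp \<phi> z v * evalp \<phi> z u))" by (simp add: r0(2))
    moreover have "?e + ?e' = 1" using UV by (simp add: algebra_simps)
    moreover have "?e \<in> B" "?e' \<in> B" "r0 * (evalp \<phi> z v * evalp \<phi> z u) \<in> B"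
      using zB GB r0(1) by (auto intro!: ring_set_mult[OF RB])
    ultimately show ?case using zB
      by (intro exI[of _ ?e] exI[of _ ?e'] exI[of _ "r0 * (evalp \<phi> z v * evalp \<phi> z u)"]
          exI[of _ "evalp \<phi> z v"] exI[of _ "evalp \<phi> z u"] conjI) auto
  next
    case (Suc k)
    then obtain e e' c a a' where *: "e \<in> B" "e' \<in> B" "c \<in> B" "a \<in> B" "a' \<in> B" "e + e' = 1"
      "e * e' = s ^ (2 ^ k) * c" "e = H * a" "e' = G * a'" by blast
    let ?e = "e ^ 2 * (1 + 2 * e')" and ?e' = "e' ^ 2 * (1 + 2 * e)"
    have e': "e' = 1 - e" using *(6) by (simp add: eq_diff_eq add.commute)
    have "?e + ?e' = 1" unfolding e' by (simp add: power2_eq_square algebra_simps)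
    moreover have "?e * ?e' = (e * e') ^ 2 * ((1 + 2 * e') * (1 + 2 * e))" by (simp add: power2_eq_square algebra_simps)
    then have "?e * ?e' = s ^ 2 ^ Suc k * (c ^ 2 * ((1 + 2 * e') * (1 + 2 * e)))"
      unfolding *(7) by (simp add: power_mult_distrib power_mult[symmetric] mult.commute mult.left_commute)
    moreover have "?e = H * (a * e * (1 + 2 * e'))" "?e' = G * (a' * e' * (1 + 2 * e))"
      using *(8,9) by (simp_all add: power2_eq_square mult.assoc)
    moreover have two: "2 \<in> B"
      using ring_set_add[OF RB ring_set_one[OF RB] ring_set_one[OF RB]] by simp
    have "?e \<in> B" "?e' \<in> B" "c ^ 2 * ((1 + 2 * e') * (1 + 2 * e)) \<in> B"
      "a * e * (1 + 2 * e') \<in> B" "a' * e' * (1 + 2 * e) \<in> B"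
      by (intro RB_intros *(1-5) two)+
    ultimately show ?case
      by (intro exI[of _ ?e] exI[of _ ?e'] exI[of _ "c ^ 2 * ((1 + 2 * e') * (1 + 2 * e))"]
          exI[of _ "a * e * (1 + 2 * e')"] exI[of _ "a' * e' * (1 + 2 * e)"] conjI)
  qed
  \<comment> \<open>The exponents n will run over d..N, that is over d^2 + 1 values, one more than
    the d^2 linear conditions to be met; e e' has to be divisible by s^n for all of them.\<close>
  define N where "N = d + d * d"
  obtain e e' c0 a a' where e: "e \<in> B" "e' \<in> B" "c0 \<in> B" "a \<in> B" "a' \<in> B" "e + e' = 1"
    "e * e' = s ^ (2 ^ N) * c0" "e = H * a" "e' = G * a'" using idem[of N] by blast
  define c where "c = s ^ (2 ^ N - N) * c0"
  have c: "c \<in> B" "e * e' = s ^ N * c"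
    using e(3,7) inB less_exp[of N]
    by (auto simp: c_def mult.assoc[symmetric] power_add[symmetric] intro!: RB_intros)
  \<comment> \<open>The ring generated by the constants, 1/s and z/s: functions without poles on the
    affine curve.\<close>
  define R where "R = \<Inter>{S. ring_set S \<and> range \<phi> \<subseteq> S \<and> inverse s \<in> S \<and> z / s \<in> S}"
  have RR: "ring_set R" unfolding R_def by (auto simp: ring_set_def)
  have inR: "\<phi> b \<in> R" "inverse s \<in> R" "z / s \<in> R" for b by (auto simp: R_def)
  have reduce: "\<exists>q. x = E q \<and> degree q < d" if x: "x \<in> B" for x
  proof -
    obtain p where p: "x = E p" using x by (auto simp: B_def)
    obtain q r where "p = f * q + r" "r = 0 \<or> degree r < degree f" by (rule monic_division[OF monic])
    moreover have "E (f * q) = 0" using root by (simp add: hom_fun_mult[OF hE]) (simp add: E_def)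
    ultimately show ?thesis using p d by (intro exI[of _ r]) (auto simp: hom_fun_add[OF hE] d_def)
  qed
  \<comment> \<open>Here x / s^n is an element of \<open>R\<close> plus a remainder whose pole along
    s = 0 has order at most d - 1. For s^i z^j with j < d, either i + j \<le> n and the quotient is
    a monomial in 1/s and z/s, or n - i \<le> d - 1 and it is such a remainder.\<close>
  define W where "W n x \<longleftrightarrow> (\<exists>r\<in>R. \<exists>w. s ^ (d - 1) * w \<in> B \<and> x = (r + w) * s ^ n)" for n x
  have W_add: "W n (x + y)" if xy: "W n x" "W n y" for n x y
  proof -
    obtain r w r' w' where *: "r \<in> R" "s ^ (d - 1) * w \<in> B" "x = (r + w) * s ^ n"
       "r' \<in> R" "s ^ (d - 1) * w' \<in> B" "y = (r' + w') * s ^ n"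
      using xy unfolding W_def by blast
    have "x + y = ((r + r') + (w + w')) * s ^ n" using *(3,6) by (simp add: algebra_simps)
    moreover have "s ^ (d - 1) * (w + w') \<in> B" using *(2,5) RB_intros(6) by (simp add: distrib_left)
    ultimately show ?thesis using ring_set_add[OF RR *(1,4)] unfolding W_def by blast
  qed
  have W_0: "W n 0" for n
    unfolding W_def using ring_set_zero[OF RR] ring_set_zero[OF RB] by (intro bexI[of _ 0] exI[of _ 0]) auto
  have W_sum: "W n (sum F A)" if "\<And>i. i \<in> A \<Longrightarrow> W n (F i)" for F n and A :: "nat set"
    using that by (induction A rule: infinite_finite_induct) (auto intro: W_0 W_add)
  have W_monom: "W n (\<phi> b * s ^ i * z ^ j)" if j: "j < d" for n b i j
  proof (cases "i + j \<le> n")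
    case True
    have "s ^ n = s ^ (n - (i + j)) * s ^ i * s ^ j"
      using True by (simp add: power_add[symmetric])
    then have "\<phi> b * s ^ i * z ^ j = (\<phi> b * inverse s ^ (n - (i + j)) * (z / s) ^ j + 0) * s ^ n"
      using s by (simp add: field_simps)
    moreover have "\<phi> b * inverse s ^ (n - (i + j)) * (z / s) ^ j \<in> R"
      using inR by (intro ring_set_intros RR) auto
    moreover have "s ^ (d - 1) * 0 \<in> B" using ring_set_zero[OF RB] by simp
    ultimately show ?thesis unfolding W_def by blast
  next
    case False
    then have le: "n \<le> d - 1 + i" using j by auto
    let ?w = "\<phi> b * s ^ i * z ^ j / s ^ n"
    have "s ^ (d - 1) * ?w = \<phi> b * s ^ (d - 1 + i - n) * z ^ j"
      using s le by (simp add: power_diff power_add)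
    moreover have "\<phi> b * s ^ (d - 1 + i - n) * z ^ j \<in> B" using inB by (auto intro!: RB_intros)
    moreover have "\<phi> b * s ^ i * z ^ j = (0 + ?w) * s ^ n" using s by simp
    ultimately show ?thesis unfolding W_def using ring_set_zero[OF RR] by metis
  qed
  have W_B: "W n x" if xB: "x \<in> B" for n x
  proof -
    obtain q where q: "x = E q" "degree q < d" using reduce[OF xB] by blast
    have "x = (\<Sum>j\<le>degree q. (\<Sum>i\<le>degree (coeff q j). \<phi> (coeff (coeff q j) i) * s ^ i * z ^ j))"
      unfolding q E_def evalp_altdef[OF hs order_refl]
      by (simp add: evalp_altdef[OF h\<phi> order_refl] sum_distrib_right)
    also have "W n \<dots>" using q(2) by (intro W_sum W_monom) auto
    finally show ?thesis .
  qed
  have "\<forall>n. \<exists>r w. r \<in> R \<and> s ^ (d - 1) * w \<in> B \<and> e' = (r + w) * s ^ n"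
    using W_B[OF e(2)] unfolding W_def by blast
  then obtain \<Psi> w where \<Psi>: "\<And>n. \<Psi> n \<in> R" "\<And>n. s ^ (d - 1) * w n \<in> B" "\<And>n. e' = (\<Psi> n + w n) * s ^ n"
    by metis
  define I where "I = {d..N}"
  \<comment> \<open>\<open>e * \<Psi> n\<close> is e e'/s^n minus e times the remainder; the first
    term is regular because n \<le> N, so only the pole of the remainder is left.\<close>
  have "s ^ (d - 1) * e * \<Psi> n \<in> B" if n: "n \<in> I" for n
  proof -
    have P: "\<Psi> n = e' / s ^ n - w n" using \<Psi>(3)[of n] s by (simp add: field_simps)
    have "s ^ (d - 1) * e * \<Psi> n = s ^ (d - 1) * ((e * e') / s ^ n) - e * (s ^ (d - 1) * w n)"
      unfolding P by (simp add: right_diff_distrib mult.assoc mult.left_commute)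
    also have "(e * e') / s ^ n = s ^ (N - n) * c"
      unfolding c(2) using n s by (simp add: I_def power_diff)
    also have "s ^ (d - 1) * (s ^ (N - n) * c) - e * (s ^ (d - 1) * w n) \<in> B"
      by (intro ring_set_diff[OF RB] ring_set_mult[OF RB e(1) \<Psi>(2)])
        (intro ring_set_mult[OF RB] ring_set_power[OF RB] inB c)
    finally show ?thesis .
  qed
  then have "\<forall>n\<in>I. \<exists>q. s ^ (d - 1) * e * \<Psi> n = E q \<and> degree q < d" using reduce by blast
  then obtain q where q: "\<And>n. n \<in> I \<Longrightarrow> s ^ (d - 1) * e * \<Psi> n = E (q n)" "\<And>n. n \<in> I \<Longrightarrow> degree (q n) < d"
    by metis
  have "card ({..<d} \<times> {..<d}) < card I" by (simp add: I_def N_def)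
  \<comment> \<open>The conditions are the vanishing of the coefficients of s^i z^j with i, j < d. A
    solution makes \<open>Q\<close> divisible by s^d, which cancels the factor s^(d-1) and leaves
    one more s dividing e \<Phi>.\<close>
  from linear_dependence[OF _ _ this, of "\<lambda>n (i, j). coeff (coeff (q n) j) i"]
  obtain l where l: "\<exists>n\<in>I. l n \<noteq> 0"
    and l0: "\<And>i j. i < d \<Longrightarrow> j < d \<Longrightarrow> (\<Sum>n\<in>I. l n * coeff (coeff (q n) j) i) = 0"
    by (auto simp: I_def)
  define Q where "Q = (\<Sum>n\<in>I. smult [:l n:] (q n))"
  define \<Phi> where "\<Phi> = (\<Sum>n\<in>I. \<phi> (l n) * \<Psi> n)"
  have EQ: "s ^ (d - 1) * e * \<Phi> = E Q"
  proof -
    have "E (smult [:l n:] (q n)) = \<phi> (l n) * (s ^ (d - 1) * e * \<Psi> n)" if "n \<in> I" for n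
      using q(1)[OF that] by (simp add: E_def evalp_smult[OF hs] evalp_const[OF h\<phi>])
    then show ?thesis
      unfolding Q_def \<Phi>_def hom_fun_sum[OF hE] sum_distrib_left
      by (intro sum.cong) (auto simp: mult_ac)
  qed
  have "monom 1 d dvd coeff Q j" for j
  proof -
    have "coeff (coeff Q j) i = 0" if i: "i < d" for i
    proof (cases "j < d")
      case True
      then show ?thesis using l0[OF i True] by (simp add: Q_def coeff_sum)
    next
      case False
      then have "coeff (q n) j = 0" if "n \<in> I" for n
        using q(2)[OF that] by (intro coeff_eq_0) auto
      then show ?thesis by (simp add: Q_def coeff_sum)
    qed
    then show ?thesis by (simp add: monom_1_dvd_iff')
  qed
  then have "[:monom 1 d:] dvd Q" using const_poly_dvd_iff by blast
  then obtain Q' where "Q = [:monom 1 d:] * Q'" by (rule dvdE)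
  then have "E Q = s ^ d * E Q'"
    by (simp add: E_def evalp_smult[OF hs] evalp_monom[OF h\<phi>] hom_fun_1[OF h\<phi>])
  also have "s ^ d = s ^ (d - 1) * s" using d by (cases d) auto
  finally have e\<Phi>: "e * \<Phi> = s * E Q'" using EQ s by (simp add: mult.assoc)
  \<comment> \<open>The largest exponent in the combination produces the pole on the other part:
    modulo s, the function s^m \<Phi> is a nonzero constant times e', a unit there, and m >
    0.\<close>
  define m where "m = Max {n \<in> I. l n \<noteq> 0}"
  have "m \<in> {n \<in> I. l n \<noteq> 0}"
    unfolding m_def using l by (intro Max_in) (auto simp: I_def)
  then have m: "m \<in> I" "l m \<noteq> 0" by auto
  have mmax: "l n = 0" if "n \<in> I" "n > m" for n
  proof (rule ccontr)
    assume "l n \<noteq> 0"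
    then have "n \<le> m" unfolding m_def using that by (intro Max_ge) (auto simp: I_def)
    then show False using that by simp
  qed
  have mpos: "m > 0" using m d by (auto simp: I_def)
  define J where "J = {s * b |b. b \<in> B}"
  have JI: "s * b \<in> J" if "b \<in> B" for b using that by (auto simp: J_def)
  have J0: "0 \<in> J" using JI[OF ring_set_zero[OF RB]] by simp
  have J_add: "x + y \<in> J" if xy: "x \<in> J" "y \<in> J" for x y
  proof -
    obtain b b' where "b \<in> B" "b' \<in> B" "x = s * b" "y = s * b'" using xy by (auto simp: J_def)
    then show ?thesis using JI[OF ring_set_add[OF RB], of b b'] by (simp add: distrib_left)
  qed
  have J_mult: "b * x \<in> J" if xy: "b \<in> B" "x \<in> J" for x b
  proof -
    obtain b' where "b' \<in> B" "x = s * b'" using xy by (auto simp: J_def)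
    then show ?thesis using JI[OF ring_set_mult[OF RB], of b b'] xy by (simp add: mult.left_commute)
  qed
  have J_sum: "sum F A \<in> J" if "\<And>i. i \<in> A \<Longrightarrow> F i \<in> J" for F and A :: "nat set"
    using that by (induction A rule: infinite_finite_induct) (auto intro: J0 J_add)
  have sw: "s ^ n * w n \<in> J" if "n \<in> I" for n
  proof -
    have "s ^ n = s * s ^ (n - d) * s ^ (d - 1)"
      using that d by (simp add: I_def power_add[symmetric] power_Suc[symmetric] del: power_Suc)
    then have "s ^ n * w n = s * (s ^ (n - d) * (s ^ (d - 1) * w n))" by simp
    then show ?thesis using JI[OF ring_set_mult[OF RB ring_set_power[OF RB inB(2)] \<Psi>(2)]] by metis
  qed
  have s\<Psi>: "s ^ n * \<Psi> n = e' + (-1) * (s ^ n * w n)" for n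
    using \<Psi>(3)[of n] by (simp add: algebra_simps)
  have m1: "-1 \<in> B" using ring_set_uminus[OF RB ring_set_one[OF RB]] .
  have low: "s ^ m * (\<phi> (l n) * \<Psi> n) \<in> J" if n: "n \<in> I - {m}" for n
  proof (cases "n < m")
    case False
    then show ?thesis using mmax[of n] n J0 by (auto simp: hom_fun_0[OF h\<phi>])
  next
    case True
    have "s ^ m = s * s ^ (m - n - 1) * s ^ n"
      using True by (simp add: power_add[symmetric] power_Suc[symmetric] del: power_Suc)
    then have "s ^ m * (\<phi> (l n) * \<Psi> n) = s * (s ^ (m - n - 1) * (\<phi> (l n) * (s ^ n * \<Psi> n)))" by simp
    also have "s ^ n * \<Psi> n \<in> B"
    proof -
      have "s ^ n * w n \<in> B" using sw[of n] n inB ring_set_mult[OF RB] by (auto simp: J_def)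
      then show ?thesis
        unfolding s\<Psi> by (intro ring_set_add[OF RB e(2)] ring_set_mult[OF RB m1])
    qed
    then have "s * (s ^ (m - n - 1) * (\<phi> (l n) * (s ^ n * \<Psi> n))) \<in> J"
      by (intro JI ring_set_mult[OF RB ring_set_power[OF RB inB(2)] ring_set_mult[OF RB inB(1)]])
    finally show ?thesis .
  qed
  have "s ^ m * \<Phi> = s ^ m * (\<phi> (l m) * \<Psi> m) + (\<Sum>n\<in>I - {m}. s ^ m * (\<phi> (l n) * \<Psi> n))"
    unfolding \<Phi>_def sum_distrib_left using m(1) by (intro sum.remove) (auto simp: I_def)
  also have "s ^ m * (\<phi> (l m) * \<Psi> m) = \<phi> (l m) * e' + \<phi> (l m) * ((-1) * (s ^ m * w m))"
    unfolding distrib_left[symmetric] s\<Psi>[symmetric] by (rule mult.left_commute)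
  finally have "s ^ m * \<Phi> - \<phi> (l m) * e' =
      \<phi> (l m) * ((-1) * (s ^ m * w m)) + (\<Sum>n\<in>I - {m}. s ^ m * (\<phi> (l n) * \<Psi> n))" by simp
  also have "\<dots> \<in> J" by (intro J_add[OF J_mult[OF inB(1) J_mult[OF m1 sw[OF m(1)]]] J_sum[OF low]])
  finally have top: "s ^ m * \<Phi> - \<phi> (l m) * e' \<in> J" .
  show thesis
  proof (rule that[of \<Phi>])
    fix S assume "ring_set S" "range \<phi> \<subseteq> S" "inverse s \<in> S" "z / s \<in> S"
    then have "R \<subseteq> S" by (auto simp: R_def)
    moreover have "\<Phi> \<in> R" unfolding \<Phi>_def using inR \<Psi>(1) by (intro ring_set_sum[OF RR] ring_set_mult[OF RR])
    ultimately show "\<Phi> \<in> S" by blast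
  next
    fix V assume V: "valuation_ring V" "range \<phi> \<subseteq> V" "s \<in> max_ideal V" and g: "evalp \<phi> z g \<in> max_ideal V"
    note I = ideal_max_ideal[OF V(1)] and RV = valuation_ring_ring[OF V(1)] and BV = BV[OF V]
    have "e' \<in> max_ideal V" unfolding e(9) using g e(5) BV by (auto intro: ideal_set_mult2[OF I] simp: G_def)
    then have "e \<notin> max_ideal V" using ideal_set_add[OF I, of e e'] e(6) one_notin_max_ideal[OF V(1)] by auto
    moreover have "e * \<Phi> \<in> max_ideal V" unfolding e\<Phi> using V(3) BV by (intro ideal_set_mult2[OF I]) (auto simp: B_def)
    ultimately show "\<Phi> \<in> max_ideal V" using ideal_unit_cancel[OF V(1)] e(1) BV by blast
  next
    fix V assume V: "valuation_ring V" "range \<phi> \<subseteq> V" "s \<in> max_ideal V" and g: "evalp \<phi> z h \<in> max_ideal V"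
    note I = ideal_max_ideal[OF V(1)] and RV = valuation_ring_ring[OF V(1)] and BV = BV[OF V]
    have "e \<in> max_ideal V" unfolding e(8) using g e(4) BV by (auto intro: ideal_set_mult2[OF I] simp: H_def)
    then have e': "e' \<notin> max_ideal V" using ideal_set_add[OF I, of e e'] e(6) one_notin_max_ideal[OF V(1)] by auto
    have "\<phi> (l m) \<notin> max_ideal V"
      using m(2) hom_fun_eq_0_iff[OF h\<phi>] field_set_unit[OF V(1) field_set_range_hom[OF h\<phi>] V(2)] by blast
    then have n: "\<phi> (l m) * e' \<notin> max_ideal V"
      using max_ideal_prime[OF V(1), of "\<phi> (l m)" e'] V(2) e' e(2) BV by blast
    have JV: "x \<in> max_ideal V" if "x \<in> J" for x
      using that V(3) BV by (auto simp: J_def intro: ideal_set_mult2[OF I])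
    show "\<Phi> \<notin> V"
    proof
      assume "\<Phi> \<in> V"
      then have "s ^ m * \<Phi> \<in> max_ideal V"
        using V(3) mpos by (intro ideal_set_mult2[OF I] ideal_set_power[OF RV I])
      then have "s ^ m * \<Phi> - (s ^ m * \<Phi> - \<phi> (l m) * e') \<in> max_ideal V"
        using JV[OF top] by (rule ideal_set_diff[OF RV I])
      then show False using n by simp
    qed
  qed
qed

section \<open>Places at infinity of a plane curve\<close>

text \<open>With the trivial Euclidean structure of a field, polynomials over \<complex>(t) get
  Bezout coefficients, and polynomials in two variables over \<complex>(t) get contents and unique
  factorisation.\<close>

instantiation fract :: (idom) "{unique_euclidean_ring, normalization_euclidean_semiring, normalization_semidom_multiplicative}"
begin

definition [simp]: "normalize_fract = (normalize_field :: 'a fract \<Rightarrow> 'a fract)"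
definition [simp]: "unit_factor_fract = (unit_factor_field :: 'a fract \<Rightarrow> 'a fract)"
definition [simp]: "modulo_fract = (mod_field :: 'a fract \<Rightarrow> 'a fract \<Rightarrow> 'a fract)"
definition [simp]: "euclidean_size_fract = (euclidean_size_field :: 'a fract \<Rightarrow> nat)"
definition [simp]: "division_segment (x :: 'a fract) = 1"

instance
  by standard (simp_all add: dvd_field_iff field_split_simps split: if_splits)

end

instantiation fract :: (idom) euclidean_ring_gcd
begin

definition "(gcd :: 'a fract \<Rightarrow> _) = Euclidean_Algorithm.gcd"
definition "(lcm :: 'a fract \<Rightarrow> _) = Euclidean_Algorithm.lcm"
definition "(Gcd :: 'a fract set \<Rightarrow> _) = Euclidean_Algorithm.Gcd"
definition "(Lcm :: 'a fract set \<Rightarrow> _) = Euclidean_Algorithm.Lcm"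

instance
  by standard (simp_all add: gcd_fract_def lcm_fract_def Gcd_fract_def Lcm_fract_def)

end

instance fract :: (idom) field_gcd ..

text \<open>A primitive element of the kernel of least degree in z generates it, by pseudo-division
  and Gauss's lemma. Contents can be removed because s is transcendental and so no nonzero
  polynomial in s alone is in the kernel. The irreducible f is associated to this generator.\<close>

lemma monic_irreducible_generates_kernel:
  fixes \<phi> :: "'k::field_gcd \<Rightarrow> 'm::field" and f q :: "'k poly poly"
  assumes h\<phi>: "hom_fun \<phi>" and s: "\<not> alg_over (range \<phi>) s"
    and f: "irreducible f" "evalp (evalp \<phi> s) z f = 0"
    and q: "evalp (evalp \<phi> s) z q = 0"
  shows "f dvd q"
proof -
  note hs = hom_fun_evalp[OF h\<phi>, of s]
  define E where "E = evalp (evalp \<phi> s) z"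
  have hE: "hom_fun E" unfolding E_def by (rule hom_fun_evalp[OF hs])
  have c: "evalp \<phi> s c \<noteq> 0" if "c \<noteq> 0" for c
  proof
    assume "evalp \<phi> s c = 0"
    moreover have "map_poly \<phi> c \<noteq> 0"
      using that hom_fun_eq_0_iff[OF h\<phi>] by (simp add: map_poly_eq_0_iff hom_fun_0[OF h\<phi>])
    moreover have "map_poly \<phi> c \<in> polys_over (range \<phi>)"
      using hom_fun_0[OF h\<phi>] by (auto simp: polys_over_def coeff_map_poly)
    ultimately show False using s by (auto simp: alg_over_def evalp_def)
  qed
  have "f \<noteq> 0" using f(1) by auto
  then have "\<exists>n g. g \<noteq> 0 \<and> E g = 0 \<and> degree g = n" using f(2) by (auto simp: E_def)
  from LeastI_ex[OF this] obtain g where g: "g \<noteq> 0" "E g = 0"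
    "degree g = (LEAST n. \<exists>g. g \<noteq> 0 \<and> E g = 0 \<and> degree g = n)" by blast
  have gmin: "degree g \<le> degree r" if "r \<noteq> 0" "E r = 0" for r
    unfolding g(3) using that by (intro Least_le) auto
  define p where "p = primitive_part g"
  have gp: "g = smult (content g) p" by (simp add: p_def)
  have p: "p \<noteq> 0" "content p = 1" "degree p = degree g" using g(1) by (simp_all add: p_def)
  have "E g = evalp \<phi> s (content g) * E p"
    by (subst gp) (simp add: E_def evalp_smult[OF hs])
  then have Ep: "E p = 0" using g(1,2) c[of "content g"] by simp
  have dvd: "p dvd r" if r: "E r = 0" for r
  proof -
    obtain a b where ab: "pseudo_divmod r p = (a, b)" by fastforce
    define k where "k = coeff p (degree p) ^ (Suc (degree r) - degree p)"
    have "k \<noteq> 0" unfolding k_def using p(1) by (intro power_not_zero) simp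
    have *: "smult k r = p * a + b" "b = 0 \<or> degree b < degree p"
      using pseudo_divmod[OF p(1) ab] by (auto simp: k_def)
    have "E b = 0"
      using arg_cong[OF *(1), of E] r Ep
      by (simp add: hom_fun_add[OF hE] hom_fun_mult[OF hE]) (simp add: E_def evalp_smult[OF hs])
    then have "b = 0" using gmin[of b] *(2) p(3) by (metis not_le)
    then have "p dvd smult k r" using * by simp
    then have "fract_poly p dvd smult (to_fract k) (fract_poly r)"
      using fract_poly_dvd[of p "smult k r"] by (simp only: fract_poly_smult)
    then have "fract_poly p dvd fract_poly r"
      using \<open>k \<noteq> 0\<close> by (simp add: dvd_smult_iff)
    then show ?thesis using p(2) by (rule fract_poly_dvdD)
  qed
  obtain b where b: "f = p * b" using dvd[of f] f(2) by (auto simp: E_def)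
  have "\<not> is_unit p"
  proof
    assume "is_unit p"
    then obtain c where "1 = p * c" by (rule dvdE)
    then have "E 1 = E (p * c)" by (rule arg_cong)
    then show False unfolding hom_fun_mult[OF hE] hom_fun_1[OF hE] Ep by simp
  qed
  then have "is_unit b" using f(1) b irreducibleD by blast
  then have "f dvd p" unfolding b by (simp add: mult_unit_dvd_iff)
  then show ?thesis using dvd[of q] q dvd_trans unfolding E_def by blast
qed

lemma hom_fun_poly_at: "hom_fun (\<lambda>p. poly p a)"
  by (simp add: hom_fun_def)

text \<open>In the coordinate ring of the chart, s and h(z) generate a proper ideal: as the kernel
  is generated by f, a relation for 1 would exhibit h as a divisor of 1 after setting s = 0.\<close>

lemma exists_place_at_infinity:
  fixes \<phi> :: "'k::field_gcd \<Rightarrow> 'm::field" and f :: "'k poly poly"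
  assumes h\<phi>: "hom_fun \<phi>" and s: "\<not> alg_over (range \<phi>) s"
    and f: "irreducible f" "evalp (evalp \<phi> s) z f = 0"
    and gh: "h dvd map_poly (\<lambda>c. poly c 0) f" "\<not> is_unit h"
  obtains V where "valuation_ring V" "range \<phi> \<subseteq> V" "s \<in> max_ideal V" "evalp \<phi> z h \<in> max_ideal V"
proof -
  note hs = hom_fun_evalp[OF h\<phi>, of s]
  define E where "E = evalp (evalp \<phi> s) z"
  have hE: "hom_fun E" unfolding E_def by (rule hom_fun_evalp[OF hs])
  define l where "l = map_poly (\<lambda>c. [:c:]) h"
  have El: "E l = evalp \<phi> z h" unfolding E_def l_def by (rule evalp_lift[OF h\<phi>])
  have Es: "E [:[:0, 1:]:] = s" and Ec: "\<phi> c = E [:[:c:]:]" for c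
    unfolding E_def by (simp_all add: evalp_const[OF hs] evalp_X[OF h\<phi>] evalp_const[OF h\<phi>])
  let ?J = "{[:[:0, 1:]:] * a + l * b |a b. True}"
  let ?I = "E ` ?J"
  have R: "ring_set (range E)" by (rule ring_set_range_hom[OF hE])
  have "ideal_set (range E) ?I"
    unfolding ideal_set_def
  proof (intro conjI ballI)
    show "?I \<subseteq> range E" by auto
    have "E ([:[:0, 1:]:] * 0 + l * 0) \<in> ?I" by blast
    then show "0 \<in> ?I" by (simp add: hom_fun_0[OF hE])
  next
    fix x y assume "x \<in> ?I" "y \<in> ?I"
    then obtain a b a' b' where xy: "x = E ([:[:0, 1:]:] * a + l * b)" "y = E ([:[:0, 1:]:] * a' + l * b')" by auto
    have "x + y = E ([:[:0, 1:]:] * (a + a') + l * (b + b'))"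
      unfolding xy by (simp only: hom_fun_add[OF hE] hom_fun_mult[OF hE] distrib_left add_ac)
    then show "x + y \<in> ?I" by blast
  next
    fix x y assume "x \<in> range E" "y \<in> ?I"
    then obtain r a b where xy: "x = E r" "y = E ([:[:0, 1:]:] * a + l * b)" by auto
    have "x * y = E ([:[:0, 1:]:] * (r * a) + l * (r * b))"
      unfolding xy by (simp only: hom_fun_add[OF hE] hom_fun_mult[OF hE] distrib_left mult_ac)
    then show "x * y \<in> ?I" by blast
  qed
  moreover have "1 \<notin> ?I"
  proof
    assume "1 \<in> ?I"
    then obtain a b where "1 = E ([:[:0, 1:]:] * a + l * b)" by blast
    then have "E (1 - ([:[:0, 1:]:] * a + l * b)) = 0"
      unfolding hom_fun_diff[OF hE] hom_fun_1[OF hE] by (rule right_minus_eq[THEN iffD2])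
    then have "f dvd 1 - ([:[:0, 1:]:] * a + l * b)"
      unfolding E_def by (rule monic_irreducible_generates_kernel[OF h\<phi> s f])
    then obtain k where k: "1 - ([:[:0, 1:]:] * a + l * b) = f * k" by (rule dvdE)
    define \<sigma> where "\<sigma> = map_poly (\<lambda>c::'k poly. poly c 0)"
    have h\<sigma>: "hom_fun \<sigma>" unfolding \<sigma>_def by (intro hom_fun_map_poly hom_fun_poly_at)
    have "\<sigma> [:[:0, 1:]:] = 0" by (simp add: \<sigma>_def map_poly_pCons)
    moreover have "\<sigma> l = h" by (simp add: \<sigma>_def l_def poly_eq_iff coeff_map_poly)
    ultimately have "1 - h * \<sigma> b = \<sigma> f * \<sigma> k"
      using arg_cong[OF k, of \<sigma>]
      by (simp only: hom_fun_diff[OF h\<sigma>] hom_fun_add[OF h\<sigma>] hom_fun_mult[OF h\<sigma>]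
          hom_fun_1[OF h\<sigma>] mult_zero_left add_0)
    then have "1 = h * \<sigma> b + \<sigma> f * \<sigma> k" by (simp add: algebra_simps)
    moreover have "h dvd h * \<sigma> b + \<sigma> f * \<sigma> k" using gh(1) by (auto simp: \<sigma>_def)
    ultimately show False using gh(2) by simp
  qed
  ultimately obtain V where V: "valuation_ring V" "range E \<subseteq> V" "?I \<subseteq> max_ideal V"
    by (rule exists_valuation_ring[OF R])
  have inI: "E ([:[:0, 1:]:] * a + l * b) \<in> max_ideal V" for a b
    by (rule subsetD[OF V(3)]) blast
  have "s = E ([:[:0, 1:]:] * 1 + l * 0)" "evalp \<phi> z h = E ([:[:0, 1:]:] * 0 + l * 1)"
    by (simp_all only: mult_1_right mult_zero_right add_0_right add_0_left Es El)
  then have "s \<in> max_ideal V" "evalp \<phi> z h \<in> max_ideal V" by (simp_all only: inI)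
  moreover have "range \<phi> \<subseteq> V" unfolding image_subset_iff Ec using V(2) by (simp add: image_subset_iff)
  ultimately show thesis by (intro that[OF V(1)])
qed

section \<open>Points over a transcendental extension of the constants\<close>

text \<open>A substitute for reduction to \<complex>, since the residue field of a valuation ring
  may be larger: with its maximal ideal as \<open>m\<close>, the functional factors through the
  quotient by \<open>m\<close>. A basis of \<open>m\<close> together with 1 is extended to a basis
  of the whole field.\<close>

lemma exists_linear_functional:
  fixes \<chi> :: "'c::field \<Rightarrow> 'm::field"
  assumes h: "hom_fun \<chi>" and m0: "0 \<in> m" and madd: "\<And>x y. x \<in> m \<Longrightarrow> y \<in> m \<Longrightarrow> x + y \<in> m"
    and mscale: "\<And>c x. x \<in> m \<Longrightarrow> \<chi> c * x \<in> m" and one: "1 \<notin> m"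
  obtains L where "\<And>x y. L (x + y) = L x + L y" "\<And>c x. L (\<chi> c * x) = c * L x"
    "\<And>x. x \<in> m \<Longrightarrow> L x = 0" "L 1 = 1"
proof -
  interpret V: vector_space "\<lambda>c x. \<chi> c * x"
    by unfold_locales (simp_all add: hom_funs[OF h] algebra_simps)
  have sub: "V.subspace m" using m0 madd mscale by (auto simp: V.subspace_def)
  obtain B where B: "B \<subseteq> m" "V.independent B" "m \<subseteq> V.span B"
    by (rule V.maximal_independent_subset)
  have span: "V.span B = m" by (rule V.span_subspace[OF B(1,3) sub])
  have ind: "V.independent (insert 1 B)" using one B(2) span by (intro V.independent_insertI) auto
  obtain B' where B': "insert 1 B \<subseteq> B'" "V.independent B'" "UNIV \<subseteq> V.span B'"
    by (rule V.maximal_independent_subset_extend[OF subset_UNIV ind])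
  define L where "L x = V.representation B' x 1" for x
  have "L (x + y) = L x + L y" for x y
    unfolding L_def using B' by (subst V.representation_add) auto
  moreover have "L (\<chi> c * x) = c * L x" for c x
    unfolding L_def using B' by (subst V.representation_scale) auto
  moreover have "L x = 0" if "x \<in> m" for x
  proof -
    have "L x = V.representation B x 1"
      unfolding L_def using B' that span by (subst V.representation_extend[of B' x B]) auto
    also have "\<dots> = 0" using V.representation_ne_zero[of B x 1] B(1) one by blast
    finally show ?thesis .
  qed
  moreover have "L 1 = 1" unfolding L_def using B' by (subst V.representation_basis) auto
  ultimately show thesis by (rule that)
qed

text \<open>The form splits into linear factors over \<complex>, and the maximal ideal is prime. It
  is homogeneous because \<open>A\<close> may lie in the maximal ideal, where B/A need not have a
  finite residue.\<close>

lemma homogeneous_root_in_max_ideal: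
  fixes \<chi> :: "complex \<Rightarrow> 'm::field"
  assumes h: "hom_fun \<chi>" and V: "valuation_ring V" "range \<chi> \<subseteq> V" and AB: "A \<in> V" "B \<in> V"
  shows "p \<noteq> 0 \<Longrightarrow> (\<Sum>i\<le>degree p. \<chi> (coeff p i) * B ^ i * A ^ (degree p - i)) \<in> max_ideal V \<Longrightarrow>
    \<exists>\<zeta>. poly p \<zeta> = 0 \<and> B - \<chi> \<zeta> * A \<in> max_ideal V"
proof (induction "degree p" arbitrary: p)
  case 0
  then obtain c where c: "p = [:c:]" "c \<noteq> 0" by (metis degree_eq_zeroE pCons_0_0)
  then have "\<chi> c \<in> max_ideal V" using 0 by simp
  moreover have "\<chi> c \<noteq> 0" using c hom_fun_eq_0_iff[OF h] by simp
  ultimately show ?case using field_set_unit[OF V(1) field_set_range_hom[OF h] V(2)] by blast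
next
  case (Suc n)
  define H where "H k q = (\<Sum>i\<le>k. \<chi> (coeff q i) * B ^ i * A ^ (k - i))" for k q
  have shift: "H (Suc k) (pCons 0 q) = B * H k q" for k q
    unfolding H_def by (subst sum.atMost_Suc_shift)
      (simp add: hom_fun_0[OF h] sum_distrib_left algebra_simps)
  have lower: "H (Suc k) q = A * H k q" if "degree q \<le> k" for k q
    unfolding H_def using that
    by (auto simp: coeff_eq_0 hom_fun_0[OF h] sum_distrib_left Suc_diff_le algebra_simps intro!: sum.cong)
  have diff: "H k (q - smult c r) = H k q - \<chi> c * H k r" for k q c r
    unfolding H_def by (simp add: hom_funs[OF h] left_diff_distrib sum_subtractf sum_distrib_left mult.assoc)
  have "\<not> constant (poly p)" using Suc(2) by (simp add: constant_degree)
  then obtain \<rho> where \<rho>: "poly p \<rho> = 0" using fundamental_theorem_of_algebra by blast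
  then obtain q where q: "p = [:-\<rho>, 1:] * q" by (auto simp: poly_eq_0_iff_dvd)
  have q0: "q \<noteq> 0" using q Suc by auto
  have deg: "degree q = n" using Suc(2) q0 unfolding q by (subst (asm) degree_mult_eq) auto
  have p: "p = pCons 0 q - smult \<rho> q" unfolding q by simp
  have "H (Suc n) p = (B - \<chi> \<rho> * A) * H n q"
    unfolding p diff shift lower[OF deg[THEN eq_imp_le]] by (simp add: algebra_simps)
  then have prod: "(B - \<chi> \<rho> * A) * H n q \<in> max_ideal V"
    using Suc by (simp add: H_def)
  note R = valuation_ring_ring[OF V(1)]
  have "H n q \<in> V" unfolding H_def using V(2) AB by (intro ring_set_intros[OF R]) auto
  moreover have "B - \<chi> \<rho> * A \<in> V" using V(2) AB by (intro ring_set_intros[OF R]) auto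
  ultimately consider "B - \<chi> \<rho> * A \<in> max_ideal V" | "H n q \<in> max_ideal V"
    using max_ideal_prime[OF V(1) _ _ prod] by blast
  then show ?case
  proof cases
    case 1
    then show ?thesis using \<rho> by blast
  next
    case 2
    then show ?thesis using Suc(1)[of q] deg q0 unfolding H_def q by auto
  qed
qed

text \<open>\<open>F\<close> is the field of the coefficients: \<complex>(t) is embedded by
  \<kappa>, and t stays transcendental over \<open>F\<close>. The ambient field may exceed
  F(t).\<close>

locale transcendental_extension =
  fixes \<kappa> :: "complex poly fract \<Rightarrow> 'm::field" and F :: "'m set"
  assumes hom: "hom_fun \<kappa>" and field: "field_set F"
    and const_in: "\<And>c. \<kappa> (to_fract [:c:]) \<in> F"
    and transcendental: "\<And>p. p \<in> polys_over F \<Longrightarrow> poly p (\<kappa> (to_fract [:0, 1:])) = 0 \<Longrightarrow> p = 0"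
begin

definition cst :: "complex \<Rightarrow> 'm" where "cst c = \<kappa> (to_fract [:c:])"
definition t :: 'm where "t = \<kappa> (to_fract [:0, 1:])"

lemma hom_cst: "hom_fun cst"
proof -
  have "hom_fun (\<lambda>c. to_fract [:c::complex:])"
    unfolding hom_fun_def by (auto simp: to_fract_add[symmetric] to_fract_mult[symmetric] one_pCons[symmetric]
        simp del: to_fract_add to_fract_mult)
  then show ?thesis unfolding cst_def[abs_def] by (rule hom_fun_comp[OF hom])
qed

lemma range_cst: "range cst \<subseteq> F"
  using const_in by (auto simp: cst_def)

lemma ring_F: "ring_set F"
  by (rule field_set_ring[OF field])

lemma map_cst_over: "map_poly cst p \<in> polys_over (range cst)"
  using hom_fun_0[OF hom_cst] by (auto simp: polys_over_def coeff_map_poly)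

lemma polys_over_range_cst:
  assumes "p \<in> polys_over (range cst)"
  obtains q where "p = map_poly cst q"
proof -
  define q where "q = map_poly (inv_into UNIV cst) p"
  have "cst (inv_into UNIV cst 0) = 0"
    using hom_fun_0[OF hom_cst] by (intro f_inv_into_f) (metis rangeI)
  then have inv0: "inv_into UNIV cst 0 = 0" using hom_fun_eq_0_iff[OF hom_cst] by simp
  have "p = map_poly cst q"
    using assms unfolding q_def
    by (intro poly_eqI) (simp add: coeff_map_poly inv0 hom_fun_0[OF hom_cst] f_inv_into_f polys_overD)
  then show thesis by (rule that)
qed

lemma hom_to_fract: "\<kappa> (to_fract p) = poly (map_poly cst p) t"
proof -
  have "\<kappa> (to_fract p) = evalp cst t p"
  proof (induction p)
    case 0
    then show ?case by (simp add: hom_fun_0[OF hom] evalp_0)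
  next
    case (pCons a p)
    have "pCons a p = [:a:] + [:0, 1:] * p" by simp
    then have "\<kappa> (to_fract (pCons a p)) = \<kappa> (to_fract ([:a:] + [:0, 1:] * p))" by simp
    also have "\<dots> = cst a + t * \<kappa> (to_fract p)"
      by (simp only: to_fract_add to_fract_mult hom_fun_add[OF hom] hom_fun_mult[OF hom] cst_def t_def)
    finally show ?case using pCons by (simp add: evalp_pCons[OF hom_cst])
  qed
  then show ?thesis by (simp add: evalp_def)
qed

lemma range_hom_cases:
  assumes "x \<in> range \<kappa>"
  obtains p q where "x = \<kappa> (to_fract p) / \<kappa> (to_fract q)" "q \<noteq> 0"
proof -
  obtain y where "x = \<kappa> y" using assms by blast
  moreover obtain p q where "y = Fract p q" "q \<noteq> 0" by (cases y)
  ultimately show thesis using that by (simp add: Fract_conv_to_fract hom_fun_divide[OF hom])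
qed

text \<open>The Gauss extension is trivial on \<complex>(t): a nonzero polynomial over \<complex>
  has a coefficient that is a unit of \<open>V\<close>, so its value at t is a unit of
  \<open>W\<close>.\<close>

lemma exists_Gauss:
  assumes V: "valuation_ring V" "range cst \<subseteq> V"
  obtains W where "valuation_ring W" "range \<kappa> \<subseteq> W"
    "\<And>p. p \<in> polys_over F \<Longrightarrow> poly p t \<in> W \<longleftrightarrow> (\<forall>i. coeff p i \<in> V)"
    "\<And>p. p \<in> polys_over F \<Longrightarrow> poly p t \<in> max_ideal W \<longleftrightarrow> (\<forall>i. coeff p i \<in> max_ideal V)"
proof -
  obtain W where W: "valuation_ring W"
    "\<And>p. p \<in> polys_over F \<Longrightarrow> poly p t \<in> W \<longleftrightarrow> (\<forall>i. coeff p i \<in> V)"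
    "\<And>p. p \<in> polys_over F \<Longrightarrow> poly p t \<in> max_ideal W \<longleftrightarrow> (\<forall>i. coeff p i \<in> max_ideal V)"
    using exists_Gauss_extension[OF V(1) field, of t] transcendental unfolding t_def by blast
  have over: "map_poly cst p \<in> polys_over F" for p
    using map_cst_over polys_over_mono[OF range_cst] by blast
  have in_W: "\<kappa> (to_fract p) \<in> W" for p
    unfolding hom_to_fract W(2)[OF over] using V(2) polys_overD[OF map_cst_over] by blast
  have unit: "\<kappa> (to_fract q) \<notin> max_ideal W" if "q \<noteq> 0" for q
  proof -
    have "cst (lead_coeff q) \<noteq> 0" using that hom_fun_eq_0_iff[OF hom_cst] by simp
    then have "cst (lead_coeff q) \<notin> max_ideal V"
      using field_set_unit[OF V(1) field_set_range_hom[OF hom_cst] V(2)] by blast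
    then have "coeff (map_poly cst q) (degree q) \<notin> max_ideal V"
      by (simp add: coeff_map_poly hom_fun_0[OF hom_cst])
    then show ?thesis unfolding hom_to_fract W(3)[OF over] by blast
  qed
  have "range \<kappa> \<subseteq> W"
  proof
    fix x assume "x \<in> range \<kappa>"
    then obtain p q where x: "x = \<kappa> (to_fract p) / \<kappa> (to_fract q)" "q \<noteq> 0" by (rule range_hom_cases)
    have "inverse (\<kappa> (to_fract q)) \<in> W" using unit[OF x(2)] by (auto simp: max_ideal_def)
    then show "x \<in> W" unfolding x(1) divide_inverse
      by (intro ring_set_mult[OF valuation_ring_ring[OF W(1)] in_W])
  qed
  then show thesis using W that by blast
qed

text \<open>The elements with a common denominator in \<open>\<complex>[t]\<close>: these are the ones for which the Gauss
  valuation is read off from the coefficients.\<close>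

definition polynomial_elements :: "'m set" where
  "polynomial_elements = {x. \<exists>q p. q \<noteq> 0 \<and> p \<in> polys_over F \<and> \<kappa> (to_fract q) * x = poly p t}"

lemma polynomial_elementsI:
  "q \<noteq> 0 \<Longrightarrow> p \<in> polys_over F \<Longrightarrow> \<kappa> (to_fract q) * x = poly p t \<Longrightarrow> x \<in> polynomial_elements"
  by (auto simp: polynomial_elements_def)

lemma poly_in_polynomial_elements: "p \<in> polys_over F \<Longrightarrow> poly p t \<in> polynomial_elements"
  by (rule polynomial_elementsI[of 1 p]) (auto simp: hom_fun_1[OF hom])

lemma range_hom_in_polynomial_elements: "range \<kappa> \<subseteq> polynomial_elements"
proof
  fix x assume "x \<in> range \<kappa>"
  then obtain p q where x: "x = \<kappa> (to_fract p) / \<kappa> (to_fract q)" "q \<noteq> 0" by (rule range_hom_cases)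
  then have "\<kappa> (to_fract q) * x = poly (map_poly cst p) t"
    using hom_fun_eq_0_iff[OF hom] by (simp add: hom_to_fract[symmetric])
  then show "x \<in> polynomial_elements"
    using x(2) map_cst_over polys_over_mono[OF range_cst] by (intro polynomial_elementsI) auto
qed

lemma ring_set_polynomial_elements: "ring_set polynomial_elements"
  unfolding ring_set_def
proof (intro conjI ballI)
  note R = ring_set_polys_over[OF ring_F]
  show "1 \<in> polynomial_elements" using range_hom_in_polynomial_elements hom_fun_1[OF hom] by (metis rangeI subsetD)
  fix x y assume "x \<in> polynomial_elements" "y \<in> polynomial_elements"
  then obtain q p q' p' where *: "q \<noteq> 0" "p \<in> polys_over F" "\<kappa> (to_fract q) * x = poly p t"
    "q' \<noteq> 0" "p' \<in> polys_over F" "\<kappa> (to_fract q') * y = poly p' t"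
    by (auto simp: polynomial_elements_def)
  have over: "map_poly cst p \<in> polys_over F" for p
    using map_cst_over polys_over_mono[OF range_cst] by blast
  have "\<kappa> (to_fract (q * q')) * (x - y) = poly (map_poly cst q' * p - map_poly cst q * p') t"
    using *(3,6) by (simp add: hom_fun_mult[OF hom] hom_to_fract algebra_simps) (simp add: mult.assoc[symmetric] mult.commute)
  moreover have "map_poly cst q' * p - map_poly cst q * p' \<in> polys_over F"
    using * over by (intro ring_set_diff[OF R] ring_set_mult[OF R])
  ultimately show "x - y \<in> polynomial_elements" using *(1,4) by (intro polynomial_elementsI[of "q * q'"]) auto
  have "\<kappa> (to_fract (q * q')) * (x * y) = (\<kappa> (to_fract q) * x) * (\<kappa> (to_fract q') * y)"
    by (simp add: hom_fun_mult[OF hom])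
  also have "\<dots> = poly (p * p') t" unfolding *(3,6) by simp
  finally show "x * y \<in> polynomial_elements"
    by (rule polynomial_elementsI[OF _ ring_set_mult[OF R *(2,5)], rotated]) (simp add: *(1,4))
qed

text \<open>If the residue \<open>P\<^sub>2/P\<^sub>1\<close> of a place is a root of a polynomial over \<open>\<complex>(t)\<close>, then that polynomial
  has a root in \<open>\<complex>(t)\<close>: at each \<open>w \<in> \<complex>\<close> the residue takes a value in \<open>\<complex>\<close>, so a \<open>\<complex>\<close>-linear
  functional applied to the coefficients of \<open>P\<^sub>1\<close> and \<open>P\<^sub>2\<close> produces a rational function with the
  same values.\<close>

lemma rational_root_of_residue:
  assumes V: "valuation_ring V" "range cst \<subseteq> V"
    and W: "valuation_ring W" "range \<kappa> \<subseteq> W"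
      "\<And>p. p \<in> polys_over F \<Longrightarrow> poly p t \<in> max_ideal W \<longleftrightarrow> (\<forall>i. coeff p i \<in> max_ideal V)"
    and q1: "q1 \<in> polys_over (V \<inter> F)" "coeff q1 i1 = 1" and q2: "q2 \<in> polys_over (V \<inter> F)"
    and z: "poly q2 t = z * poly q1 t" and q1W: "poly q1 t \<in> W"
    and g: "g \<noteq> 0" "evalp \<kappa> z g \<in> max_ideal W"
  shows "\<exists>\<zeta>. poly g \<zeta> = 0"
proof -
  note RV = valuation_ring_ring[OF V(1)] and IV = ideal_max_ideal[OF V(1)] and IW = ideal_max_ideal[OF W(1)]
  \<comment> \<open>The denominators of g are cleared, so that the coefficients of d are polynomials
    in t and can be specialised at t = w.\<close>
  obtain c d where cd: "g = smult c (fract_poly d)" by (rule content_decompose_fract)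
  have c: "c \<noteq> 0" and d: "d \<noteq> 0" using cd g(1) by auto
  define n where "n = degree d"
  have over: "map_poly cst p \<in> polys_over (V \<inter> F)" for p
    using map_cst_over polys_over_mono[of "range cst" "V \<inter> F"] V(2) range_cst by blast
  have RVF: "ring_set (V \<inter> F)" using RV ring_F by (auto simp: ring_set_def)
  note RP = ring_set_polys_over[OF RVF]
  \<comment> \<open>This is q1^n d(q2/q1). Its value at t lies in the maximal ideal of
    \<open>W\<close>, so its coefficients lie in that of \<open>V\<close>, and the relation survives
    every specialisation of t.\<close>
  define Q where "Q = (\<Sum>i\<le>n. map_poly cst (coeff d i) * q2 ^ i * q1 ^ (n - i))"
  have QP: "Q \<in> polys_over (V \<inter> F)"
    unfolding Q_def using over q1 q2 by (intro ring_set_intros[OF RP])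
  have "poly Q t = poly q1 t ^ n * evalp \<kappa> z (fract_poly d)"
  proof -
    have "degree (fract_poly d) \<le> n" by (simp add: n_def degree_map_poly)
    then have "evalp \<kappa> z (fract_poly d) = (\<Sum>i\<le>n. \<kappa> (to_fract (coeff d i)) * z ^ i)"
      by (subst evalp_altdef[OF hom]) (auto simp: coeff_map_poly)
    moreover have "poly (map_poly cst (coeff d i) * q2 ^ i * q1 ^ (n - i)) t =
        poly q1 t ^ n * (\<kappa> (to_fract (coeff d i)) * z ^ i)" if "i \<le> n" for i
    proof -
      have "poly q1 t ^ i * poly q1 t ^ (n - i) = poly q1 t ^ n"
        using that by (simp add: power_add[symmetric])
      then show ?thesis by (simp add: hom_to_fract z power_mult_distrib)
    qed
    ultimately show ?thesis
      unfolding Q_def poly_sum by (simp add: sum_distrib_left del: poly_mult poly_power)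
  qed
  moreover have "evalp \<kappa> z (fract_poly d) \<in> max_ideal W"
  proof -
    have "evalp \<kappa> z g = \<kappa> c * evalp \<kappa> z (fract_poly d)" unfolding cd by (rule evalp_smult[OF hom])
    moreover have "\<kappa> c \<in> W" "\<kappa> c \<notin> max_ideal W"
      using W(2) c hom_fun_eq_0_iff[OF hom] field_set_unit[OF W(1) field_set_range_hom[OF hom] W(2)] by auto
    ultimately show ?thesis using g(2) ideal_unit_cancel[OF W(1)] by metis
  qed
  ultimately have "poly Q t \<in> max_ideal W"
    using ideal_set_mult[OF IW ring_set_power[OF valuation_ring_ring[OF W(1)] q1W]] by metis
  then have Qm: "coeff Q i \<in> max_ideal V" for i
    using W(3)[of Q] polys_over_mono[of "V \<inter> F" F Q] QP by blast
  define ev where "ev w p = poly p (cst w)" for w and p :: "'m poly"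
  have evV: "ev w p \<in> V" if "p \<in> polys_over (V \<inter> F)" for w p
    unfolding ev_def using that V(2) polys_over_mono[of "V \<inter> F" V p] by (intro poly_in_ring_set[OF RV]) auto
  define dw where "dw w = map_poly (\<lambda>p. poly p w) d" for w
  \<comment> \<open>Avoiding the zeros of the leading coefficient of d keeps the specialised
    polynomial in degree n, so that the specialised form is its homogenisation.\<close>
  have root: "\<exists>\<zeta>. poly (dw w) \<zeta> = 0 \<and> ev w q2 - cst \<zeta> * ev w q1 \<in> max_ideal V"
    if w: "poly (lead_coeff d) w \<noteq> 0" for w
  proof (rule homogeneous_root_in_max_ideal[OF hom_cst V evV[OF q1(1)] evV[OF q2]])
    have cf: "coeff (dw w) n \<noteq> 0" using w by (simp add: dw_def coeff_map_poly n_def)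
    moreover have "degree (dw w) \<le> n" unfolding dw_def n_def
      by (intro degree_le) (auto simp: coeff_map_poly coeff_eq_0)
    ultimately have deg: "degree (dw w) = n" by (intro antisym le_degree)
    show "dw w \<noteq> 0" using cf by auto
    have "ev w Q = (\<Sum>i\<le>n. cst (coeff (dw w) i) * ev w q2 ^ i * ev w q1 ^ (n - i))"
    proof -
      have "poly (map_poly cst p) (cst w) = cst (poly p w)" for p
        using evalp_compose[OF hom_fun_id hom_cst, of w p] by (simp add: evalp_def)
      then show ?thesis by (simp add: Q_def ev_def poly_sum dw_def coeff_map_poly)
    qed
    moreover have "ev w Q \<in> max_ideal V"
      unfolding ev_def poly_altdef using Qm V(2)
      by (intro ideal_set_sum[OF IV] ideal_set_mult2[OF IV] ring_set_power[OF RV]) auto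
    ultimately show "(\<Sum>i\<le>degree (dw w). cst (coeff (dw w) i) * ev w q2 ^ i * ev w q1 ^ (degree (dw w) - i)) \<in> max_ideal V"
      using deg by simp
  qed
  have mscale: "cst c * x \<in> max_ideal V" if "x \<in> max_ideal V" for c x
    using that V(2) by (intro ideal_set_mult[OF IV]) auto
  obtain L where L: "\<And>x y. L (x + y) = L x + L y" "\<And>c x. L (cst c * x) = c * L x"
    "\<And>x. x \<in> max_ideal V \<Longrightarrow> L x = 0" "L 1 = 1"
  proof (rule exists_linear_functional[OF hom_cst ideal_set_zero[OF IV] ideal_set_add[OF IV] mscale
        one_notin_max_ideal[OF V(1)]])
  qed (auto intro: that)
  have L0: "L 0 = 0" using L(1)[of 0 0] by simp
  have Ldiff: "L (x - y) = L x - L y" for x y using L(1)[of "x - y" y] by simp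
  have Lev: "L (ev w p) = poly (map_poly L p) w" for w p
    unfolding ev_def
  proof (induction p)
    case (pCons a p)
    then show ?case by (simp add: L L0 map_poly_pCons)
  qed (simp add: L0)
  define r1 where "r1 = map_poly L q1"
  define r2 where "r2 = map_poly L q2"
  \<comment> \<open>Here the normalisations \<open>coeff q1 i1 = 1\<close> and
    \<open>L 1 = 1\<close> meet: the future denominator r1 is not zero.\<close>
  have "coeff r1 i1 = 1" using q1(2) by (simp add: r1_def coeff_map_poly L0 L(4))
  then have r1: "r1 \<noteq> 0" by auto
  \<comment> \<open>The homogenised value of d at r2/r1. It vanishes at all but finitely many w,
    hence identically.\<close>
  define H where "H = (\<Sum>i\<le>n. coeff d i * r2 ^ i * r1 ^ (n - i))"
  have "poly H w = 0" if w: "poly (lead_coeff d) w \<noteq> 0" for w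
  proof -
    obtain \<zeta> where \<zeta>: "poly (dw w) \<zeta> = 0" "ev w q2 - cst \<zeta> * ev w q1 \<in> max_ideal V"
      using root[OF w] by blast
    have r2: "poly r2 w = \<zeta> * poly r1 w"
      using L(3)[OF \<zeta>(2)] by (simp add: Ldiff L(2) Lev r1_def r2_def)
    have deg: "degree (dw w) \<le> n" unfolding dw_def n_def
      by (intro degree_le) (auto simp: coeff_map_poly coeff_eq_0)
    have "poly H w = (\<Sum>i\<le>n. (coeff (dw w) i * \<zeta> ^ i) * poly r1 w ^ n)"
      unfolding H_def poly_sum
      by (intro sum.cong refl)
        (simp add: r2 dw_def coeff_map_poly power_mult_distrib mult.assoc power_add[symmetric])
    also have "\<dots> = poly (dw w) \<zeta> * poly r1 w ^ n"
      unfolding poly_altdef_le[OF deg] by (rule sum_distrib_right[symmetric])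
    finally show ?thesis using \<zeta>(1) by simp
  qed
  then have "poly (H * lead_coeff d) w = 0" for w by (cases "poly (lead_coeff d) w = 0") auto
  then have "H * lead_coeff d = 0" using poly_all_0_iff_0 by blast
  then have H0: "H = 0" using d by simp
  define \<zeta> where "\<zeta> = to_fract r2 / to_fract r1"
  have "to_fract H = poly (fract_poly d) \<zeta> * to_fract r1 ^ n"
  proof -
    have "degree (fract_poly d) \<le> n" by (simp add: n_def degree_map_poly)
    moreover have pow: "to_fract (p ^ k) = to_fract p ^ k" for p :: "complex poly" and k
      by (induction k) simp_all
    moreover have "to_fract (coeff d i * r2 ^ i * r1 ^ (n - i)) =
        coeff (fract_poly d) i * \<zeta> ^ i * to_fract r1 ^ n" if "i \<le> n" for i
    proof -
      have "to_fract r1 ^ n = to_fract r1 ^ i * to_fract r1 ^ (n - i)"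
        using that by (simp add: power_add[symmetric])
      then show ?thesis using r1 by (simp add: coeff_map_poly \<zeta>_def pow power_divide)
    qed
    ultimately show ?thesis
      by (simp add: poly_altdef_le[of _ n] H_def sum_distrib_right del: to_fract_mult)
  qed
  then have "poly (fract_poly d) \<zeta> = 0" using H0 r1 by simp
  then show ?thesis using cd by auto
qed

section \<open>Algebraic dependence over the constants\<close>

lemma clear_denominators:
  assumes p: "p \<in> polys_over (field_adjoin (range cst) a)" "p \<noteq> 0"
  obtains P where "P \<noteq> 0" "\<And>b. poly p b = 0 \<Longrightarrow> evalp (evalp cst a) b P = 0"
proof -
  note ha = hom_fun_evalp[OF hom_cst, of a]
  have "\<exists>m n. coeff p i = evalp cst a m / evalp cst a n \<and> evalp cst a n \<noteq> 0" for i
  proof -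
    have "coeff p i \<in> field_adjoin (range cst) a" by (rule polys_overD[OF p(1)])
    then obtain u v where uv: "u \<in> polys_over (range cst)" "v \<in> polys_over (range cst)"
      "poly v a \<noteq> 0" "coeff p i = poly u a / poly v a" unfolding field_adjoin_def by blast
    obtain m where "u = map_poly cst m" by (rule polys_over_range_cst[OF uv(1)])
    moreover obtain n where "v = map_poly cst n" by (rule polys_over_range_cst[OF uv(2)])
    ultimately show ?thesis using uv(3,4) by (auto simp: evalp_def)
  qed
  then obtain m n where mn: "\<And>i. coeff p i = evalp cst a (m i) / evalp cst a (n i)" "\<And>i. evalp cst a (n i) \<noteq> 0"
    by metis
  define k where "k = degree p"
  define D where "D = (\<Prod>j\<le>k. n j)"
  define P where "P = (\<Sum>i\<le>k. monom (m i * (\<Prod>j\<in>{..k} - {i}. n j)) i)"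
  have coeffP: "evalp cst a (m i * (\<Prod>j\<in>{..k} - {i}. n j)) = evalp cst a D * coeff p i" if "i \<le> k" for i
  proof -
    have "D = n i * (\<Prod>j\<in>{..k} - {i}. n j)" unfolding D_def using that by (subst prod.remove[of _ i]) auto
    then show ?thesis using mn(2)[of i] by (simp add: hom_fun_mult[OF ha] mn(1))
  qed
  have D0: "evalp cst a D \<noteq> 0" using mn(2) by (simp add: D_def hom_fun_prod[OF ha])
  have "evalp (evalp cst a) b P = evalp cst a D * poly p b" for b
  proof -
    have "evalp (evalp cst a) b P = (\<Sum>i\<le>k. evalp cst a (m i * (\<Prod>j\<in>{..k} - {i}. n j)) * b ^ i)"
      by (simp add: P_def hom_fun_sum[OF hom_fun_evalp[OF ha]] evalp_monom[OF ha])
    also have "\<dots> = evalp cst a D * poly p b"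
      unfolding poly_altdef_le[OF eq_refl[OF k_def[symmetric]]] sum_distrib_left
      by (intro sum.cong) (auto simp: coeffP mult.assoc)
    finally show ?thesis .
  qed
  moreover have "P \<noteq> 0"
  proof
    assume "P = 0"
    moreover have "coeff P k = m k * (\<Prod>j\<in>{..k} - {k}. n j)"
      by (simp add: P_def coeff_sum sum.delta)
    ultimately have "m k * (\<Prod>j\<in>{..k} - {k}. n j) = 0" by (metis coeff_0)
    then have "evalp cst a D * coeff p k = 0" using coeffP[of k] by (simp only: evalp_0 order_refl)
    then show False using D0 p(2) by (simp add: k_def)
  qed
  ultimately show thesis using that by simp
qed

text \<open>Steinitz exchange by valuations. If b had a pole at a place trivial on \<complex>(a),
  dividing the relation between a and b by the top power b^N would put the coefficient of b^N, a
  nonzero polynomial in a, into the maximal ideal.\<close>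

lemma exchange:
  assumes a: "\<not> alg_over (range cst) a" and b: "alg_over (field_adjoin (range cst) b) a"
  shows "alg_over (field_adjoin (range cst) a) b"
  unfolding alg_over_iff[OF field_set_adjoin[OF field_set_range_hom[OF hom_cst]]]
proof (intro allI impI, rule ccontr)
  note k0 = field_set_range_hom[OF hom_cst]
  fix V assume V: "valuation_ring V" "field_adjoin (range cst) a \<subseteq> V" "b \<notin> V"
  note RV = valuation_ring_ring[OF V(1)] and IV = ideal_max_ideal[OF V(1)]
  have aV: "a \<in> V" and k0V: "range cst \<subseteq> V"
    using V(2) field_adjoin_self[OF k0, of a] field_adjoin_superset[OF k0, of a] by auto
  obtain p where "p \<in> polys_over (field_adjoin (range cst) b)" "p \<noteq> 0" "poly p a = 0"
    using b by (auto simp: alg_over_def)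
  then obtain P where P: "P \<noteq> 0" "evalp (evalp cst b) a P = 0"
    by (metis clear_denominators)
  define k where "k = degree P"
  define N where "N = Max ((\<lambda>j. degree (coeff P j)) ` {..k})"
  have N: "degree (coeff P j) \<le> N" if "j \<le> k" for j
    unfolding N_def using that by (intro Max_ge) auto
  have "N \<in> (\<lambda>j. degree (coeff P j)) ` {..k}" unfolding N_def by (intro Max_in) auto
  then obtain j0 where j0: "j0 \<le> k" "degree (coeff P j0) = N" by auto
  define r where "r = (\<Sum>j\<le>k. monom (coeff (coeff P j) N) j)"
  have r0: "r \<noteq> 0"
  proof (cases "coeff P j0 = 0")
    case False
    then have "coeff r j0 \<noteq> 0" using j0 by (auto simp: r_def coeff_sum sum.delta)
    then show ?thesis by auto
  next
    \<comment> \<open>As \<open>degree 0 = 0\<close>, the maximum may be attained at a vanishing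
      coefficient; then N = 0 and the leading coefficient of \<open>P\<close> is a nonzero
      constant.\<close>
    case True
    then have N0: "N = 0" using j0 by simp
    have "coeff P k \<noteq> 0" using P(1) by (simp add: k_def)
    moreover have "degree (coeff P k) = 0" using N[of k] N0 by simp
    ultimately have "coeff (coeff P k) 0 \<noteq> 0" by (metis leading_coeff_0_iff)
    then have "coeff r k \<noteq> 0" using N0 by (simp add: r_def coeff_sum sum.delta)
    then show ?thesis by auto
  qed
  have diff: "evalp cst b (coeff P j) * inverse b ^ N - cst (coeff (coeff P j) N) \<in> max_ideal V" if "j \<le> k" for j
  proof -
    have "map_poly cst (coeff P j) \<in> polys_over V" using map_cst_over polys_over_mono[OF k0V] by blast
    moreover have "degree (map_poly cst (coeff P j)) \<le> N"
      using N[OF that] hom_fun_0[OF hom_cst] by (intro degree_le) (auto simp: coeff_map_poly coeff_eq_0)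
    ultimately show ?thesis
      using poly_at_pole[OF V(1,3), of "map_poly cst (coeff P j)" N]
      by (simp add: evalp_def coeff_map_poly hom_fun_0[OF hom_cst])
  qed
  have "0 = (\<Sum>j\<le>k. evalp cst b (coeff P j) * a ^ j) * inverse b ^ N"
    using P(2) evalp_altdef[OF hom_fun_evalp[OF hom_cst, of b] eq_refl[OF k_def[symmetric]], of a] by simp
  also have "\<dots> = (\<Sum>j\<le>k. (evalp cst b (coeff P j) * inverse b ^ N - cst (coeff (coeff P j) N)) * a ^ j)
      + (\<Sum>j\<le>k. cst (coeff (coeff P j) N) * a ^ j)"
    unfolding sum_distrib_right sum.distrib[symmetric] by (intro sum.cong) (auto simp: algebra_simps)
  also have "(\<Sum>j\<le>k. cst (coeff (coeff P j) N) * a ^ j) = evalp cst a r"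
    by (simp add: r_def hom_fun_sum[OF hom_fun_evalp[OF hom_cst]] evalp_monom[OF hom_cst])
  finally have "evalp cst a r = - (\<Sum>j\<le>k. (evalp cst b (coeff P j) * inverse b ^ N - cst (coeff (coeff P j) N)) * a ^ j)"
    by (simp add: eq_neg_iff_add_eq_0 add.commute)
  also have "\<dots> \<in> max_ideal V"
    using diff aV by (intro ideal_set_uminus[OF RV IV] ideal_set_sum[OF IV] ideal_set_mult2[OF IV] ring_set_power[OF RV]) auto
  finally have m: "evalp cst a r \<in> max_ideal V" .
  have "map_poly cst r \<noteq> 0"
    using r0 hom_fun_eq_0_iff[OF hom_cst] by (simp add: map_poly_eq_0_iff hom_fun_0[OF hom_cst])
  then have "evalp cst a r \<noteq> 0" using a map_cst_over unfolding alg_over_def evalp_def by blast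
  moreover have "evalp cst a r \<in> field_adjoin (range cst) a"
    unfolding evalp_def by (rule field_adjoin_poly[OF k0 map_cst_over])
  ultimately show False using field_set_unit[OF V(1) field_set_adjoin[OF k0] V(2)] m by blast
qed

text \<open>\<open>(pX, pY)\<close> is a point of the curve with coefficients in \<open>F\<close>, and \<open>f\<close> is an equation of the curve in
  the coordinates \<open>1/x\<^sub>0\<close> and \<open>y\<^sub>0/x\<^sub>0\<close>, where \<open>x\<^sub>0 = x - c y\<close> and \<open>y\<^sub>0 = y\<close>: its points at infinity are
  the roots of \<open>f(0, \<cdot>)\<close>.\<close>

theorem no_independent_point:
  fixes pX pY :: "'m poly" and c :: complex and f :: "complex poly fract poly poly"
    and e :: "complex poly fract \<Rightarrow> 'l::field"
  assumes x0_def: "x0 = poly pX t - cst c * poly pY t" and y0_def: "y0 = poly pY t"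
    and p: "pX \<in> polys_over F" "pY \<in> polys_over F"
    and int: "\<And>W. valuation_ring W \<Longrightarrow> range \<kappa> \<subseteq> W \<Longrightarrow> x0 \<in> W \<Longrightarrow> y0 \<in> W"
    and f: "irreducible f" "lead_coeff f = 1"
      "x0 \<noteq> 0 \<Longrightarrow> evalp (evalp \<kappa> (inverse x0)) (y0 / x0) f = 0"
    and e: "hom_fun e" and roots: "evalp e a (map_poly (\<lambda>c. poly c 0) f) = 0"
      "evalp e b (map_poly (\<lambda>c. poly c 0) f) = 0" "a \<noteq> b"
    and \<gamma>: "\<And>V. valuation_ring V \<Longrightarrow> range cst \<subseteq> V \<Longrightarrow> (\<And>i. coeff pX i \<in> V) \<Longrightarrow> (\<And>i. coeff pY i \<in> V) \<Longrightarrow>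
      \<gamma>1 \<in> V \<and> \<gamma>2 \<in> V"
    and indep: "\<And>P. P \<noteq> 0 \<Longrightarrow> evalp (evalp cst \<gamma>1) \<gamma>2 P \<noteq> 0"
  shows False
proof -
  define k0 where "k0 = range cst"
  have k0: "field_set k0" unfolding k0_def by (rule field_set_range_hom[OF hom_cst])
  \<comment> \<open>The point is finite at the place \<open>V\<close> of the coefficients.\<close>
  define bd where "bd V \<longleftrightarrow> (\<forall>i. coeff pX i \<in> V) \<and> (\<forall>i. coeff pY i \<in> V)" for V
  have \<gamma>1: "\<not> alg_over k0 \<gamma>1"
  proof
    assume "alg_over k0 \<gamma>1"
    then obtain p where p: "p \<in> polys_over (range cst)" "p \<noteq> 0" "poly p \<gamma>1 = 0"
      by (auto simp: alg_over_def k0_def)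
    obtain q where q: "p = map_poly cst q" by (rule polys_over_range_cst[OF p(1)])
    have "evalp (evalp cst \<gamma>1) \<gamma>2 [:q:] = 0"
      unfolding evalp_const[OF hom_fun_evalp[OF hom_cst]] using p(3) by (simp add: evalp_def q)
    moreover have "[:q:] \<noteq> 0" using p(2) q by (cases "q = 0") simp_all
    ultimately show False using indep by blast
  qed
  have \<gamma>2: "\<not> alg_over (field_adjoin k0 \<gamma>1) \<gamma>2"
  proof
    assume "alg_over (field_adjoin k0 \<gamma>1) \<gamma>2"
    then obtain p where p: "p \<in> polys_over (field_adjoin (range cst) \<gamma>1)" "p \<noteq> 0" "poly p \<gamma>2 = 0"
      by (auto simp: alg_over_def k0_def)
    show False by (rule clear_denominators[OF p(1,2)]) (use indep p(3) in blast)
  qed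
  have \<gamma>': "\<gamma>1 \<in> V \<and> \<gamma>2 \<in> V" if "valuation_ring V" "k0 \<subseteq> V" "bd V" for V
    using \<gamma>[of V] that by (simp add: bd_def k0_def)
  have bounded: False if "\<And>V. valuation_ring V \<Longrightarrow> k0 \<subseteq> V \<Longrightarrow> bd V"
    using \<gamma>1 \<gamma>' that unfolding alg_over_iff[OF k0] by blast
  have cstW: "cst c \<in> W" if "range \<kappa> \<subseteq> W" for W using that by (auto simp: cst_def)
  \<comment> \<open>If x0 were in \<open>W\<close>, then by \<open>int\<close> so would be y0, hence
    both coordinates of the point, and the Gauss extension would show all their coefficients in
    \<open>V\<close>.\<close>
  have pole: "x0 \<notin> W" if V: "\<not> bd V" and W: "valuation_ring W" "range \<kappa> \<subseteq> W"
      "\<And>p. p \<in> polys_over F \<Longrightarrow> poly p t \<in> W \<longleftrightarrow> (\<forall>i. coeff p i \<in> V)" for V W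
  proof
    assume x0: "x0 \<in> W"
    note RW = valuation_ring_ring[OF W(1)]
    have y0: "y0 \<in> W" by (rule int[OF W(1,2) x0])
    have "poly pX t = x0 + cst c * y0" by (simp add: x0_def y0_def)
    then have "poly pX t \<in> W" using x0 y0 cstW[OF W(2)] RW by (auto intro: ring_set_intros)
    then show False using V W(3)[OF p(1)] W(3)[OF p(2)] y0 by (simp add: bd_def y0_def)
  qed
  have Xtrans: "\<not> alg_over (range \<kappa>) x0"
  proof
    assume alg: "alg_over (range \<kappa>) x0"
    show False
    proof (rule bounded, rule ccontr)
      fix V assume V: "valuation_ring V" "k0 \<subseteq> V" "\<not> bd V"
      obtain W where W: "valuation_ring W" "range \<kappa> \<subseteq> W"
        "\<And>p. p \<in> polys_over F \<Longrightarrow> poly p t \<in> W \<longleftrightarrow> (\<forall>i. coeff p i \<in> V)"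
        using exists_Gauss[OF V(1) V(2)[unfolded k0_def]] by metis
      have "x0 \<in> W" by (rule alg_over_in_valuation_ring[OF W(1) field_set_range_hom[OF hom] W(2) alg])
      then show False using pole[OF V(3) W] by blast
    qed
  qed
  have x0_nz: "x0 \<noteq> 0"
    using Xtrans alg_over_self[OF field_set_range_hom[OF hom], of 0] hom_fun_0[OF hom] by (metis rangeI)
  define s where "s = inverse x0"
  define z where "z = y0 / x0"
  have s0: "s \<noteq> 0" using x0_nz by (simp add: s_def)
  have strans: "\<not> alg_over (range \<kappa>) s"
    using Xtrans alg_over_inverse[OF field_set_range_hom[OF hom], of s] by (auto simp: s_def)
  have root: "evalp (evalp \<kappa> s) z f = 0" using f(3)[OF x0_nz] by (simp add: s_def z_def)
  have xy: "inverse s = x0" "z / s = y0" using x0_nz by (simp_all add: s_def z_def)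
  define f0 where "f0 = map_poly (\<lambda>c. poly c 0) f"
  have f0: "f0 \<noteq> 0"
  proof
    assume "f0 = 0"
    then have "coeff f0 (degree f) = 0" by simp
    then show False using f(2) by (simp add: f0_def coeff_map_poly)
  qed
  have sW: "s \<in> max_ideal W" if "valuation_ring W" "x0 \<notin> W" for W
    using inverse_max_ideal[OF that] by (simp add: s_def)
  have chart: "evalp (evalp \<kappa> s) z q \<in> W"
    if "valuation_ring W" "range \<kappa> \<subseteq> W" "s \<in> max_ideal W" for W q
    by (rule chart_in_valuation_ring[OF hom f(2) root that])
  have zW: "z \<in> W" if "valuation_ring W" "range \<kappa> \<subseteq> W" "s \<in> max_ideal W" for W
    using chart[OF that, of "[:0, 1:]"] by (simp add: evalp_X[OF hom_fun_evalp[OF hom]])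
  have f0W: "evalp \<kappa> z f0 \<in> max_ideal W"
    if W: "valuation_ring W" "range \<kappa> \<subseteq> W" "s \<in> max_ideal W" for W
    using special_fibre[OF hom root] chart[OF W] W(3) ideal_set_mult2[OF ideal_max_ideal[OF W(1)]]
    unfolding f0_def by metis
  \<comment> \<open>The residue of z at a Gauss place at infinity is a root of f(0, z); without a
    root in \<complex>(t) there is no such place, and the point is finite everywhere.\<close>
  obtain \<zeta> where \<zeta>: "poly f0 \<zeta> = 0"
  proof (rule ccontr)
    assume "\<not> thesis"
    with that have no: "\<nexists>\<zeta>. poly f0 \<zeta> = 0" by blast
    show False
    proof (rule bounded, rule ccontr)
      fix V assume V: "valuation_ring V" "k0 \<subseteq> V" "\<not> bd V"
      obtain W where W: "valuation_ring W" "range \<kappa> \<subseteq> W"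
        "\<And>p. p \<in> polys_over F \<Longrightarrow> poly p t \<in> W \<longleftrightarrow> (\<forall>i. coeff p i \<in> V)"
        "\<And>p. p \<in> polys_over F \<Longrightarrow> poly p t \<in> max_ideal W \<longleftrightarrow> (\<forall>i. coeff p i \<in> max_ideal V)"
        using exists_Gauss[OF V(1) V(2)[unfolded k0_def]] by metis
      have s: "s \<in> max_ideal W" by (rule sW[OF W(1) pole[OF V(3) W(1-3)]])
      note RW = valuation_ring_ring[OF W(1)]
      \<comment> \<open>Numerator and denominator of z = y0/x0, as polynomials in t, are both
        divided by the content of the denominator. Then q1 is primitive, and q2 is integral because
        z lies in \<open>W\<close>.\<close>
      define p1 where "p1 = pX - smult (cst c) pY"
      have p1: "poly p1 t = x0" "p1 \<in> polys_over F"
      proof -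
        show "poly p1 t = x0" by (simp add: p1_def x0_def)
        show "p1 \<in> polys_over F"
          unfolding p1_def using range_cst p
          by (intro ring_set_diff[OF ring_set_polys_over[OF ring_F]] polys_over_smult[OF ring_F]) auto
      qed
      then have "p1 \<noteq> 0" using x0_nz by auto
      from primitive_factor[OF V(1) field p1(2) this]
      obtain r q1 where q1: "r \<in> F" "r \<noteq> 0" "p1 = smult r q1" "q1 \<in> polys_over (V \<inter> F)" "\<exists>i. coeff q1 i = 1" .
      obtain i1 where i1: "coeff q1 i1 = 1" using q1(5) by blast
      define q2 where "q2 = smult (inverse r) pY"
      have q2F: "q2 \<in> polys_over F"
        unfolding q2_def by (intro polys_over_smult ring_F field_set_inverse field q1(1) p)
      have q1F: "q1 \<in> polys_over F" "\<And>i. coeff q1 i \<in> V" using q1(4) by (auto simp: polys_over_def)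
      have q1W: "poly q1 t \<in> W" using W(3)[OF q1F(1)] q1F(2) by blast
      have "x0 = r * poly q1 t" using p1(1) q1(3) by simp
      then have zq: "poly q2 t = z * poly q1 t" using x0_nz q1(2) by (simp add: q2_def z_def y0_def divide_inverse)
      then have "poly q2 t \<in> W" using ring_set_mult[OF RW zW[OF W(1,2) s] q1W] by simp
      then have "q2 \<in> polys_over (V \<inter> F)" using W(3)[OF q2F] q2F by (auto simp: polys_over_def)
      from rational_root_of_residue[OF V(1) V(2)[unfolded k0_def] W(1,2,4) q1(4) i1 this zq q1W f0 f0W[OF W(1,2) s]]
      show False using no by blast
    qed
  qed
  \<comment> \<open>The full multiplicity of the root goes into \<open>g\<close>, which makes
    \<open>g\<close> and \<open>h\<close> coprime.\<close>
  define n where "n = order \<zeta> f0"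
  define g where "g = [:-\<zeta>, 1:] ^ n"
  obtain h where h: "f0 = g * h" "\<not> [:-\<zeta>, 1:] dvd h"
    unfolding g_def n_def using order_decomp[OF f0] by blast
  have n0: "n \<noteq> 0" using \<zeta> f0 by (simp add: n_def order_root)
  have gu: "\<not> is_unit g" using n0 by (auto simp: g_def is_unit_power_iff is_unit_iff_degree)
  \<comment> \<open>A constant \<open>h\<close> would leave \<zeta> as the only root of f(0, z) in
    the larger field, contrary to the two distinct roots a and b.\<close>
  have hu: "\<not> is_unit h"
  proof
    assume "is_unit h"
    then obtain u where u: "h = [:u:]" "u \<noteq> 0" using is_unit_poly_iff not_is_unit_0 by metis
    have "x = e \<zeta>" if "evalp e x f0 = 0" for x
    proof -
      have "evalp e x f0 = (x - e \<zeta>) ^ n * e u"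
        unfolding h(1) g_def u(1) hom_fun_mult[OF hom_fun_evalp[OF e]] hom_fun_power[OF hom_fun_evalp[OF e]]
        by (simp add: evalp_const[OF e] evalp_pCons[OF e] evalp_0 hom_fun_1[OF e] hom_fun_minus[OF e])
      then show ?thesis using that u(2) hom_fun_eq_0_iff[OF e] by auto
    qed
    then show False using roots unfolding f0_def[symmetric] by metis
  qed
  have "coprime g h"
  proof -
    have "coprime [:-\<zeta>, 1:] h"
      using h(2) by (intro prime_elem_imp_coprime prime_elem_linear_field_poly) auto
    then show ?thesis by (simp add: g_def)
  qed
  then have bez: "fst (bezout_coefficients g h) * g + snd (bezout_coefficients g h) * h = 1"
    by (simp add: bezout_coefficients_fst_snd)
  obtain \<Phi> where \<Phi>: "\<And>S. ring_set S \<Longrightarrow> range \<kappa> \<subseteq> S \<Longrightarrow> inverse s \<in> S \<Longrightarrow> z / s \<in> S \<Longrightarrow> \<Phi> \<in> S"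
    "\<And>V. valuation_ring V \<Longrightarrow> range \<kappa> \<subseteq> V \<Longrightarrow> s \<in> max_ideal V \<Longrightarrow> evalp \<kappa> z g \<in> max_ideal V \<Longrightarrow> \<Phi> \<in> max_ideal V"
    "\<And>V. valuation_ring V \<Longrightarrow> range \<kappa> \<subseteq> V \<Longrightarrow> s \<in> max_ideal V \<Longrightarrow> evalp \<kappa> z h \<in> max_ideal V \<Longrightarrow> \<Phi> \<notin> V"
    using exists_Runge_function[OF hom s0 f(2) root h(1)[unfolded f0_def] bez] by blast
  have hg: "map_poly (\<lambda>c. poly c 0) f = h * g" using h(1) by (simp add: f0_def mult.commute)
  obtain \<Psi> where \<Psi>: "\<And>S. ring_set S \<Longrightarrow> range \<kappa> \<subseteq> S \<Longrightarrow> inverse s \<in> S \<Longrightarrow> z / s \<in> S \<Longrightarrow> \<Psi> \<in> S"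
    "\<And>V. valuation_ring V \<Longrightarrow> range \<kappa> \<subseteq> V \<Longrightarrow> s \<in> max_ideal V \<Longrightarrow> evalp \<kappa> z h \<in> max_ideal V \<Longrightarrow> \<Psi> \<in> max_ideal V"
    "\<And>V. valuation_ring V \<Longrightarrow> range \<kappa> \<subseteq> V \<Longrightarrow> s \<in> max_ideal V \<Longrightarrow> evalp \<kappa> z g \<in> max_ideal V \<Longrightarrow> \<Psi> \<notin> V"
    using exists_Runge_function[OF hom s0 f(2) root hg bez[unfolded add.commute[of "_ * g"]]] by blast
  have split: "evalp \<kappa> z g \<in> max_ideal W \<or> evalp \<kappa> z h \<in> max_ideal W"
    if W: "valuation_ring W" "range \<kappa> \<subseteq> W" "s \<in> max_ideal W" for W
  proof (rule max_ideal_prime[OF W(1)])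
    note RW = valuation_ring_ring[OF W(1)]
    show "evalp \<kappa> z g \<in> W" "evalp \<kappa> z h \<in> W"
      by (intro evalp_in_ring_set[OF hom RW W(2) zW[OF W]])+
    show "evalp \<kappa> z g * evalp \<kappa> z h \<in> max_ideal W"
      using f0W[OF W] by (simp add: h(1) hom_fun_mult[OF hom_fun_evalp[OF hom]])
  qed
  \<comment> \<open>Each function has a pole somewhere: the curve has places over every factor of
    f(0, z), though these need not be Gauss extensions.\<close>
  have nz: "\<Phi> \<noteq> 0" "\<Psi> \<noteq> 0"
  proof -
    have dvd: "h dvd map_poly (\<lambda>c. poly c 0) f" "g dvd map_poly (\<lambda>c. poly c 0) f" unfolding hg by simp_all
    obtain V where V: "valuation_ring V" "range \<kappa> \<subseteq> V" "s \<in> max_ideal V" "evalp \<kappa> z h \<in> max_ideal V"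
      by (rule exists_place_at_infinity[OF hom strans f(1) root dvd(1) hu])
    show "\<Phi> \<noteq> 0" using \<Phi>(3)[OF V] ring_set_zero[OF valuation_ring_ring[OF V(1)]] by auto
    obtain V where V: "valuation_ring V" "range \<kappa> \<subseteq> V" "s \<in> max_ideal V" "evalp \<kappa> z g \<in> max_ideal V"
      by (rule exists_place_at_infinity[OF hom strans f(1) root dvd(2) gu])
    show "\<Psi> \<noteq> 0" using \<Psi>(3)[OF V] ring_set_zero[OF valuation_ring_ring[OF V(1)]] by auto
  qed
  have XY: "x0 \<in> polynomial_elements" "y0 \<in> polynomial_elements"
  proof -
    note R = ring_set_polynomial_elements
    show y0: "y0 \<in> polynomial_elements" unfolding y0_def by (rule poly_in_polynomial_elements[OF p(2)])
    show "x0 \<in> polynomial_elements"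
      using poly_in_polynomial_elements[OF p(1)] y0 cstW[OF range_hom_in_polynomial_elements]
      unfolding x0_def y0_def by (intro ring_set_intros[OF R])
  qed
  have "\<Phi> \<in> polynomial_elements" "\<Psi> \<in> polynomial_elements"
    using XY by (intro \<Phi>(1) \<Psi>(1) ring_set_polynomial_elements range_hom_in_polynomial_elements; simp add: xy)+
  then obtain u p\<Phi> v p\<Psi> where uv: "u \<noteq> 0" "p\<Phi> \<in> polys_over F" "\<kappa> (to_fract u) * \<Phi> = poly p\<Phi> t"
    "v \<noteq> 0" "p\<Psi> \<in> polys_over F" "\<kappa> (to_fract v) * \<Psi> = poly p\<Psi> t"
    unfolding polynomial_elements_def by blast
  have denom: "poly q t \<in> W \<longleftrightarrow> \<Theta> \<in> W" "poly q t \<in> max_ideal W \<longleftrightarrow> \<Theta> \<in> max_ideal W"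
    if W: "valuation_ring W" "range \<kappa> \<subseteq> W" and u: "u \<noteq> 0" "\<kappa> (to_fract u) * \<Theta> = poly q t" for W u q \<Theta>
  proof -
    note RW = valuation_ring_ring[OF W(1)] and IW = ideal_max_ideal[OF W(1)]
    have uW: "\<kappa> (to_fract u) \<in> W" "\<kappa> (inverse (to_fract u)) \<in> W" using W(2) by auto
    have "\<Theta> = \<kappa> (inverse (to_fract u)) * poly q t"
      using u hom_fun_eq_0_iff[OF hom] by (simp add: u(2)[symmetric] hom_fun_inverse[OF hom])
    then show "poly q t \<in> W \<longleftrightarrow> \<Theta> \<in> W" "poly q t \<in> max_ideal W \<longleftrightarrow> \<Theta> \<in> max_ideal W"
      using u(2) uW ring_set_mult[OF RW] ideal_set_mult[OF IW] by metis+
  qed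
  \<comment> \<open>Stated for a variable field k, as it is applied to \<Phi> over the constants and
    to \<Psi> over the field generated by a coefficient of \<Phi>. At a place at infinity, algebraic
    coefficients exclude the pole of \<Theta> and, \<Theta> being nonzero, also its
    vanishing.\<close>
  have step: "bd V"
    if k: "field_set k" "k0 \<subseteq> k" and V: "valuation_ring V" "k \<subseteq> V"
      and u: "u \<noteq> 0" "q \<in> polys_over F" "\<kappa> (to_fract u) * \<Theta> = poly q t" "\<Theta> \<noteq> 0"
      and dich: "\<And>W. valuation_ring W \<Longrightarrow> range \<kappa> \<subseteq> W \<Longrightarrow> s \<in> max_ideal W \<Longrightarrow> \<Theta> \<in> max_ideal W \<or> \<Theta> \<notin> W"
      and alg: "\<And>i. alg_over k (coeff q i)" for k V u q \<Theta>
  proof (rule ccontr)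
    assume nbd: "\<not> bd V"
    have kV: "range cst \<subseteq> V" using k(2) V(2) by (auto simp: k0_def)
    obtain W where W: "valuation_ring W" "range \<kappa> \<subseteq> W"
        "\<And>p. p \<in> polys_over F \<Longrightarrow> poly p t \<in> W \<longleftrightarrow> (\<forall>i. coeff p i \<in> V)"
        "\<And>p. p \<in> polys_over F \<Longrightarrow> poly p t \<in> max_ideal W \<longleftrightarrow> (\<forall>i. coeff p i \<in> max_ideal V)"
      using exists_Gauss[OF V(1) kV] by metis
    have s: "s \<in> max_ideal W" by (rule sW[OF W(1) pole[OF nbd W(1-3)]])
    have "\<Theta> \<in> W"
      using denom(1)[OF W(1,2) u(1,3)] W(3)[OF u(2)] alg_over_in_valuation_ring[OF V(1) k(1) V(2) alg] by blast
    then have "\<Theta> \<in> max_ideal W" using dich[OF W(1,2) s] by blast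
    then have c: "coeff q i \<in> max_ideal V" for i
      using denom(2)[OF W(1,2) u(1,3)] W(4)[OF u(2)] by blast
    have "q \<noteq> 0" using u(1,3,4) hom_fun_eq_0_iff[OF hom] by auto
    then have "lead_coeff q \<noteq> 0" by simp
    then show False using alg_over_unit[OF V(1) k(1) V(2) alg] c by blast
  qed
  have dich\<Phi>: "\<Phi> \<in> max_ideal W \<or> \<Phi> \<notin> W" and dich\<Psi>: "\<Psi> \<in> max_ideal W \<or> \<Psi> \<notin> W"
    if "valuation_ring W" "range \<kappa> \<subseteq> W" "s \<in> max_ideal W" for W
    using split[OF that] \<Phi>(2,3)[OF that] \<Psi>(2,3)[OF that] by blast+
  obtain i where i: "\<not> alg_over k0 (coeff p\<Phi> i)"
    using bounded step[OF k0 order_refl _ _ uv(1-3) nz(1) dich\<Phi>] by blast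
  define \<phi> where "\<phi> = coeff p\<Phi> i"
  define k where "k = field_adjoin k0 \<phi>"
  have k: "field_set k" "k0 \<subseteq> k"
    unfolding k_def by (rule field_set_adjoin[OF k0], rule field_adjoin_superset[OF k0])
  \<comment> \<open>Otherwise \<gamma>1 and \<gamma>2 would both be algebraic over k0(\<phi>).
    Exchanging \<phi> for \<gamma>1 would make \<gamma>2 algebraic over k0(\<gamma>1).\<close>
  obtain j where j: "\<not> alg_over k (coeff p\<Psi> j)"
  proof (rule ccontr)
    assume "\<not> thesis"
    with that have alg: "\<And>j. alg_over k (coeff p\<Psi> j)" by blast
    have bdV: "bd V" if "valuation_ring V" "k \<subseteq> V" for V
      by (rule step[OF k that uv(4-6) nz(2) dich\<Psi> alg])
    have \<gamma>V: "\<gamma>1 \<in> V \<and> \<gamma>2 \<in> V" if "valuation_ring V" "k \<subseteq> V" for V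
      using \<gamma>'[OF that(1) _ bdV[OF that]] that(2) k(2) by blast
    define k1 where "k1 = field_adjoin k0 \<gamma>1"
    have k1: "field_set k1" unfolding k1_def by (rule field_set_adjoin[OF k0])
    have "alg_over k \<gamma>1" unfolding alg_over_iff[OF k(1)] using \<gamma>V by blast
    then have "alg_over k1 \<phi>" using exchange[of \<gamma>1 \<phi>] \<gamma>1 by (simp add: k_def k1_def k0_def)
    moreover have "alg_over k1 x" if "x \<in> k0" for x
      using that field_adjoin_superset[OF k0, of \<gamma>1] by (intro alg_over_self[OF k1]) (auto simp: k1_def)
    ultimately have "k \<subseteq> {x. alg_over k1 x}"
      unfolding k_def by (intro field_adjoin_least field_set_alg_over[OF k1]) auto
    then have "k \<subseteq> V" if "valuation_ring V" "k1 \<subseteq> V" for V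
      using alg_over_in_valuation_ring[OF that(1) k1 that(2)] by blast
    then have "alg_over k1 \<gamma>2" unfolding alg_over_iff[OF k1] using \<gamma>V by blast
    then show False using \<gamma>2 by (simp add: k1_def)
  qed
  obtain V where V: "valuation_ring V" "k0 \<subseteq> V" "\<phi> \<notin> V" "coeff p\<Psi> j \<notin> V"
    by (rule exists_two_poles[OF k0 i[folded \<phi>_def] j[unfolded k_def]])
  obtain W where W: "valuation_ring W" "range \<kappa> \<subseteq> W"
    "\<And>p. p \<in> polys_over F \<Longrightarrow> poly p t \<in> W \<longleftrightarrow> (\<forall>i. coeff p i \<in> V)"
    using exists_Gauss[OF V(1) V(2)[unfolded k0_def]] by metis
  have \<Phi>W: "\<Phi> \<notin> W" and \<Psi>W: "\<Psi> \<notin> W"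
    using denom(1)[OF W(1,2) uv(1,3)] denom(1)[OF W(1,2) uv(4,6)] W(3)[OF uv(2)] W(3)[OF uv(5)] V(3,4)
    by (auto simp: \<phi>_def)
  have "x0 \<notin> W"
  proof
    assume "x0 \<in> W"
    then have "\<Phi> \<in> W"
      using int[OF W(1,2)] by (intro \<Phi>(1) valuation_ring_ring[OF W(1)] W(2)) (auto simp: xy)
    then show False using \<Phi>W by blast
  qed
  then have s: "s \<in> max_ideal W" by (rule sW[OF W(1)])
  show False
    using split[OF W(1,2) s] \<Phi>(2)[OF W(1,2) s] \<Psi>(2)[OF W(1,2) s] max_ideal_subset[OF W(1)] \<Phi>W \<Psi>W by blast
qed

end

section \<open>Multivariate polynomials and Zariski topologies\<close>

definition mon_eval :: "('i \<Rightarrow> 'l::comm_ring_1) \<Rightarrow> ('i \<Rightarrow>\<^sub>0 nat) \<Rightarrow> 'l" where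
  "mon_eval x m = (\<Prod>i\<in>Poly_Mapping.keys m. x i ^ Poly_Mapping.lookup m i)"

lemma mon_eval_superset:
  assumes "finite S" "Poly_Mapping.keys m \<subseteq> S"
  shows "mon_eval x m = (\<Prod>i\<in>S. x i ^ Poly_Mapping.lookup m i)"
  unfolding mon_eval_def using assms by (intro prod.mono_neutral_left) (auto simp: in_keys_iff)

lemma keys_add_nat: "Poly_Mapping.keys (m + n) = Poly_Mapping.keys m \<union> Poly_Mapping.keys (n :: 'i \<Rightarrow>\<^sub>0 nat)"
  by (auto simp: in_keys_iff lookup_add)

lemma mon_eval_add: "mon_eval x (m + n) = mon_eval x m * mon_eval x n"
  by (simp add: mon_eval_superset[of "Poly_Mapping.keys (m + n)"] keys_add_nat lookup_add power_add prod.distrib)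

lemma mon_eval_0: "mon_eval x 0 = 1"
  by (simp add: mon_eval_def)

lemma eval_mpoly_superset:
  assumes "hom_fun e" "finite S" "Poly_Mapping.keys f \<subseteq> S"
  shows "eval_mpoly e x f = (\<Sum>m\<in>S. e (Poly_Mapping.lookup f m) * mon_eval x m)"
  unfolding eval_mpoly_def mon_eval_def[symmetric]
  using assms by (intro sum.mono_neutral_left) (auto simp: in_keys_iff hom_fun_0)

lemma eval_mpoly_add:
  assumes "hom_fun e"
  shows "eval_mpoly e x (f + g) = eval_mpoly e x f + eval_mpoly e x g"
proof -
  let ?S = "Poly_Mapping.keys f \<union> Poly_Mapping.keys g"
  have "Poly_Mapping.keys (f + g) \<subseteq> ?S" by (rule Poly_Mapping.keys_add)
  then show ?thesis
    by (simp add: eval_mpoly_superset[OF assms, of ?S] lookup_add hom_fun_add[OF assms] distrib_right sum.distrib)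
qed

lemma eval_mpoly_single:
  assumes "hom_fun e"
  shows "eval_mpoly e x (Poly_Mapping.single m c) = e c * mon_eval x m"
  using eval_mpoly_superset[OF assms, of "{m}" "Poly_Mapping.single m c" x] by simp

lemma eval_mpoly_0: "eval_mpoly e x 0 = 0"
  by (simp add: eval_mpoly_def)

lemma eval_mpoly_sum:
  assumes "hom_fun e"
  shows "eval_mpoly e x (sum F A) = (\<Sum>i\<in>A. eval_mpoly e x (F i))"
  by (induction A rule: infinite_finite_induct) (auto simp: eval_mpoly_0 eval_mpoly_add[OF assms])

lemma mpoly_sum_single: "f = (\<Sum>m\<in>Poly_Mapping.keys f. Poly_Mapping.single m (Poly_Mapping.lookup f m))"
  by (rule poly_mapping_eqI) (simp add: lookup_sum lookup_single when_def in_keys_iff)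

lemma hom_fun_eval_mpoly:
  fixes e :: "'k::comm_ring_1 \<Rightarrow> 'l::comm_ring_1"
  assumes h: "hom_fun e"
  shows "hom_fun (eval_mpoly e x)"
proof -
  have "eval_mpoly e x (f * g) = eval_mpoly e x f * eval_mpoly e x g" for f g
  proof -
    have "f * g = (\<Sum>m\<in>Poly_Mapping.keys f. \<Sum>n\<in>Poly_Mapping.keys g.
        Poly_Mapping.single (m + n) (Poly_Mapping.lookup f m * Poly_Mapping.lookup g n))"
      using arg_cong2[where f = times, OF mpoly_sum_single[of f] mpoly_sum_single[of g]]
      by (simp only: sum_product mult_single)
    then have "eval_mpoly e x (f * g) = (\<Sum>m\<in>Poly_Mapping.keys f. \<Sum>n\<in>Poly_Mapping.keys g.
        (e (Poly_Mapping.lookup f m) * mon_eval x m) * (e (Poly_Mapping.lookup g n) * mon_eval x n))"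
      by (simp add: eval_mpoly_sum[OF h] eval_mpoly_single[OF h] hom_fun_mult[OF h] mon_eval_add mult_ac)
    then show ?thesis
      by (simp add: sum_product[symmetric] eval_mpoly_def[of e x] mon_eval_def[symmetric])
  qed
  moreover have "eval_mpoly e x 1 = 1"
    using eval_mpoly_single[OF h, of x 0 1] by (simp add: mon_eval_0 hom_fun_1[OF h])
  ultimately show ?thesis by (simp add: hom_fun_def eval_mpoly_0 eval_mpoly_add[OF h])
qed

definition mconst :: "'k \<Rightarrow> ('i, 'k::comm_ring_1) mpoly" where
  "mconst c = Poly_Mapping.single 0 c"

definition mvar :: "'i \<Rightarrow> ('i, 'k::comm_ring_1) mpoly" where
  "mvar i = Poly_Mapping.single (Poly_Mapping.single i 1) 1"

lemma eval_mconst: "hom_fun e \<Longrightarrow> eval_mpoly e x (mconst c) = e c"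
  by (simp add: mconst_def eval_mpoly_single mon_eval_0)

lemma eval_mvar: "hom_fun e \<Longrightarrow> eval_mpoly e x (mvar i) = x i"
  by (simp add: mvar_def eval_mpoly_single hom_fun_1) (simp add: mon_eval_def)

definition mpolys_in :: "'i set \<Rightarrow> ('i, 'k::comm_ring_1) mpoly set" where
  "mpolys_in I = {f. vars f \<subseteq> I}"

lemma mpolys_in_iff: "f \<in> mpolys_in I \<longleftrightarrow> (\<forall>m\<in>Poly_Mapping.keys f. Poly_Mapping.keys m \<subseteq> I)"
  by (auto simp: mpolys_in_def vars_def)

lemma mconst_in: "mconst c \<in> mpolys_in I"
  by (auto simp: mpolys_in_iff mconst_def)

lemma mvar_in: "i \<in> I \<Longrightarrow> mvar i \<in> mpolys_in I"
  by (auto simp: mpolys_in_iff mvar_def split: if_splits)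

lemma ring_set_mpolys_in: "ring_set (mpolys_in I :: ('i, 'k::comm_ring_1) mpoly set)"
  unfolding ring_set_def
proof (intro conjI ballI)
  show "1 \<in> (mpolys_in I :: ('i, 'k) mpoly set)" by (auto simp: mpolys_in_iff split: if_splits)
  fix f g :: "('i, 'k) mpoly" assume fg: "f \<in> mpolys_in I" "g \<in> mpolys_in I"
  have "Poly_Mapping.keys (f - g) \<subseteq> Poly_Mapping.keys f \<union> Poly_Mapping.keys g"
    by (auto simp: in_keys_iff lookup_minus)
  then show "f - g \<in> mpolys_in I" using fg by (auto simp: mpolys_in_iff)
  show "f * g \<in> mpolys_in I"
    unfolding mpolys_in_iff
  proof
    fix m assume "m \<in> Poly_Mapping.keys (f * g)"
    then obtain a b where "m = a + b" "a \<in> Poly_Mapping.keys f" "b \<in> Poly_Mapping.keys g"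
      using keys_mult[of f g] by blast
    then show "Poly_Mapping.keys m \<subseteq> I" using fg by (auto simp: mpolys_in_iff keys_add_nat)
  qed
qed

definition degree_is :: "nat \<Rightarrow> ('i, 'k::comm_ring_1) mpoly set" where
  "degree_is d = {f. \<forall>m\<in>Poly_Mapping.keys f. (\<Sum>i\<in>Poly_Mapping.keys m. Poly_Mapping.lookup m i) = d}"

lemma degree_is_homogeneous: "f \<in> degree_is d \<Longrightarrow> homogeneous f"
  by (auto simp: degree_is_def homogeneous_def)

lemma degree_is_0: "0 \<in> degree_is d"
  by (simp add: degree_is_def)

lemma degree_is_add: "f \<in> degree_is d \<Longrightarrow> g \<in> degree_is d \<Longrightarrow> f + g \<in> degree_is d"
  using Poly_Mapping.keys_add[of f g] by (auto simp: degree_is_def)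

lemma degree_is_sum: "(\<And>i. i \<in> A \<Longrightarrow> F i \<in> degree_is d) \<Longrightarrow> sum F A \<in> degree_is d"
  by (induction A rule: infinite_finite_induct) (auto simp: degree_is_0 degree_is_add)

lemma degree_is_mconst: "mconst c \<in> degree_is 0"
  by (auto simp: degree_is_def mconst_def)

lemma degree_is_mvar: "mvar i \<in> degree_is 1"
  by (auto simp: degree_is_def mvar_def split: if_splits)

lemma total_degree_superset:
  fixes m :: "'i \<Rightarrow>\<^sub>0 nat"
  assumes "finite S" "Poly_Mapping.keys m \<subseteq> S"
  shows "(\<Sum>i\<in>Poly_Mapping.keys m. Poly_Mapping.lookup m i) = (\<Sum>i\<in>S. Poly_Mapping.lookup m i)"
  using assms by (intro sum.mono_neutral_left) (auto simp: in_keys_iff)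

lemma degree_is_mult:
  assumes "f \<in> degree_is d" "g \<in> degree_is d'"
  shows "f * g \<in> degree_is (d + d')"
  unfolding degree_is_def mem_Collect_eq
proof
  fix m assume "m \<in> Poly_Mapping.keys (f * g)"
  then obtain a b where *: "m = a + b" "a \<in> Poly_Mapping.keys f" "b \<in> Poly_Mapping.keys g"
    using keys_mult[of f g] by blast
  have "(\<Sum>i\<in>Poly_Mapping.keys m. Poly_Mapping.lookup m i) =
      (\<Sum>i\<in>Poly_Mapping.keys m. Poly_Mapping.lookup a i) + (\<Sum>i\<in>Poly_Mapping.keys m. Poly_Mapping.lookup b i)"
    by (simp add: *(1) lookup_add sum.distrib)
  also have "\<dots> = d + d'"
    using assms *(2,3) total_degree_superset[of "Poly_Mapping.keys m" a] total_degree_superset[of "Poly_Mapping.keys m" b]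
    by (auto simp: *(1) keys_add_nat degree_is_def)
  finally show "(\<Sum>i\<in>Poly_Mapping.keys m. Poly_Mapping.lookup m i) = d + d'" .
qed

lemma degree_is_power: "f \<in> degree_is d \<Longrightarrow> f ^ n \<in> degree_is (n * d)"
proof (induction n)
  case 0
  then show ?case using degree_is_mconst[of 1] by (simp add: mconst_def)
next
  case (Suc n)
  then show ?case using degree_is_mult[of f d "f ^ n" "n * d"] by simp
qed

lemma eval_homogeneous_scale:
  assumes h: "hom_fun e" and f: "f \<in> degree_is d"
  shows "eval_mpoly e (\<lambda>i. c * x i) f = c ^ d * eval_mpoly e x f"
proof -
  have "mon_eval (\<lambda>i. c * x i) m = c ^ (\<Sum>i\<in>Poly_Mapping.keys m. Poly_Mapping.lookup m i) * mon_eval x m" for m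
    by (simp add: mon_eval_def power_mult_distrib prod.distrib power_sum)
  then show ?thesis using f
    unfolding eval_mpoly_def mon_eval_def[symmetric] sum_distrib_left
    by (intro sum.cong) (auto simp: degree_is_def mult_ac)
qed

lemma eval_mpoly_cong:
  assumes "f \<in> mpolys_in I" "\<And>i. i \<in> I \<Longrightarrow> x i = y i"
  shows "eval_mpoly e x f = eval_mpoly e y f"
proof -
  have "x i = y i" if "m \<in> Poly_Mapping.keys f" "i \<in> Poly_Mapping.keys m" for m i
    using assms that by (auto simp: mpolys_in_iff)
  then show ?thesis unfolding eval_mpoly_def by simp
qed

section \<open>Zariski topologies on affine space and chains of closed sets\<close>

abbreviation aspace :: "'i set \<Rightarrow> ('i \<Rightarrow> 'l) set" where
  "aspace I \<equiv> I \<rightarrow>\<^sub>E UNIV"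

lemma openin_basic:
  "f \<in> mpolys_in I \<Longrightarrow> openin (affine_zariski e I) {x \<in> aspace I. eval_mpoly e x f \<noteq> 0}"
  unfolding affine_zariski_def by (rule topology_generated_by_Basis) (auto simp: mpolys_in_def)

lemma topspace_affine_zariski:
  fixes e :: "'k::comm_ring_1 \<Rightarrow> 'l::field"
  assumes "hom_fun e"
  shows "topspace (affine_zariski e I) = aspace I"
proof
  show "topspace (affine_zariski e I) \<subseteq> aspace I"
    unfolding affine_zariski_def topology_generated_by_topspace by auto
  have "openin (affine_zariski e I) {x \<in> aspace I. eval_mpoly e x 1 \<noteq> 0}"
    by (intro openin_basic ring_set_one[OF ring_set_mpolys_in])
  then show "aspace I \<subseteq> topspace (affine_zariski e I)"
    using openin_subset by (simp add: hom_fun_1[OF hom_fun_eval_mpoly[OF assms]])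
qed

lemma closedin_zero_set:
  fixes e :: "'k::comm_ring_1 \<Rightarrow> 'l::field"
  assumes "hom_fun e" "f \<in> mpolys_in I"
  shows "closedin (affine_zariski e I) {x \<in> aspace I. eval_mpoly e x f = 0}"
proof -
  have "aspace I - {x \<in> aspace I. eval_mpoly e x f = 0} = {x \<in> aspace I. eval_mpoly e x f \<noteq> 0}" by auto
  then show ?thesis
    using openin_basic[OF assms(2), of e] unfolding closedin_def topspace_affine_zariski[OF assms(1)] by auto
qed

text \<open>The generating sets already form a basis, because the nonvanishing set of
  \<open>f * g\<close> is the intersection of those of f and g.\<close>

lemma open_contains_basic:
  fixes e :: "'k::comm_ring_1 \<Rightarrow> 'l::field"
  assumes h: "hom_fun e" and U: "openin (affine_zariski e I) U" "p \<in> U"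
  shows "\<exists>f\<in>mpolys_in I. eval_mpoly e p f \<noteq> 0 \<and> {x \<in> aspace I. eval_mpoly e x f \<noteq> 0} \<subseteq> U"
proof -
  have "generate_topology_on {{x \<in> aspace I. eval_mpoly e x f \<noteq> 0} | f. vars f \<subseteq> I} U"
    using U(1) unfolding affine_zariski_def openin_topology_generated_by_iff .
  then show ?thesis using U(2)
  proof (induction rule: generate_topology_on.induct)
    case (Int a b)
    then obtain f g where fg: "f \<in> mpolys_in I" "g \<in> mpolys_in I" "eval_mpoly e p f \<noteq> 0" "eval_mpoly e p g \<noteq> 0"
      "{x \<in> aspace I. eval_mpoly e x f \<noteq> 0} \<subseteq> a" "{x \<in> aspace I. eval_mpoly e x g \<noteq> 0} \<subseteq> b" by blast
    show ?case
    proof (rule bexI[of _ "f * g"], rule conjI)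
      show "f * g \<in> mpolys_in I" using fg(1,2) by (rule ring_set_mult[OF ring_set_mpolys_in])
      show "eval_mpoly e p (f * g) \<noteq> 0"
        using fg(3,4) by (simp add: hom_fun_mult[OF hom_fun_eval_mpoly[OF h]])
      have "{x \<in> aspace I. eval_mpoly e x (f * g) \<noteq> 0} =
          {x \<in> aspace I. eval_mpoly e x f \<noteq> 0} \<inter> {x \<in> aspace I. eval_mpoly e x g \<noteq> 0}"
        by (auto simp: hom_fun_mult[OF hom_fun_eval_mpoly[OF h]])
      then show "{x \<in> aspace I. eval_mpoly e x (f * g) \<noteq> 0} \<subseteq> a \<inter> b" using fg(5,6) by auto
    qed
  next
    case (Basis s)
    then obtain f where "f \<in> mpolys_in I" "s = {x \<in> aspace I. eval_mpoly e x f \<noteq> 0}"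
      by (auto simp: mpolys_in_def)
    then show ?case using Basis(2) by (intro bexI[of _ f]) auto
  next
    case (UN K)
    then obtain k where k: "k \<in> K" "p \<in> k" by blast
    from UN.IH[OF k] obtain f where "f \<in> mpolys_in I" "eval_mpoly e p f \<noteq> 0"
      "{x \<in> aspace I. eval_mpoly e x f \<noteq> 0} \<subseteq> k" by (rule bexE) (elim conjE, rule that)
    then show ?case using Union_upper[OF k(1)] by (intro bexI[of _ f] conjI order_trans[OF _ Union_upper[OF k(1)]])
  next
    case Empty
    then show ?case by simp
  qed
qed

lemma closed_separation:
  fixes e :: "'k::comm_ring_1 \<Rightarrow> 'l::field"
  assumes h: "hom_fun e" and A: "closedin (subtopology (affine_zariski e I) S) A" "S \<subseteq> aspace I"
    and p: "p \<in> S" "p \<notin> A"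
  obtains f where "f \<in> mpolys_in I" "eval_mpoly e p f \<noteq> 0" "\<And>x. x \<in> A \<Longrightarrow> eval_mpoly e x f = 0"
proof -
  obtain B where B: "closedin (affine_zariski e I) B" "A = B \<inter> S"
    using A(1) unfolding closedin_subtopology by auto
  have "openin (affine_zariski e I) (aspace I - B)"
    using B(1) unfolding closedin_def topspace_affine_zariski[OF h] by simp
  moreover have "p \<in> aspace I - B" using p A(2) B(2) by auto
  ultimately obtain f where f: "f \<in> mpolys_in I" "eval_mpoly e p f \<noteq> 0"
    "{x \<in> aspace I. eval_mpoly e x f \<noteq> 0} \<subseteq> aspace I - B" using open_contains_basic[OF h, of I "aspace I - B" p] by blast
  show thesis
  proof (rule that[OF f(1,2)])
    fix x assume "x \<in> A"
    then have "x \<in> aspace I" "x \<in> B" using A(2) B(2) by auto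
    then show "eval_mpoly e x f = 0" using f(3) by blast
  qed
qed

text \<open>Irreducibility is primality of the vanishing ideal. Two proper closed subsets covering
  \<open>S\<close> give, by separation from points outside, two polynomials not vanishing on
  \<open>S\<close> whose product does.\<close>

lemma irreducible_zariski_iff:
  fixes e :: "'k::comm_ring_1 \<Rightarrow> 'l::field"
  assumes h: "hom_fun e" and S: "S \<subseteq> aspace I"
  shows "irreducible_top (subtopology (affine_zariski e I) S) \<longleftrightarrow> S \<noteq> {} \<and>
    (\<forall>f\<in>mpolys_in I. \<forall>g\<in>mpolys_in I. (\<forall>x\<in>S. eval_mpoly e x f * eval_mpoly e x g = 0) \<longrightarrow>
       (\<forall>x\<in>S. eval_mpoly e x f = 0) \<or> (\<forall>x\<in>S. eval_mpoly e x g = 0))" (is "?L \<longleftrightarrow> ?R")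
proof -
  let ?T = "subtopology (affine_zariski e I) S"
  have top: "topspace ?T = S" using S by (auto simp: topspace_affine_zariski[OF h])
  show ?thesis
  proof
    assume L: ?L
    have "(\<forall>x\<in>S. eval_mpoly e x f = 0) \<or> (\<forall>x\<in>S. eval_mpoly e x g = 0)"
      if f: "f \<in> mpolys_in I" and g: "g \<in> mpolys_in I" and fg: "\<forall>x\<in>S. eval_mpoly e x f * eval_mpoly e x g = 0" for f g
    proof -
      have cl: "closedin ?T {x \<in> S. eval_mpoly e x q = 0}" if "q \<in> mpolys_in I" for q
        unfolding closedin_subtopology
        using closedin_zero_set[OF h that] S by (intro exI[of _ "{x \<in> aspace I. eval_mpoly e x q = 0}"]) auto
      have "{x \<in> S. eval_mpoly e x f = 0} \<union> {x \<in> S. eval_mpoly e x g = 0} = S" using fg by auto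
      then have "{x \<in> S. eval_mpoly e x f = 0} = S \<or> {x \<in> S. eval_mpoly e x g = 0} = S"
        using L cl[OF f] cl[OF g] unfolding irreducible_top_def top by blast
      then show ?thesis by blast
    qed
    moreover have "S \<noteq> {}" using L unfolding irreducible_top_def top by simp
    ultimately show ?R by (intro conjI ballI impI) assumption+
  next
    assume R: ?R
    have AB: "A = S \<or> B = S" if A: "closedin ?T A" and B: "closedin ?T B" and AB: "A \<union> B = S" for A B
    proof (rule ccontr)
      assume "\<not> (A = S \<or> B = S)"
      then obtain p q where pq: "p \<in> S" "p \<notin> A" "q \<in> S" "q \<notin> B" using AB by blast
      obtain f where f: "f \<in> mpolys_in I" "eval_mpoly e p f \<noteq> 0" "\<And>x. x \<in> A \<Longrightarrow> eval_mpoly e x f = 0"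
        by (rule closed_separation[OF h A S pq(1,2)]) (rule that)
      obtain g where g: "g \<in> mpolys_in I" "eval_mpoly e q g \<noteq> 0" "\<And>x. x \<in> B \<Longrightarrow> eval_mpoly e x g = 0"
        by (rule closed_separation[OF h B S pq(3,4)]) (rule that)
      have "\<forall>x\<in>S. eval_mpoly e x f * eval_mpoly e x g = 0" using f(3) g(3) AB by auto
      then show False using R f(1,2) g(1,2) pq by blast
    qed
    show ?L
      unfolding irreducible_top_def top
    proof (intro conjI allI impI)
      show "S \<noteq> {}" using R by simp
    qed (rule AB)
  qed
qed

lemma krull_dim_ge:
  assumes "\<And>i. i \<le> n \<Longrightarrow> closedin T (C i) \<and> irreducible_top (subtopology T (C i))" "\<And>i. i < n \<Longrightarrow> C i \<subset> C (Suc i)"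
  shows "krull_dim T \<ge> ereal (real n)"
  unfolding krull_dim_def
proof (rule SUP_upper, rule CollectI, rule exI[of _ C], intro conjI allI impI)
  show "closedin T (C i)" "irreducible_top (subtopology T (C i))" if "i \<le> n" for i
    using assms(1)[OF that] by simp_all
qed (rule assms(2))

lemma krull_dim_le_1:
  assumes "\<And>Z0 Z1 Z2. closedin T Z0 \<Longrightarrow> closedin T Z1 \<Longrightarrow> closedin T Z2 \<Longrightarrow>
    irreducible_top (subtopology T Z0) \<Longrightarrow> irreducible_top (subtopology T Z1) \<Longrightarrow>
    irreducible_top (subtopology T Z2) \<Longrightarrow> Z0 \<subset> Z1 \<Longrightarrow> Z1 \<subset> Z2 \<Longrightarrow> False"
  shows "krull_dim T \<le> 1"
  unfolding krull_dim_def
proof (rule SUP_least)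
  fix n assume "n \<in> {n. \<exists>Z :: nat \<Rightarrow> 'a set. (\<forall>i\<le>n. closedin T (Z i) \<and> irreducible_top (subtopology T (Z i))) \<and>
    (\<forall>i<n. Z i \<subset> Z (Suc i))}"
  then obtain Z :: "nat \<Rightarrow> 'a set" where Z: "\<forall>i\<le>n. closedin T (Z i) \<and> irreducible_top (subtopology T (Z i))"
    "\<forall>i<n. Z i \<subset> Z (Suc i)" by blast
  have "n \<le> 1"
  proof (rule ccontr)
    assume "\<not> n \<le> 1"
    then have n: "2 \<le> n" by simp
    show False
    proof (rule assms)
      show "closedin T (Z 0)" "irreducible_top (subtopology T (Z 0))" "closedin T (Z 1)"
        "irreducible_top (subtopology T (Z 1))" "closedin T (Z 2)" "irreducible_top (subtopology T (Z 2))"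
        using Z(1)[rule_format, of 0] Z(1)[rule_format, of 1] Z(1)[rule_format, of 2] n by simp_all
      show "Z 0 \<subset> Z 1" "Z 1 \<subset> Z 2"
        using Z(2)[rule_format, of 0] Z(2)[rule_format, of 1] n by (auto simp: numeral_2_eq_2)
    qed
  qed
  then have "real n \<le> 1" by simp
  then show "ereal (real n) \<le> 1" unfolding one_ereal_def ereal_less_eq .
qed

section \<open>An ultrapower of the rational functions\<close>

text \<open>Zorn's lemma for proper filters below \<open>F\<close>: an event of the infimum of a
  chain is an event of one member, so the infimum stays proper. A minimal filter decides every
  predicate, since otherwise restricting to the predicate would refine it.\<close>

lemma exists_ultrafilter:
  fixes F :: "'a filter"
  assumes "F \<noteq> bot"
  obtains U where "U \<le> F" "U \<noteq> bot" "\<And>P. eventually P U \<or> eventually (\<lambda>x. \<not> P x) U"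
proof -
  let ?A = "{G. G \<le> F \<and> G \<noteq> bot}"
  let ?P = "\<lambda>G H :: 'a filter. H \<le> G"
  have "\<exists>U\<in>?A. \<forall>G\<in>?A. ?P U G \<longrightarrow> G = U"
  proof (rule predicate_Zorn)
    show "partial_order_on ?A (relation_of ?P ?A)"
      by (rule partial_order_on_relation_ofI) auto
  next
    fix C assume C: "C \<in> Chains (relation_of ?P ?A)"
    then have CA: "C \<subseteq> ?A" and tot: "\<And>G H. G \<in> C \<Longrightarrow> H \<in> C \<Longrightarrow> G \<le> H \<or> H \<le> G"
      by (auto simp: Chains_def relation_of_def)
    show "\<exists>u\<in>?A. \<forall>a\<in>C. ?P a u"
    proof (cases "C = {}")
      case True
      then show ?thesis using assms by auto
    next
      case False
      have base: "eventually P (Inf C) \<longleftrightarrow> (\<exists>b\<in>C. eventually P b)" for P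
      proof (rule eventually_Inf_base[OF False])
        fix G H assume "G \<in> C" "H \<in> C"
        then show "\<exists>x\<in>C. x \<le> inf G H" using tot[of G H] by (metis inf.absorb1 inf.absorb2 order_refl)
      qed
      have "Inf C \<noteq> bot" using base[of "\<lambda>_. False"] CA by (auto simp: trivial_limit_def)
      moreover obtain G where "G \<in> C" using False by blast
      then have "Inf C \<le> F" using CA Inf_lower[of G C] by auto
      ultimately show ?thesis using Inf_lower[of _ C] by blast
    qed
  qed
  then obtain U where U: "U \<le> F" "U \<noteq> bot" "\<And>G. G \<le> F \<Longrightarrow> G \<noteq> bot \<Longrightarrow> G \<le> U \<Longrightarrow> G = U" by blast
  have "eventually P U \<or> eventually (\<lambda>x. \<not> P x) U" for P
  proof (rule disjCI)
    assume "\<not> eventually (\<lambda>x. \<not> P x) U"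
    then have "inf U (principal {x. P x}) \<noteq> bot"
      by (auto simp: trivial_limit_def eventually_inf_principal)
    then have "inf U (principal {x. P x}) = U" using U(1) by (intro U(3)) (auto intro: le_infI1)
    moreover have "eventually P (inf U (principal {x. P x}))" by (simp add: eventually_inf_principal)
    ultimately show "eventually P U" by simp
  qed
  then show thesis using U(1,2) that by blast
qed

type_synonym index = "complex poly poly"

text \<open>The ultrapower of \<open>\<complex>(t)\<close> in which a family of points, indexed by the nonzero polynomials in two
  variables and avoiding them one by one, becomes a point avoiding all of them.\<close>

definition divisibility_filter :: "index filter" where
  "divisibility_filter = Abs_filter (\<lambda>R. \<exists>Q. Q \<noteq> 0 \<and> (\<forall>P. P \<noteq> 0 \<longrightarrow> Q dvd P \<longrightarrow> R P))"

lemma eventually_divisibility_filter: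
  "eventually R divisibility_filter \<longleftrightarrow> (\<exists>Q. Q \<noteq> 0 \<and> (\<forall>P. P \<noteq> 0 \<longrightarrow> Q dvd P \<longrightarrow> R P))"
  unfolding divisibility_filter_def
proof (rule eventually_Abs_filter, unfold_locales)
  show "\<exists>Q::index. Q \<noteq> 0 \<and> (\<forall>P. P \<noteq> 0 \<longrightarrow> Q dvd P \<longrightarrow> True)" by (intro exI[of _ 1]) simp
next
  fix R S :: "index \<Rightarrow> bool"
  assume "\<exists>Q. Q \<noteq> 0 \<and> (\<forall>P. P \<noteq> 0 \<longrightarrow> Q dvd P \<longrightarrow> R P)" "\<exists>Q. Q \<noteq> 0 \<and> (\<forall>P. P \<noteq> 0 \<longrightarrow> Q dvd P \<longrightarrow> S P)"
  then obtain Q Q' where "Q \<noteq> 0" "Q' \<noteq> 0" "\<forall>P. P \<noteq> 0 \<longrightarrow> Q dvd P \<longrightarrow> R P" "\<forall>P. P \<noteq> 0 \<longrightarrow> Q' dvd P \<longrightarrow> S P"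
    by blast
  then show "\<exists>Q. Q \<noteq> 0 \<and> (\<forall>P. P \<noteq> 0 \<longrightarrow> Q dvd P \<longrightarrow> R P \<and> S P)"
    by (intro exI[of _ "Q * Q'"]) (auto dest: dvd_mult_left dvd_mult_right)
qed auto

lemma divisibility_filter_nonbot: "divisibility_filter \<noteq> bot"
  unfolding trivial_limit_def eventually_divisibility_filter by (metis dvd_refl)

definition ultra :: "index filter" where
  "ultra = (SOME U. U \<le> divisibility_filter \<and> U \<noteq> bot \<and> (\<forall>P. eventually P U \<or> eventually (\<lambda>x. \<not> P x) U))"

lemma ultra: "ultra \<le> divisibility_filter" "ultra \<noteq> bot" "eventually P ultra \<or> eventually (\<lambda>x. \<not> P x) ultra"
proof -
  have "\<exists>U. U \<le> divisibility_filter \<and> U \<noteq> bot \<and> (\<forall>P. eventually P U \<or> eventually (\<lambda>x. \<not> P x) U)"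
    using exists_ultrafilter[OF divisibility_filter_nonbot] by metis
  from someI_ex[OF this] show "ultra \<le> divisibility_filter" "ultra \<noteq> bot"
    "eventually P ultra \<or> eventually (\<lambda>x. \<not> P x) ultra" unfolding ultra_def by blast+
qed

lemma eventually_ultra_dvd:
  assumes "Q \<noteq> 0" "\<And>P. P \<noteq> 0 \<Longrightarrow> Q dvd P \<Longrightarrow> R P"
  shows "eventually R ultra"
  using ultra(1) assms unfolding le_filter_def eventually_divisibility_filter by blast

quotient_type ultrapower = "index \<Rightarrow> Ct" / "\<lambda>f g. eventually (\<lambda>x. f x = g x) ultra"
proof (rule equivpI)
  show "reflp (\<lambda>f g. eventually (\<lambda>x. f x = g x) ultra)" by (simp add: reflp_def)
  show "symp (\<lambda>f g. eventually (\<lambda>x. f x = g x) ultra)" by (simp add: symp_def eq_commute)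
  show "transp (\<lambda>f g. eventually (\<lambda>x. f x = g x) ultra)"
    by (rule transpI) (auto elim: eventually_elim2)
qed

instantiation ultrapower :: field
begin

lift_definition zero_ultrapower :: ultrapower is "\<lambda>_. 0" .
lift_definition one_ultrapower :: ultrapower is "\<lambda>_. 1" .
lift_definition plus_ultrapower :: "ultrapower \<Rightarrow> ultrapower \<Rightarrow> ultrapower" is "\<lambda>f g x. f x + g x"
  by (auto elim: eventually_elim2)
lift_definition minus_ultrapower :: "ultrapower \<Rightarrow> ultrapower \<Rightarrow> ultrapower" is "\<lambda>f g x. f x - g x"
  by (auto elim: eventually_elim2)
lift_definition times_ultrapower :: "ultrapower \<Rightarrow> ultrapower \<Rightarrow> ultrapower" is "\<lambda>f g x. f x * g x"
  by (auto elim: eventually_elim2)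
lift_definition divide_ultrapower :: "ultrapower \<Rightarrow> ultrapower \<Rightarrow> ultrapower" is "\<lambda>f g x. f x / g x"
  by (auto elim: eventually_elim2)
lift_definition uminus_ultrapower :: "ultrapower \<Rightarrow> ultrapower" is "\<lambda>f x. - f x"
  by (auto elim: eventually_mono)
lift_definition inverse_ultrapower :: "ultrapower \<Rightarrow> ultrapower" is "\<lambda>f x. inverse (f x)"
  by (auto elim: eventually_mono)

instance
proof
  fix a b c :: ultrapower
  show "a + b + c = a + (b + c)" by transfer (simp add: add.assoc)
  show "a + b = b + a" by transfer (simp add: add.commute)
  show "0 + a = a" by transfer simp
  show "- a + a = 0" by transfer simp
  show "a - b = a + - b" by transfer simp
  show "a * b * c = a * (b * c)" by transfer (simp add: mult.assoc)
  show "a * b = b * a" by transfer (simp add: mult.commute)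
  show "1 * a = a" by transfer simp
  show "(a + b) * c = a * c + b * c" by transfer (simp add: distrib_right)
  show "(0::ultrapower) \<noteq> 1" by transfer (use ultra(2) in \<open>simp add: trivial_limit_def\<close>)
  show "a div b = a * inverse b" by transfer (simp add: divide_inverse)
  show "inverse (0::ultrapower) = 0" by transfer simp
  show "inverse a * a = 1" if "a \<noteq> 0"
    using that
  proof transfer
    fix f :: "index \<Rightarrow> Ct" assume "\<not> (\<forall>\<^sub>F x in ultra. f x = 0)"
    then have "\<forall>\<^sub>F x in ultra. f x \<noteq> 0" using ultra(3)[of "\<lambda>x. f x = 0"] by blast
    then show "\<forall>\<^sub>F x in ultra. inverse (f x) * f x = 1" by (rule eventually_mono) simp
  qed
qed

end

definition cls :: "(index \<Rightarrow> Ct) \<Rightarrow> ultrapower" where "cls = abs_ultrapower"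

lemma cls_eq_iff: "cls f = cls g \<longleftrightarrow> eventually (\<lambda>x. f x = g x) ultra"
  by (simp add: cls_def ultrapower.abs_eq_iff)

lemma cls_0: "cls (\<lambda>_. 0) = 0"
  and cls_1: "cls (\<lambda>_. 1) = 1"
  and cls_add: "cls (\<lambda>x. f x + g x) = cls f + cls g"
  and cls_diff: "cls (\<lambda>x. f x - g x) = cls f - cls g"
  and cls_mult: "cls (\<lambda>x. f x * g x) = cls f * cls g"
  and cls_inverse: "cls (\<lambda>x. inverse (f x)) = inverse (cls f)"
  by (simp_all add: cls_def zero_ultrapower.abs_eq one_ultrapower.abs_eq plus_ultrapower.abs_eq
      minus_ultrapower.abs_eq times_ultrapower.abs_eq inverse_ultrapower.abs_eq
      zero_ultrapower_def one_ultrapower_def)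

lemma cls_power: "cls (\<lambda>x. f x ^ n) = cls f ^ n"
  by (induction n) (simp_all add: cls_1 cls_mult)

lemma cls_sum: "cls (\<lambda>x. \<Sum>i\<in>A. f i x) = (\<Sum>i\<in>A. cls (f i))"
  by (induction A rule: infinite_finite_induct) (simp_all add: cls_0 cls_add)

lemma cls_prod: "cls (\<lambda>x. \<Prod>i\<in>A. f i x) = (\<Prod>i\<in>A. cls (f i))"
  by (induction A rule: infinite_finite_induct) (simp_all add: cls_1 cls_mult)

definition emb :: "Ct \<Rightarrow> ultrapower" where "emb c = cls (\<lambda>_. c)"

lemma hom_emb: "hom_fun emb"
  unfolding hom_fun_def emb_def by (simp add: cls_0 cls_1 cls_add cls_mult)

text \<open>The ultrapower of \<complex>; it contains the coefficients of the point to be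
  constructed.\<close>

definition constants :: "ultrapower set" where
  "constants = range (\<lambda>g. cls (\<lambda>x. to_fract [:g x:]))"

lemma constantsI: "cls (\<lambda>x. to_fract [:g x:]) \<in> constants"
  by (simp add: constants_def)

lemma to_fract_const: "to_fract [:a + b:] = to_fract [:a:] + to_fract [:b:]"
  "to_fract [:a - b:] = to_fract [:a:] - to_fract [:b:]"
  "to_fract [:a * b:] = to_fract [:a:] * to_fract [:b:]" for a b :: complex
  by (simp_all add: to_fract_add[symmetric] to_fract_diff[symmetric] to_fract_mult[symmetric]
      del: to_fract_add to_fract_diff to_fract_mult)

lemma to_fract_const_inverse: "to_fract [:inverse a:] = inverse (to_fract [:a:])" for a :: complex
proof (cases "a = 0")
  case False
  then have "to_fract [:a:] * to_fract [:inverse a:] = 1"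
    by (simp add: to_fract_const(3)[symmetric] one_pCons[symmetric])
  then show ?thesis by (metis inverse_unique)
qed simp

lemma field_set_constants: "field_set constants"
  unfolding field_set_def ring_set_def
proof (intro conjI ballI)
  show "1 \<in> constants" using constantsI[of "\<lambda>_. 1"] by (simp add: one_pCons[symmetric] cls_1)
next
  fix x y assume "x \<in> constants" "y \<in> constants"
  then obtain g h where "x = cls (\<lambda>x. to_fract [:g x:])" "y = cls (\<lambda>x. to_fract [:h x:])"
    by (auto simp: constants_def)
  then show "x - y \<in> constants" "x * y \<in> constants"
    using constantsI[of "\<lambda>x. g x - h x"] constantsI[of "\<lambda>x. g x * h x"]
    unfolding to_fract_const cls_diff cls_mult by simp_all
next
  fix x assume "x \<in> constants"
  then obtain g where "x = cls (\<lambda>x. to_fract [:g x:])" by (auto simp: constants_def)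
  then show "inverse x \<in> constants"
    using constantsI[of "\<lambda>x. inverse (g x)"] unfolding to_fract_const_inverse cls_inverse by simp
qed

lemma to_fract_power: "to_fract (p ^ n) = to_fract p ^ n"
  by (induction n) simp_all

lemma poly_constants:
  "poly (\<Sum>i\<le>n. monom (cls (\<lambda>x. to_fract [:g i x:])) i) (emb (to_fract [:0, 1:])) =
     cls (\<lambda>x. to_fract (\<Sum>i\<le>n. monom (g i x) i))"
proof -
  have "to_fract (monom c i) = to_fract [:c:] * to_fract [:0, 1:] ^ i" for c :: complex and i
    by (simp add: to_fract_power[symmetric] to_fract_mult[symmetric] monom_altdef del: to_fract_mult)
  then show ?thesis
    by (simp add: poly_sum poly_monom emb_def cls_power[symmetric] cls_mult[symmetric] cls_sum[symmetric])
qed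

text \<open>The degree of p is an ordinary number, so p(t) = 0 says that on a set of the ultrafilter
  an honest complex polynomial vanishes, and with it each of its coefficients.\<close>

lemma transcendental_emb:
  assumes "p \<in> polys_over constants" "poly p (emb (to_fract [:0, 1:])) = 0"
  shows "p = 0"
proof -
  have "\<forall>i. \<exists>g. coeff p i = cls (\<lambda>x. to_fract [:g x:])" using assms(1) by (auto simp: polys_over_def constants_def)
  then obtain g where g: "\<And>i. coeff p i = cls (\<lambda>x. to_fract [:g i x:])" by metis
  have p: "p = (\<Sum>i\<le>degree p. monom (cls (\<lambda>x. to_fract [:g i x:])) i)"
    unfolding g[symmetric] by (rule poly_as_sum_of_monoms[symmetric])
  have "cls (\<lambda>x. to_fract (\<Sum>i\<le>degree p. monom (g i x) i)) = cls (\<lambda>_. 0)"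
    using assms(2) poly_constants[of g "degree p"] p by (simp add: cls_0)
  then have ev: "eventually (\<lambda>x. (\<Sum>i\<le>degree p. monom (g i x) i) = 0) ultra"
    unfolding cls_eq_iff to_fract_eq_0_iff .
  have "coeff p i = 0" if "i \<le> degree p" for i
  proof -
    have "eventually (\<lambda>x. to_fract [:g i x:] = 0) ultra"
      using ev
    proof (rule eventually_mono)
      fix x assume "(\<Sum>i\<le>degree p. monom (g i x) i) = 0"
      then have "coeff (\<Sum>i\<le>degree p. monom (g i x) i) i = 0" by simp
      then show "to_fract [:g i x:] = 0" using that by (simp add: coeff_sum)
    qed
    then show ?thesis unfolding g cls_0[symmetric] cls_eq_iff .
  qed
  then show "p = 0" by (metis leading_coeff_0_iff order_refl)
qed

interpretation star: transcendental_extension emb constants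
proof
  show "emb (to_fract [:c:]) \<in> constants" for c using constantsI[of "\<lambda>_. c"] by (simp add: emb_def)
qed (use hom_emb field_set_constants transcendental_emb in auto)

section \<open>Affine charts of plane curves at infinity\<close>

text \<open>A crude bound on the total degree, large enough that the truncated subtraction in
  \<open>homogenise\<close> is a true difference.\<close>

definition chart_bound :: "'k::comm_ring_1 poly poly \<Rightarrow> nat" where
  "chart_bound q = degree q + (\<Sum>j\<le>degree q. degree (coeff q j))"

text \<open>The homogenisation of \<open>q(w/l, y/l)\<close> for the linear form \<open>l = x - c y\<close>.\<close>

definition homogenise :: "'k::comm_ring_1 \<Rightarrow> (nat, 'k) mpoly \<Rightarrow> 'k poly poly \<Rightarrow> (nat, 'k) mpoly" where
  "homogenise c w q = (\<Sum>j\<le>degree q. \<Sum>i\<le>degree (coeff q j). mconst (coeff (coeff q j) i) *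
     (mvar 0 - mconst c * mvar 1) ^ (chart_bound q - i - j) * mvar 1 ^ j * w ^ i)"

lemma chart_bound_ge: "j \<le> degree q \<Longrightarrow> i \<le> degree (coeff q j) \<Longrightarrow> i + j \<le> chart_bound q"
  using member_le_sum[of j "{..degree q}" "\<lambda>j. degree (coeff q j)"] by (auto simp: chart_bound_def)

text \<open>The parameter \<open>w\<close> stands for the homogenising variable:
  \<open>w = 1\<close> gives an equation in the affine plane, \<open>w = mvar 2\<close> a form on
  the projective plane.\<close>

lemma eval_homogenise_scaled:
  fixes e :: "'k::field \<Rightarrow> 'l::field"
  assumes h: "hom_fun e" and l: "l = x 0 - e c * x 1" "l \<noteq> 0"
  shows "eval_mpoly e x (homogenise c w q) =
    l ^ chart_bound q * evalp (evalp e (eval_mpoly e x w / l)) (x 1 / l) q"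
proof -
  note hm = hom_fun_eval_mpoly[OF h, of x]
  let ?w = "eval_mpoly e x w"
  have le: "eval_mpoly e x (mvar 0 - mconst c * mvar 1) = l"
    by (simp add: hom_fun_diff[OF hm] hom_fun_mult[OF hm] eval_mvar[OF h] eval_mconst[OF h] l(1))
  have scale: "e a * l ^ (chart_bound q - i - j) * x 1 ^ j * ?w ^ i =
      l ^ chart_bound q * (e a * (?w / l) ^ i * (x 1 / l) ^ j)"
    if "j \<le> degree q" "i \<le> degree (coeff q j)" for a i j
  proof -
    have "chart_bound q = (chart_bound q - i - j) + i + j" using chart_bound_ge[OF that] by simp
    then have "l ^ chart_bound q = l ^ (chart_bound q - i - j) * l ^ i * l ^ j"
      by (metis power_add)
    then show ?thesis using l(2) by (simp add: power_divide)
  qed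
  have "eval_mpoly e x (homogenise c w q) = (\<Sum>j\<le>degree q. \<Sum>i\<le>degree (coeff q j).
      e (coeff (coeff q j) i) * l ^ (chart_bound q - i - j) * x 1 ^ j * ?w ^ i)"
    by (simp only: homogenise_def hom_fun_sum[OF hm] hom_fun_mult[OF hm] hom_fun_power[OF hm] le
        eval_mvar[OF h] eval_mconst[OF h])
  also have "\<dots> = (\<Sum>j\<le>degree q. \<Sum>i\<le>degree (coeff q j).
      l ^ chart_bound q * (e (coeff (coeff q j) i) * (?w / l) ^ i * (x 1 / l) ^ j))"
    using scale by (intro sum.cong) auto
  also have "\<dots> = l ^ chart_bound q * evalp (evalp e (?w / l)) (x 1 / l) q"
    by (simp add: evalp_altdef[OF hom_fun_evalp[OF h] order_refl] evalp_altdef[OF h order_refl]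
        sum_distrib_left sum_distrib_right)
  finally show ?thesis .
qed

lemma homogenise_in:
  assumes "w \<in> mpolys_in I" "{0, 1} \<subseteq> I"
  shows "homogenise c w q \<in> mpolys_in I"
  unfolding homogenise_def using assms
  by (intro ring_set_intros[OF ring_set_mpolys_in] mconst_in mvar_in) auto

lemma degree_is_linear: "mvar 0 - mconst c * mvar 1 \<in> degree_is 1"
proof -
  have eq: "mvar 0 - mconst c * mvar 1 = mvar 0 + mconst (- c) * mvar 1"
    by (simp add: mconst_def single_uminus)
  have "mconst (- c) * mvar 1 \<in> degree_is (0 + 1)"
    by (intro degree_is_mult degree_is_mconst degree_is_mvar)
  then show ?thesis unfolding eq add_0 by (rule degree_is_add[OF degree_is_mvar])
qed

lemma homogenise_degree_is:
  assumes "w \<in> degree_is 1"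
  shows "homogenise c w q \<in> degree_is (chart_bound q)"
  unfolding homogenise_def
proof (intro degree_is_sum)
  fix j i assume "j \<in> {..degree q}" "i \<in> {..degree (coeff q j)}"
  then have "0 + (chart_bound q - i - j) * 1 + j * 1 + i * 1 = chart_bound q"
    using chart_bound_ge[of j q i] by simp
  moreover have "mconst (coeff (coeff q j) i) * (mvar 0 - mconst c * mvar 1) ^ (chart_bound q - i - j) *
      mvar 1 ^ j * w ^ i \<in> degree_is (0 + (chart_bound q - i - j) * 1 + j * 1 + i * 1)"
    by (intro degree_is_mult degree_is_mconst degree_is_power degree_is_linear degree_is_mvar assms)
  ultimately show "mconst (coeff (coeff q j) i) * (mvar 0 - mconst c * mvar 1) ^ (chart_bound q - i - j) *
      mvar 1 ^ j * w ^ i \<in> degree_is (chart_bound q)" by simp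
qed

section \<open>Equations after the substitution x = a + c y\<close>

lemma linear_power_coeff:
  "k \<ge> i + j \<Longrightarrow> coeff ([:a, c:] ^ i * [:0, 1:] ^ j) k = (if k = i + j then c ^ i else (0::'r::comm_ring_1))"
proof (induction i arbitrary: k)
  case 0
  then show ?case by (simp add: monom_altdef[of 1 j, simplified, symmetric])
next
  case (Suc i)
  then obtain k' where k: "k = Suc k'" "k' \<ge> i + j" by (cases k) auto
  have "[:a, c:] ^ Suc i * [:0, 1:] ^ j = [:a, c:] * ([:a, c:] ^ i * [:0, 1:] ^ j)"
    by (simp only: power_Suc mult.assoc)
  also have "\<dots> = smult a ([:a, c:] ^ i * [:0, 1:] ^ j) + pCons 0 (smult c ([:a, c:] ^ i * [:0, 1:] ^ j))"
    by (simp only: mult_pCons_left mult_zero_left pCons_0_0 add_0_right)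
  finally show ?case using Suc.IH[of k] Suc.IH[of k'] k by (simp add: k(1))
qed

lemma prod_two: "(\<Prod>i\<in>{..<2::nat}. g i) = g 0 * g 1"
  by (simp add: numeral_2_eq_2 lessThan_Suc mult.commute)

abbreviation lk :: "(nat \<Rightarrow>\<^sub>0 nat) \<Rightarrow> nat \<Rightarrow> nat" where "lk \<equiv> Poly_Mapping.lookup"

lemma eval_two_variables:
  assumes h: "hom_fun e" and f: "f \<in> mpolys_in {..<2}"
  shows "eval_mpoly e x f = (\<Sum>m\<in>Poly_Mapping.keys f. e (Poly_Mapping.lookup f m) * (x 0 ^ lk m 0 * x 1 ^ lk m 1))"
  unfolding eval_mpoly_superset[OF h finite_keys order_refl]
proof (intro sum.cong refl)
  fix m assume "m \<in> Poly_Mapping.keys f"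
  then have "Poly_Mapping.keys m \<subseteq> {..<2}" using f by (auto simp: mpolys_in_iff)
  then have "mon_eval x m = x 0 ^ lk m 0 * x 1 ^ lk m 1"
    using mon_eval_superset[of "{..<2::nat}" m x] prod_two by simp
  then show "e (Poly_Mapping.lookup f m) * mon_eval x m =
    e (Poly_Mapping.lookup f m) * (x 0 ^ lk m 0 * x 1 ^ lk m 1)" by simp
qed

definition total_degree :: "(nat, 'k::zero) mpoly \<Rightarrow> nat" where
  "total_degree f = Max ((\<lambda>m. lk m 0 + lk m 1) ` Poly_Mapping.keys f)"

lemma total_degree_ge: "m \<in> Poly_Mapping.keys f \<Longrightarrow> lk m 0 + lk m 1 \<le> total_degree f"
  unfolding total_degree_def by (intro Max_ge) auto

text \<open>The coefficient of \<open>y\<^sup>n\<close> in \<open>f(x + c y, y)\<close>, as a polynomial in \<open>c\<close>; here \<open>n\<close> is the total degree.\<close>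

definition top_form :: "(nat, 'k::comm_ring_1) mpoly \<Rightarrow> 'k poly" where
  "top_form f = (\<Sum>m\<in>{m \<in> Poly_Mapping.keys f. lk m 0 + lk m 1 = total_degree f}.
     monom (Poly_Mapping.lookup f m) (lk m 0))"

lemma top_form_nonzero:
  assumes f: "f \<in> mpolys_in {..<2}" "f \<noteq> 0"
  shows "top_form f \<noteq> 0"
proof -
  let ?K = "{m \<in> Poly_Mapping.keys f. lk m 0 + lk m 1 = total_degree f}"
  have "Poly_Mapping.keys f \<noteq> {}" using f(2) by simp
  then have "total_degree f \<in> (\<lambda>m. lk m 0 + lk m 1) ` Poly_Mapping.keys f"
    unfolding total_degree_def by (intro Max_in) auto
  then obtain m where m: "m \<in> ?K" by auto
  have inj: "m' = m" if "m' \<in> ?K" "lk m' 0 = lk m 0" for m'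
  proof (rule poly_mapping_eqI)
    fix i :: nat
    have "Poly_Mapping.keys m \<subseteq> {..<2}" "Poly_Mapping.keys m' \<subseteq> {..<2}"
      using f(1) m that by (auto simp: mpolys_in_iff)
    then have out: "lk m' i = lk m i" if "i \<ge> 2" using that by (metis in_keys_iff lessThan_iff not_le subsetD)
    have "lk m' 1 = lk m 1" using m that by auto
    then show "lk m' i = lk m i" using out that(2) by (metis One_nat_def less_2_cases not_le)
  qed
  have "coeff (top_form f) (lk m 0) = (\<Sum>m'\<in>?K. if m' = m then Poly_Mapping.lookup f m' else 0)"
    unfolding top_form_def coeff_sum coeff_monom using inj by (intro sum.cong) auto
  also have "\<dots> = Poly_Mapping.lookup f m" using m by (simp add: sum.delta)
  also have "\<dots> \<noteq> 0" using m by (simp add: in_keys_iff)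
  finally show ?thesis by auto
qed

text \<open>Only monomials of full total degree reach this coefficient. General \<open>a\<close> and
  \<alpha> cover two cases: a = x - c y in a valuation ring, and a = 1 in the chart at
  infinity.\<close>

lemma top_coefficient:
  fixes a c :: "'r::comm_ring_1" and \<alpha> :: "(nat \<Rightarrow>\<^sub>0 nat) \<Rightarrow> 'r" and f :: "(nat, 'k::comm_ring_1) mpoly"
  defines "p \<equiv> \<Sum>m\<in>Poly_Mapping.keys f. smult (\<alpha> m) ([:a, c:] ^ lk m 0 * [:0, 1:] ^ lk m 1)"
  shows "degree p \<le> total_degree f"
    and "coeff p (total_degree f) =
      (\<Sum>m\<in>{m \<in> Poly_Mapping.keys f. lk m 0 + lk m 1 = total_degree f}. \<alpha> m * c ^ lk m 0)"
proof -
  have cf: "coeff p k = (\<Sum>m\<in>Poly_Mapping.keys f. if lk m 0 + lk m 1 = k then \<alpha> m * c ^ lk m 0 else 0)"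
    if k: "k \<ge> total_degree f" for k
    unfolding p_def coeff_sum coeff_smult
  proof (intro sum.cong refl)
    fix m assume "m \<in> Poly_Mapping.keys f"
    then have "k \<ge> lk m 0 + lk m 1" using total_degree_ge k by (meson le_trans)
    then show "\<alpha> m * coeff ([:a, c:] ^ lk m 0 * [:0, 1:] ^ lk m 1) k =
        (if lk m 0 + lk m 1 = k then \<alpha> m * c ^ lk m 0 else 0)"
      by (subst linear_power_coeff) auto
  qed
  show "degree p \<le> total_degree f"
  proof (intro degree_le allI impI)
    fix k assume k: "total_degree f < k"
    have "lk m 0 + lk m 1 \<noteq> k" if "m \<in> Poly_Mapping.keys f" for m using total_degree_ge[OF that] k by simp
    then show "coeff p k = 0" using k by (subst cf) (auto intro!: sum.neutral)
  qed
  show "coeff p (total_degree f) =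
      (\<Sum>m\<in>{m \<in> Poly_Mapping.keys f. lk m 0 + lk m 1 = total_degree f}. \<alpha> m * c ^ lk m 0)"
    by (subst cf) (auto simp: sum.inter_filter)
qed

text \<open>Written in x - c y and y, the equation has the nonzero constant
  \<open>poly (top_form f) c\<close> as its coefficient of y^n, so y is integral over the constants
  and x - c y.\<close>

lemma second_coordinate_integral:
  fixes \<phi> :: "'k::field \<Rightarrow> 'm::field"
  assumes h: "hom_fun \<phi>" and f: "f \<in> mpolys_in {..<2}" and c: "poly (top_form f) c \<noteq> 0"
    and root: "eval_mpoly \<phi> x f = 0"
    and W: "valuation_ring W" "range \<phi> \<subseteq> W" "x 0 - \<phi> c * x 1 \<in> W"
  shows "x 1 \<in> W"
proof (rule ccontr)
  assume nin: "x 1 \<notin> W"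
  note RW = valuation_ring_ring[OF W(1)] and IW = ideal_max_ideal[OF W(1)]
  let ?a = "x 0 - \<phi> c * x 1"
  define p where "p = (\<Sum>m\<in>Poly_Mapping.keys f. smult (\<phi> (Poly_Mapping.lookup f m))
      ([:?a, \<phi> c:] ^ lk m 0 * [:0, 1:] ^ lk m 1))"
  have deg: "degree p \<le> total_degree f" unfolding p_def by (rule top_coefficient(1))
  have "coeff p (total_degree f) = \<phi> (poly (top_form f) c)"
    unfolding p_def top_coefficient(2)
    by (simp add: top_form_def poly_sum poly_monom hom_fun_sum[OF h] hom_fun_mult[OF h] hom_fun_power[OF h])
  moreover have "poly p (x 1) = 0"
    using root unfolding eval_two_variables[OF h f] p_def poly_sum
    by (simp add: mult.commute[of "x 1"])
  moreover have "p \<in> polys_over W"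
    unfolding p_def using W(2,3)
    by (intro ring_set_sum[OF ring_set_polys_over[OF RW]] polys_over_smult[OF RW]
        ring_set_mult[OF ring_set_polys_over[OF RW]] ring_set_power[OF ring_set_polys_over[OF RW]]
        polys_over_pCons polys_over_const[OF RW] ring_set_zero[OF RW] ring_set_one[OF RW]) auto
  ultimately have "- \<phi> (poly (top_form f) c) \<in> max_ideal W"
    using poly_at_pole[OF W(1) nin _ deg] by simp
  then have "\<phi> (poly (top_form f) c) \<in> max_ideal W"
    using ideal_set_uminus[OF RW IW] by fastforce
  moreover have "\<phi> (poly (top_form f) c) \<noteq> 0" using c hom_fun_eq_0_iff[OF h] by simp
  ultimately show False
    using field_set_unit[OF W(1) field_set_range_hom[OF h] W(2)] by blast
qed

text \<open>With l = x - c y, s = 1/l and z = y/l one has x/l = 1 + c z. Dividing f(x, y) by l^n,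
  for n the total degree, gives this polynomial in s (inner) and z (outer).\<close>

definition chart_poly :: "'k::comm_ring_1 \<Rightarrow> (nat, 'k) mpoly \<Rightarrow> 'k poly poly" where
  "chart_poly c f = (\<Sum>m\<in>Poly_Mapping.keys f.
     smult (monom (Poly_Mapping.lookup f m) (total_degree f - lk m 0 - lk m 1)) ([:1, [:c:]:] ^ lk m 0 * [:0, 1:] ^ lk m 1))"

lemma chart_poly_degree: "degree (chart_poly c f) \<le> total_degree f"
  unfolding chart_poly_def by (rule top_coefficient(1))

text \<open>No positive power of s survives in front of z^n, so the equation is monic in z up to a
  unit once c is not a root of the top form.\<close>

lemma chart_poly_coeff:
  fixes c :: "'k::comm_ring_1"
  shows "coeff (chart_poly c f) (total_degree f) = [:poly (top_form f) c:]"
proof -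
  have hc: "hom_fun (\<lambda>a::'k. [:a:])" by (auto simp: hom_fun_def one_pCons)
  have "monom (Poly_Mapping.lookup f m) (total_degree f - lk m 0 - lk m 1) * [:c:] ^ lk m 0 =
      [:poly (monom (Poly_Mapping.lookup f m) (lk m 0)) c:]" if "lk m 0 + lk m 1 = total_degree f" for m
    using that[symmetric] by (simp add: poly_const_pow poly_monom monom_0)
  then show ?thesis
    unfolding chart_poly_def top_coefficient(2) top_form_def poly_sum hom_fun_sum[OF hc]
    by (intro sum.cong) auto
qed

lemma eval_chart_poly:
  fixes e :: "'k::field \<Rightarrow> 'l::field"
  assumes h: "hom_fun e" and f: "f \<in> mpolys_in {..<2}" and l: "l = x 0 - e c * x 1" "l \<noteq> 0"
  shows "evalp (evalp e (1 / l)) (x 1 / l) (chart_poly c f) * l ^ total_degree f = eval_mpoly e x f"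
proof -
  let ?E = "evalp (evalp e (1 / l)) (x 1 / l)"
  note hs = hom_fun_evalp[OF h, of "1 / l"]
  note hE = hom_fun_evalp[OF hs, of "x 1 / l"]
  have E1: "?E [:1, [:c:]:] = x 0 / l"
    using l by (simp add: evalp_pCons[OF hs] evalp_0 hom_fun_1[OF hs] evalp_const[OF h] field_simps)
  have "?E (chart_poly c f) * l ^ total_degree f = (\<Sum>m\<in>Poly_Mapping.keys f.
      e (Poly_Mapping.lookup f m) * (1 / l) ^ (total_degree f - lk m 0 - lk m 1) *
      ((x 0 / l) ^ lk m 0 * (x 1 / l) ^ lk m 1) * l ^ total_degree f)"
    unfolding chart_poly_def hom_fun_sum[OF hE] sum_distrib_right
    by (simp only: evalp_smult[OF hs] evalp_monom[OF h] hom_fun_mult[OF hE] hom_fun_power[OF hE] E1 evalp_X[OF hs])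
  also have "\<dots> = (\<Sum>m\<in>Poly_Mapping.keys f. e (Poly_Mapping.lookup f m) * (x 0 ^ lk m 0 * x 1 ^ lk m 1))"
  proof (intro sum.cong refl)
    fix m assume "m \<in> Poly_Mapping.keys f"
    then have "total_degree f = (total_degree f - lk m 0 - lk m 1) + lk m 0 + lk m 1"
      using total_degree_ge[of m f] by simp
    then have "l ^ total_degree f = l ^ (total_degree f - lk m 0 - lk m 1) * l ^ lk m 0 * l ^ lk m 1"
      by (metis power_add)
    then show "e (Poly_Mapping.lookup f m) * (1 / l) ^ (total_degree f - lk m 0 - lk m 1) *
        ((x 0 / l) ^ lk m 0 * (x 1 / l) ^ lk m 1) * l ^ total_degree f =
        e (Poly_Mapping.lookup f m) * (x 0 ^ lk m 0 * x 1 ^ lk m 1)"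
      using l(2) by (simp add: power_divide)
  qed
  also have "\<dots> = eval_mpoly e x f" by (rule eval_two_variables[OF h f, symmetric])
  finally show ?thesis .
qed

lemma irreducible_factor_in_prime:
  fixes f :: "'k::{factorial_semiring, comm_ring_1}"
  assumes "f \<noteq> 0" "f \<in> J" and prime: "\<And>x y. x * y \<in> J \<Longrightarrow> x \<in> J \<or> y \<in> J" and unit: "\<And>x. is_unit x \<Longrightarrow> x \<notin> J"
  shows "\<exists>p. irreducible p \<and> p dvd f \<and> p \<in> J"
  using assms(1,2)
proof (induction f rule: prime_divisors_induct)
  case zero
  then show ?case by simp
next
  case (unit x)
  then show ?case using assms(4) by blast
next
  case (factor p x)
  then show ?case
    using prime[of p x] prime_elem_imp_irreducible[of p] by (auto dest: dvd_mult)
qed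

lemma eval_mpoly_compose:
  assumes "hom_fun \<psi>"
  shows "\<psi> (eval_mpoly e x f) = eval_mpoly (\<lambda>c. \<psi> (e c)) (\<lambda>i. \<psi> (x i)) f"
  by (simp add: eval_mpoly_def hom_funs[OF assms])

lemma eval_mpoly_in_ring_set:
  assumes "ring_set V" "range e \<subseteq> V" "f \<in> mpolys_in I" "\<And>i. i \<in> I \<Longrightarrow> x i \<in> V"
  shows "eval_mpoly e x f \<in> V"
  unfolding eval_mpoly_def
proof (intro ring_set_sum[OF assms(1)] ring_set_mult[OF assms(1)] ring_set_prod[OF assms(1)] ring_set_power[OF assms(1)])
  show "e (Poly_Mapping.lookup f m) \<in> V" for m using assms(2) by blast
  fix m i assume "m \<in> Poly_Mapping.keys f" "i \<in> Poly_Mapping.keys m"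
  then show "x i \<in> V" using assms(3,4) by (auto simp: mpolys_in_iff)
qed

lemma univariate_restriction:
  fixes e :: "'k::comm_ring_1 \<Rightarrow> 'l::comm_ring_1"
  shows "\<exists>h. \<forall>y. poly h y = eval_mpoly e (x(i := y)) g"
proof (intro exI allI)
  fix y
  have "(\<lambda>k. poly (if k = i then [:0, 1:] else [:x k:]) y) = x(i := y)" by auto
  then show "poly (eval_mpoly (\<lambda>c. [:e c:]) (\<lambda>k. if k = i then [:0, 1:] else [:x k:]) g) y =
      eval_mpoly e (x(i := y)) g"
    by (simp add: eval_mpoly_compose[OF hom_fun_poly_at])
qed

section \<open>A nonzero equation of the curve\<close>

abbreviation kc :: "complex \<Rightarrow> Ct" where "kc c \<equiv> to_fract [:c:]"

lemma hom_kc: "hom_fun kc"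
  unfolding hom_fun_def by (auto simp: to_fract_const one_pCons[symmetric] simp del: one_pCons)

lemma inj_kc: "inj kc"
  by (auto simp: inj_on_def)

lemma hom_to_ac: "hom_fun (to_ac :: Ct \<Rightarrow> Ct alg_closure)"
  by (simp add: hom_fun_def)

lemma inj_to_ac_kc: "inj (\<lambda>c. to_ac (kc c))"
  by (auto simp: inj_on_def)

lemma exists_constant_avoiding:
  fixes S :: "'a set"
  assumes "inj (g :: complex \<Rightarrow> 'a)" "finite S"
  shows "\<exists>c. g c \<notin> S"
proof (rule ccontr)
  assume "\<nexists>c. g c \<notin> S"
  then have "g ` UNIV \<subseteq> S" by auto
  then have "finite (g ` UNIV)" using assms(2) finite_subset by blast
  then have "finite (UNIV :: complex set)" using assms(1) finite_imageD by blast
  then show False using infinite_UNIV_char_0 by blast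
qed

lemma poly_avoiding:
  assumes "h \<noteq> (0 :: Ct alg_closure poly)"
  shows "\<exists>c. poly h (to_ac (kc c)) \<noteq> 0 \<and> to_ac (kc c) \<noteq> d"
  using exists_constant_avoiding[OF inj_to_ac_kc, of "insert d {x. poly h x = 0}"] poly_roots_finite[OF assms] by auto

text \<open>If no polynomial vanished on \<open>C\<close>, then \<open>C\<close> would be open, and a vertical line through a point of
  \<open>C\<close> with coordinates in \<open>\<complex>\<close> would give a chain of length two.\<close>

lemma curve_equation:
  fixes C :: "(nat \<Rightarrow> Ct alg_closure) set"
  assumes C: "irreducible_curve to_ac {..<2} C"
  shows "\<exists>F\<in>mpolys_in {..<2}. F \<noteq> 0 \<and> (\<forall>x\<in>C. eval_mpoly to_ac x F = 0)"
proof (rule ccontr)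
  assume no: "\<not> ?thesis"
  let ?T = "affine_zariski to_ac {..<2} :: (nat \<Rightarrow> Ct alg_closure) topology"
  let ?ev = "eval_mpoly to_ac :: (nat \<Rightarrow> Ct alg_closure) \<Rightarrow> _"
  note hev = hom_fun_eval_mpoly[OF hom_to_ac]
  have dim: "krull_dim (subtopology ?T C) = 1" and irr: "irreducible_top (subtopology ?T C)"
    using C by (simp_all add: irreducible_curve_def variety_dim_def)
  obtain A U where AU: "closedin ?T A" "openin ?T U" "C = A \<inter> U"
    using C by (auto simp: irreducible_curve_def quasi_affine_def)
  have U: "U \<subseteq> aspace {..<2}" using openin_subset[OF AU(2)] by (simp add: topspace_affine_zariski[OF hom_to_ac])
  then have CA: "C \<subseteq> aspace {..<2}" using AU(3) by blast
  \<comment> \<open>A point outside \<open>A\<close> would be separated from it by a polynomial that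
    vanishes on \<open>C\<close> and is not zero.\<close>
  have "aspace {..<2} \<subseteq> A"
  proof
    fix p :: "nat \<Rightarrow> Ct alg_closure" assume p: "p \<in> aspace {..<2}"
    show "p \<in> A"
    proof (rule ccontr)
      assume "p \<notin> A"
      have "closedin (subtopology ?T (aspace {..<2})) A"
        using AU(1) subtopology_topspace[of ?T] by (simp add: topspace_affine_zariski[OF hom_to_ac])
      then obtain f where f: "f \<in> mpolys_in {..<2}" "?ev p f \<noteq> 0" "\<And>x. x \<in> A \<Longrightarrow> ?ev x f = 0"
        by (rule closed_separation[OF hom_to_ac _ order_refl p \<open>p \<notin> A\<close>]) (rule that)
      then have "f = 0" using no AU(3) by blast
      then show False using f(2) by (simp add: eval_mpoly_0)
    qed
  qed
  then have CU: "C = U" using AU(3) U by blast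
  have "C \<noteq> {}" using irr irreducible_zariski_iff[OF hom_to_ac CA] by blast
  then obtain p where p: "p \<in> U" using CU by blast
  obtain g where g: "g \<in> mpolys_in {..<2}" "?ev p g \<noteq> 0" "{x \<in> aspace {..<2}. ?ev x g \<noteq> 0} \<subseteq> U"
    using open_contains_basic[OF hom_to_ac AU(2) p] by blast
  \<comment> \<open>The coordinates of p are moved one at a time into \<complex>, staying where g is
    nonzero. Constant coordinates make the point and the vertical line through it closed over
    \<complex>(t).\<close>
  obtain h1 where h1: "\<And>y. poly h1 y = ?ev (p(1 := y)) g" using univariate_restriction by metis
  have "poly h1 (p 1) \<noteq> 0" using h1[of "p 1"] g(2) by simp
  then have "h1 \<noteq> 0" by auto
  then obtain d where d: "?ev (p(1 := to_ac (kc d))) g \<noteq> 0" using poly_avoiding h1 by metis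
  define p1 where "p1 = p(1 := to_ac (kc d))"
  obtain h0 where h0: "\<And>y. poly h0 y = ?ev (p1(0 := y)) g" using univariate_restriction by metis
  have pp: "p1(0 := p1 0) = p1" by simp
  have "poly h0 (p1 0) \<noteq> 0" using h0[of "p1 0"] d unfolding pp by (simp add: p1_def)
  then have "h0 \<noteq> 0" by auto
  then obtain c where c: "?ev (p1(0 := to_ac (kc c))) g \<noteq> 0" using poly_avoiding h0 by metis
  define q where "q = p1(0 := to_ac (kc c))"
  have q01: "q 0 = to_ac (kc c)" "q 1 = to_ac (kc d)" "q (Suc 0) = to_ac (kc d)"
    by (simp_all add: q_def p1_def)
  have pA: "p \<in> aspace {..<2}" using p U by blast
  have upd: "r(i := y) \<in> aspace {..<2}" if "r \<in> aspace {..<2}" "i < 2" for r i and y :: "Ct alg_closure"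
    using that by (auto simp: PiE_iff extensional_def)
  have qA: "q \<in> aspace {..<2}" unfolding q_def p1_def by (intro upd pA) auto
  have line: "q(1 := y) \<in> C" if "?ev (q(1 := y)) g \<noteq> 0" for y
    using g(3) that upd[OF qA, of 1 y] CU by auto
  obtain hg where hg: "\<And>y. poly hg y = ?ev (q(1 := y)) g" using univariate_restriction by metis
  have qq: "q(1 := q 1) = q" by simp
  have "poly hg (q 1) \<noteq> 0" using hg[of "q 1"] c unfolding qq by (simp add: q_def)
  then have hg0: "hg \<noteq> 0" by auto
  have qC: "q \<in> C" using line[of "q 1"] c unfolding qq by (simp add: q_def)
  define X0 where "X0 = (mvar 0 - mconst (kc c) :: (nat, Ct) mpoly)"
  define Y0 where "Y0 = (mvar 1 - mconst (kc d) :: (nat, Ct) mpoly)"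
  have XY: "X0 \<in> mpolys_in {..<2}" "Y0 \<in> mpolys_in {..<2}"
    unfolding X0_def Y0_def by (intro ring_set_diff[OF ring_set_mpolys_in] mvar_in mconst_in; simp)+
  have evX: "?ev x X0 = x 0 - to_ac (kc c)" "?ev x Y0 = x 1 - to_ac (kc d)" for x
    by (simp_all add: X0_def Y0_def hom_fun_diff[OF hev] eval_mvar[OF hom_to_ac] eval_mconst[OF hom_to_ac])
  define Z1 where "Z1 = {x \<in> C. ?ev x X0 = 0}"
  define Z where "Z i = (if i = (0::nat) then {q} else if i = 1 then Z1 else C)" for i
  have cl: "closedin (subtopology ?T C) {x \<in> C. ?ev x f = 0}" if "f \<in> mpolys_in {..<2}" for f
    unfolding closedin_subtopology
    using closedin_zero_set[OF hom_to_ac that] CA by (intro exI[of _ "{x \<in> aspace {..<2}. ?ev x f = 0}"]) auto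
  have clZ1: "closedin (subtopology ?T C) Z1" unfolding Z1_def by (rule cl[OF XY(1)])
  have ext: "x = y" if "x \<in> C" "y \<in> C" "x 0 = y 0" "x 1 = y 1" for x y
  proof (rule PiE_ext)
    show "x \<in> aspace {..<2}" "y \<in> aspace {..<2}" using that CA by auto
    show "x i = y i" if "i \<in> {..<2}" for i using that \<open>x 0 = y 0\<close> \<open>x 1 = y 1\<close> by (auto simp: less_2_cases_iff)
  qed
  have "{q} = Z1 \<inter> {x \<in> C. ?ev x Y0 = 0}"
  proof (intro equalityI subsetI)
    fix x assume "x \<in> Z1 \<inter> {x \<in> C. ?ev x Y0 = 0}"
    then have "x \<in> C" "x 0 = q 0" "x 1 = q 1" unfolding Z1_def by (simp_all add: evX q01)
    then show "x \<in> {q}" using ext[OF _ qC] by simp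
  qed (use qC in \<open>simp add: Z1_def evX q01\<close>)
  then have clq: "closedin (subtopology ?T C) {q}" using closedin_Int[OF clZ1 cl[OF XY(2)]] by simp
  have sub: "subtopology (subtopology ?T C) S = subtopology ?T S" if "S \<subseteq> C" for S
    using that by (simp add: subtopology_subtopology Int_absorb1)
  have Z1C: "Z1 \<subseteq> C" by (auto simp: Z1_def)
  have irrZ1: "irreducible_top (subtopology ?T Z1)"
    unfolding irreducible_zariski_iff[OF hom_to_ac order_trans[OF Z1C CA]]
  proof (intro conjI ballI impI)
    show "Z1 \<noteq> {}" using qC by (auto simp: Z1_def evX q01)
    fix f f' assume "f \<in> mpolys_in {..<2}" "f' \<in> mpolys_in {..<2}" and ff: "\<forall>x\<in>Z1. ?ev x f * ?ev x f' = 0"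
    obtain hf where hf: "\<And>y. poly hf y = ?ev (q(1 := y)) f" using univariate_restriction by metis
    obtain hf' where hf': "\<And>y. poly hf' y = ?ev (q(1 := y)) f'" using univariate_restriction by metis
    \<comment> \<open>The factor hg takes care of the points of the line outside the basic open set,
      so that the product vanishes everywhere and one of the first two factors is zero.\<close>
    have roots: "poly (hf * hf' * hg) y = 0" for y
    proof (cases "?ev (q(1 := y)) g = 0")
      case False
      then have "q(1 := y) \<in> Z1" using line by (simp add: Z1_def evX q01)
      then show ?thesis using ff by (simp add: hf hf')
    qed (simp add: hg)
    have "hf * hf' * hg = 0" using poly_avoiding[of "hf * hf' * hg"] roots by blast
    then have z: "hf = 0 \<or> hf' = 0" using hg0 by simp
    have rep: "x = q(1 := x 1)" if "x \<in> Z1" for x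
    proof (rule PiE_ext)
      show "x \<in> aspace {..<2}" using that Z1C CA by auto
      show "q(1 := x 1) \<in> aspace {..<2}" by (rule upd[OF qA]) simp
      show "x i = (q(1 := x 1)) i" if "i \<in> {..<2}" for i
        using that \<open>x \<in> Z1\<close> by (auto simp: less_2_cases_iff Z1_def evX q01)
    qed
    have "?ev x f = poly hf (x 1)" "?ev x f' = poly hf' (x 1)" if "x \<in> Z1" for x
      unfolding hf hf' by (rule arg_cong[OF rep[OF that]])+
    then show "(\<forall>x\<in>Z1. ?ev x f = 0) \<or> (\<forall>x\<in>Z1. ?ev x f' = 0)" using z by auto
  qed
  have irrq: "irreducible_top (subtopology ?T {q})"
    using qA by (subst irreducible_zariski_iff[OF hom_to_ac]) auto
  obtain d' where d': "poly hg (to_ac (kc d')) \<noteq> 0" "to_ac (kc d') \<noteq> q 1" using poly_avoiding[OF hg0] by blast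
  have "q(1 := to_ac (kc d')) \<in> Z1" using line d' by (simp add: hg Z1_def evX q01)
  moreover have "q(1 := to_ac (kc d')) \<noteq> q" using d'(2) by (metis fun_upd_same)
  moreover have "q \<in> Z1" using qC by (simp add: Z1_def evX q01)
  ultimately have s0: "{q} \<subset> Z1" by blast
  have s1: "Z1 \<subset> C"
  proof
    show "Z1 \<subseteq> C" by (rule Z1C)
    show "Z1 \<noteq> C"
    proof
      assume "Z1 = C"
      then have "X0 = 0" using no XY(1) unfolding Z1_def by blast
      then have "?ev (\<lambda>_. to_ac (kc c) + 1) X0 = 0" by (simp add: eval_mpoly_0)
      then show False by (simp add: evX)
    qed
  qed
  have "krull_dim (subtopology ?T C) \<ge> ereal (real 2)"
  proof (rule krull_dim_ge[of _ _ Z])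
    fix i :: nat assume "i \<le> 2"
    have "topspace (subtopology ?T C) = C"
      using CA by (simp add: topspace_affine_zariski[OF hom_to_ac] Int_absorb1)
    then have clC: "closedin (subtopology ?T C) C" using closedin_topspace[of "subtopology ?T C"] by simp
    have iq: "irreducible_top (subtopology (subtopology ?T C) {q})" using irrq sub[of "{q}"] qC by simp
    have i1: "irreducible_top (subtopology (subtopology ?T C) Z1)" using irrZ1 sub[OF Z1C] by simp
    have i2: "irreducible_top (subtopology (subtopology ?T C) C)" using irr sub[OF order_refl] by simp
    have "Z i = {q} \<or> Z i = Z1 \<or> Z i = C" by (simp add: Z_def)
    then show "closedin (subtopology ?T C) (Z i) \<and> irreducible_top (subtopology (subtopology ?T C) (Z i))"
      using clq clZ1 clC iq i1 i2 by (elim disjE) (simp_all only: simp_thms)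
  next
    fix i :: nat assume "i < 2"
    then have "i = 0 \<or> i = 1" by auto
    then show "Z i \<subset> Z (Suc i)" using s0 s1 by (elim disjE) (simp_all only: Z_def, simp_all)
  qed
  then show False unfolding dim one_ereal_def ereal_less_eq by simp
qed

section \<open>Points at infinity in the projective plane\<close>

lemma proj_rel_class:
  assumes "v \<in> {..n} \<rightarrow>\<^sub>E UNIV" "\<exists>i\<le>n. v i \<noteq> 0"
  shows "proj_rel n `` {v} = {\<lambda>i\<in>{..n}. c * v i |c. c \<noteq> 0}"
  using assms by (auto simp: proj_rel_def)

lemma proj_rel_class_scale:
  assumes v: "v \<in> {..n} \<rightarrow>\<^sub>E (UNIV :: 'l::field set)" "\<exists>i\<le>n. v i \<noteq> 0" and d: "d \<noteq> 0"
  shows "proj_rel n `` {\<lambda>i\<in>{..n}. d * v i} = proj_rel n `` {v}"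
proof -
  have w: "(\<lambda>i\<in>{..n}. d * v i) \<in> {..n} \<rightarrow>\<^sub>E UNIV" "\<exists>i\<le>n. (\<lambda>i\<in>{..n}. d * v i) i \<noteq> 0"
    using v(2) d by auto
  have eq: "(\<lambda>i\<in>{..n}. c * (\<lambda>i\<in>{..n}. d * v i) i) = (\<lambda>i\<in>{..n}. (c * d) * v i)" for c
    by (auto simp: fun_eq_iff)
  show ?thesis
    unfolding proj_rel_class[OF v] proj_rel_class[OF w] eq
  proof (intro equalityI subsetI)
    fix x assume "x \<in> {\<lambda>i\<in>{..n}. c * d * v i |c. c \<noteq> 0}"
    then obtain c where "c \<noteq> 0" "x = (\<lambda>i\<in>{..n}. c * d * v i)" by blast
    then show "x \<in> {\<lambda>i\<in>{..n}. c * v i |c. c \<noteq> 0}"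
      using d by (intro CollectI exI[of _ "c * d"]) simp
  next
    fix x assume "x \<in> {\<lambda>i\<in>{..n}. c * v i |c. c \<noteq> 0}"
    then obtain c where "c \<noteq> 0" "x = (\<lambda>i\<in>{..n}. c * v i)" by blast
    then show "x \<in> {\<lambda>i\<in>{..n}. c * d * v i |c. c \<noteq> 0}"
      using d by (intro CollectI exI[of _ "c / d"]) simp
  qed
qed

lemma point_at_infinity_cases:
  assumes P: "P \<in> proj_space 2 - affine_to_proj 2 ` (aspace {..<2} :: (nat \<Rightarrow> 'l::field) set)"
  obtains v where "v \<in> {..2} \<rightarrow>\<^sub>E UNIV" "P = proj_rel 2 `` {v}" "v 2 = 0" "v 0 \<noteq> 0 \<or> v 1 \<noteq> 0"
proof -
  obtain v where v: "v \<in> {..2} \<rightarrow>\<^sub>E UNIV" "\<exists>i\<le>2. v i \<noteq> 0" "P = proj_rel 2 `` {v}"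
    using P by (auto simp: proj_space_def quotient_def)
  have "v 2 = 0"
  proof (rule ccontr)
    assume v2: "v 2 \<noteq> 0"
    define x where "x = (\<lambda>i\<in>{..<2::nat}. v i / v 2)"
    have "(\<lambda>i\<in>{..2}. if i < 2 then x i else 1) = (\<lambda>i\<in>{..2}. (1 / v 2) * v i)"
      using v2 by (auto simp: fun_eq_iff x_def)
    then have "affine_to_proj 2 x = P"
      unfolding affine_to_proj_def v(3) using proj_rel_class_scale[OF v(1,2), of "1 / v 2"] v2 by simp
    moreover have "x \<in> aspace {..<2}" by (simp add: x_def)
    ultimately show False using P by blast
  qed
  moreover have "v 0 \<noteq> 0 \<or> v 1 \<noteq> 0"
    using v(2) \<open>v 2 = 0\<close> by (metis One_nat_def Suc_1 le_Suc_eq le_zero_eq)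
  ultimately show thesis using that v(1,3) by blast
qed

text \<open>Homogeneity makes the nonvanishing of \<open>H\<close> well defined on classes, and this
  open condition would otherwise hold at a point of the curve too.\<close>

lemma homogeneous_vanishes_on_closure:
  fixes e :: "'k::field \<Rightarrow> 'l::field"
  assumes h: "hom_fun e" and H: "H \<in> mpolys_in {..n}" "H \<in> degree_is d"
    and van: "\<And>x. x \<in> C \<Longrightarrow> eval_mpoly e (\<lambda>i\<in>{..n}. if i < n then x i else 1) H = 0"
    and P: "proj_rel n `` {v} \<in> proj_zariski e n closure_of (affine_to_proj n ` C)"
    and v: "v \<in> {..n} \<rightarrow>\<^sub>E UNIV" "\<exists>i\<le>n. v i \<noteq> 0"
  shows "eval_mpoly e v H = 0"
proof (rule ccontr)
  assume nz: "eval_mpoly e v H \<noteq> 0"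
  let ?U = "{P \<in> proj_space n. \<forall>v\<in>P. eval_mpoly e v H \<noteq> 0}"
  have op: "openin (proj_zariski e n) ?U"
    unfolding proj_zariski_def using H degree_is_homogeneous
    by (intro topology_generated_by_Basis) (auto simp: mpolys_in_def)
  have mem: "proj_rel n `` {v} \<in> ?U"
  proof -
    have "eval_mpoly e (\<lambda>i\<in>{..n}. c * v i) H = c ^ d * eval_mpoly e v H" for c
      using eval_homogeneous_scale[OF h H(2), of c v] eval_mpoly_cong[OF H(1), of "\<lambda>i\<in>{..n}. c * v i" "\<lambda>i. c * v i" e]
      by simp
    then have "\<forall>w\<in>proj_rel n `` {v}. eval_mpoly e w H \<noteq> 0"
      unfolding proj_rel_class[OF v] using nz by auto
    moreover have "proj_rel n `` {v} \<in> proj_space n"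
      unfolding proj_space_def using v by (intro quotientI) auto
    ultimately show ?thesis by blast
  qed
  have cl: "\<forall>T. proj_rel n `` {v} \<in> T \<and> openin (proj_zariski e n) T \<longrightarrow> (\<exists>y. y \<in> affine_to_proj n ` C \<and> y \<in> T)"
    using P unfolding in_closure_of by (rule conjunct2)
  have "\<exists>y. y \<in> affine_to_proj n ` C \<and> y \<in> ?U"
    by (rule cl[rule_format, OF conjI[OF mem op]])
  then obtain x Q where x: "x \<in> C" "Q = affine_to_proj n x" and Q: "Q \<in> ?U" by blast
  let ?w = "\<lambda>i\<in>{..n}. if i < n then x i else 1"
  have w: "?w \<in> {..n} \<rightarrow>\<^sub>E UNIV" "\<exists>i\<le>n. ?w i \<noteq> 0" by (auto intro: exI[of _ n])
  have "?w = (\<lambda>i\<in>{..n}. 1 * ?w i)" by (rule ext) simp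
  then have "?w \<in> Q"
    unfolding x(2) affine_to_proj_def proj_rel_class[OF w] by (intro CollectI exI[of _ 1] conjI one_neq_zero)
  then show False using Q van[OF x(1)] by blast
qed

lemma evalp_special_fibre:
  assumes "hom_fun e"
  shows "evalp (evalp e 0) z q = evalp e z (map_poly (\<lambda>c. poly c 0) q)"
proof -
  have "evalp e 0 c = e (poly c 0)" for c
    by (cases c) (simp add: evalp_pCons[OF assms])
  then have "map_poly (evalp e 0) q = map_poly e (map_poly (\<lambda>c. poly c 0) q)"
    by (intro poly_eqI) (simp add: coeff_map_poly hom_fun_0[OF assms])
  then show ?thesis by (simp add: evalp_def[of "evalp e 0"] evalp_def[of e])
qed

text \<open>The ideal of the curve in the coordinates s = 1/(x - c y) (inner) and z = y/(x - c y)
  (outer). It contains everything if the curve lies on the line x = c y.\<close>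

definition chart_ideal :: "(nat \<Rightarrow> Ct alg_closure) set \<Rightarrow> Ct \<Rightarrow> Ct poly poly set" where
  "chart_ideal C c = {q. \<forall>x\<in>C. x 0 - to_ac c * x 1 \<noteq> 0 \<longrightarrow>
     evalp (evalp to_ac (1 / (x 0 - to_ac c * x 1))) (x 1 / (x 0 - to_ac c * x 1)) q = 0}"

text \<open>The extra factor x - c y makes the equation valid also on the line x = c y, which the
  chart omits.\<close>

lemma chart_ideal_equation:
  assumes q: "q \<in> chart_ideal C c" and x: "x \<in> C"
  shows "eval_mpoly to_ac x ((mvar 0 - mconst c * mvar 1) * homogenise c 1 q) = 0"
proof -
  note hm = hom_fun_eval_mpoly[OF hom_to_ac, of x]
  define l where "l = x 0 - to_ac c * x 1"
  have L: "eval_mpoly to_ac x (mvar 0 - mconst c * mvar 1) = l"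
    by (simp add: l_def hom_fun_diff[OF hm] hom_fun_mult[OF hm] eval_mvar[OF hom_to_ac] eval_mconst[OF hom_to_ac])
  show ?thesis
  proof (cases "l = 0")
    case False
    have "eval_mpoly to_ac x (homogenise c 1 q) = 0"
      unfolding eval_homogenise_scaled[where l = l, OF hom_to_ac l_def False] hom_fun_1[OF hm]
      using q x False by (simp add: chart_ideal_def l_def)
    then show ?thesis by (simp add: hom_fun_mult[OF hm])
  qed (simp only: hom_fun_mult[OF hm] L mult_zero_left)
qed

text \<open>Membership of r amounts to vanishing of x - c y times the homogenisation of r on all of
  \<open>C\<close>, which transports primality from the vanishing ideal.\<close>

lemma chart_ideal_prime:
  assumes C: "irreducible_top (subtopology (affine_zariski to_ac {..<2}) C)" "C \<subseteq> aspace {..<2}"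
    and pq: "p * q \<in> chart_ideal C c"
  shows "p \<in> chart_ideal C c \<or> q \<in> chart_ideal C c"
proof -
  let ?ev = "eval_mpoly to_ac :: (nat \<Rightarrow> Ct alg_closure) \<Rightarrow> _"
  note hev = hom_fun_eval_mpoly[OF hom_to_ac]
  define l where "l x = x 0 - to_ac c * x 1" for x :: "nat \<Rightarrow> Ct alg_closure"
  define L where "L = (mvar 0 - mconst c * mvar 1 :: (nat, Ct) mpoly)"
  have evL: "?ev x L = l x" for x
    by (simp add: L_def l_def hom_fun_diff[OF hev] hom_fun_mult[OF hev] eval_mvar[OF hom_to_ac] eval_mconst[OF hom_to_ac])
  have Lin: "L \<in> mpolys_in {..<2}"
    unfolding L_def by (intro ring_set_diff[OF ring_set_mpolys_in] ring_set_mult[OF ring_set_mpolys_in] mvar_in mconst_in) auto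
  have hin: "homogenise c 1 r \<in> mpolys_in {..<2}" for r
    by (rule homogenise_in[OF ring_set_one[OF ring_set_mpolys_in]]) auto
  have ev: "?ev x (homogenise c 1 r) = l x ^ chart_bound r * evalp (evalp to_ac (1 / l x)) (x 1 / l x) r"
    if "l x \<noteq> 0" for x r
    using eval_homogenise_scaled[where l = "l x", OF hom_to_ac l_def that, of 1 r]
    unfolding hom_fun_1[OF hev] .
  have iff: "r \<in> chart_ideal C c \<longleftrightarrow> (\<forall>x\<in>C. ?ev x (L * homogenise c 1 r) = 0)" for r
  proof
    show "\<forall>x\<in>C. ?ev x (L * homogenise c 1 r) = 0" if "r \<in> chart_ideal C c"
      unfolding L_def using chart_ideal_equation[OF that] by blast
    assume *: "\<forall>x\<in>C. ?ev x (L * homogenise c 1 r) = 0"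
    have "evalp (evalp to_ac (1 / l x)) (x 1 / l x) r = 0" if "x \<in> C" "l x \<noteq> 0" for x
      using bspec[OF * that(1)] that(2) by (simp add: hom_fun_mult[OF hev] evL ev)
    then show "r \<in> chart_ideal C c" unfolding chart_ideal_def l_def by blast
  qed
  have "\<forall>x\<in>C. ?ev x (L * homogenise c 1 p) * ?ev x (L * homogenise c 1 q) = 0"
  proof
    fix x assume x: "x \<in> C"
    show "?ev x (L * homogenise c 1 p) * ?ev x (L * homogenise c 1 q) = 0"
    proof (cases "l x = 0")
      case True
      then show ?thesis by (simp add: hom_fun_mult[OF hev] evL)
    next
      case False
      have "evalp (evalp to_ac (1 / l x)) (x 1 / l x) (p * q) = 0"
        using pq x False by (simp add: chart_ideal_def l_def)
      then show ?thesis
        using False by (auto simp: hom_fun_mult[OF hev] evL ev hom_fun_mult[OF hom_fun_evalp[OF hom_fun_evalp[OF hom_to_ac]]])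
    qed
  qed
  moreover have "L * homogenise c 1 r \<in> mpolys_in {..<2}" for r
    by (intro ring_set_mult[OF ring_set_mpolys_in] Lin hin)
  ultimately have "(\<forall>x\<in>C. ?ev x (L * homogenise c 1 p) = 0) \<or> (\<forall>x\<in>C. ?ev x (L * homogenise c 1 q) = 0)"
    using C(1) unfolding irreducible_zariski_iff[OF hom_to_ac C(2)] by blast
  then show ?thesis by (simp only: iff)
qed

text \<open>The homogenised equation vanishes on the affine curve, hence on its projective closure;
  at a point with third coordinate 0 it says that s = 0.\<close>

lemma chart_ideal_at_infinity:
  assumes q: "q \<in> chart_ideal C c"
    and P: "proj_rel 2 `` {v} \<in> proj_zariski to_ac 2 closure_of (affine_to_proj 2 ` C)"
    and v: "v \<in> {..2} \<rightarrow>\<^sub>E UNIV" "v 2 = 0" and l: "l = v 0 - to_ac c * v 1" "l \<noteq> 0"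
  shows "evalp to_ac (v 1 / l) (map_poly (\<lambda>c. poly c 0) q) = 0"
proof -
  note hev = hom_fun_eval_mpoly[OF hom_to_ac]
  define L where "L = (mvar 0 - mconst c * mvar 1 :: (nat, Ct) mpoly)"
  define H where "H = L * homogenise c (mvar 2) q"
  have evL: "eval_mpoly to_ac x L = x 0 - to_ac c * x 1" for x :: "nat \<Rightarrow> Ct alg_closure"
    by (simp add: L_def hom_fun_diff[OF hev] hom_fun_mult[OF hev] eval_mvar[OF hom_to_ac] eval_mconst[OF hom_to_ac])
  have Lin: "L \<in> mpolys_in {..2}"
    unfolding L_def by (intro ring_set_diff[OF ring_set_mpolys_in] ring_set_mult[OF ring_set_mpolys_in] mvar_in mconst_in) auto
  have Hin: "H \<in> mpolys_in {..2}"
    unfolding H_def by (intro ring_set_mult[OF ring_set_mpolys_in] Lin homogenise_in mvar_in) auto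
  have Hdeg: "H \<in> degree_is (1 + chart_bound q)"
    unfolding H_def L_def by (intro degree_is_mult degree_is_linear homogenise_degree_is degree_is_mvar)
  have "eval_mpoly to_ac (\<lambda>i\<in>{..2}. if i < 2 then x i else 1) H = 0" if x: "x \<in> C" for x
  proof -
    let ?w = "\<lambda>i\<in>{..2::nat}. if i < 2 then x i else 1"
    define l' where "l' = ?w 0 - to_ac c * ?w 1"
    have l'x: "l' = x 0 - to_ac c * x 1" by (simp add: l'_def)
    show ?thesis
    proof (cases "l' = 0")
      case True
      then show ?thesis by (simp add: H_def hom_fun_mult[OF hev] evL l'_def[symmetric] l'x)
    next
      case False
      have "eval_mpoly to_ac ?w (mvar 2) = 1" by (simp add: eval_mvar[OF hom_to_ac])
      then have "eval_mpoly to_ac ?w (homogenise c (mvar 2) q) =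
          l' ^ chart_bound q * evalp (evalp to_ac (1 / l')) (?w 1 / l') q"
        using eval_homogenise_scaled[where l = l' and w = "mvar 2" and q = q, OF hom_to_ac l'_def False] by (simp only:)
      also have "evalp (evalp to_ac (1 / l')) (?w 1 / l') q = 0"
        using q x False by (simp add: chart_ideal_def l'x)
      finally show ?thesis unfolding H_def hom_fun_mult[OF hev] by (simp only: mult_zero_right)
    qed
  qed
  moreover have "\<exists>i\<le>2. v i \<noteq> 0"
    using l by (metis diff_self mult_zero_right one_le_numeral zero_le_numeral diff_zero)
  ultimately have "eval_mpoly to_ac v H = 0"
    using homogeneous_vanishes_on_closure[OF hom_to_ac Hin Hdeg _ P v(1)] by blast
  moreover have "eval_mpoly to_ac v L = l" by (simp add: evL l(1))
  moreover have "eval_mpoly to_ac v (homogenise c (mvar 2) q) =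
      l ^ chart_bound q * evalp (evalp to_ac 0) (v 1 / l) q"
    using eval_homogenise_scaled[OF hom_to_ac l, of "mvar 2" q] v(2) by (simp add: eval_mvar[OF hom_to_ac])
  ultimately have "evalp (evalp to_ac 0) (v 1 / l) q = 0" using l(2) by (simp add: H_def hom_fun_mult[OF hev])
  then show ?thesis by (simp add: evalp_special_fibre[OF hom_to_ac])
qed

lemma curve_chart:
  fixes C :: "(nat \<Rightarrow> Ct alg_closure) set"
  assumes C: "irreducible_curve to_ac {..<2} C"
    and P: "P \<in> points_at_infinity to_ac 2 C" and Q: "Q \<in> points_at_infinity to_ac 2 C" and PQ: "P \<noteq> Q"
  obtains c f a b F where "F \<in> mpolys_in {..<2}" "\<And>x. x \<in> C \<Longrightarrow> eval_mpoly to_ac x F = 0"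
    "poly (top_form F) (kc c) \<noteq> 0" "irreducible f" "lead_coeff f = 1" "f \<in> chart_ideal C (kc c)"
    "evalp to_ac a (map_poly (\<lambda>c. poly c 0) f) = 0" "evalp to_ac b (map_poly (\<lambda>c. poly c 0) f) = 0" "a \<noteq> b"
proof -
  obtain F where F: "F \<in> mpolys_in {..<2}" "F \<noteq> 0" "\<And>x. x \<in> C \<Longrightarrow> eval_mpoly to_ac x F = 0"
    using curve_equation[OF C] by blast
  have irr: "irreducible_top (subtopology (affine_zariski to_ac {..<2}) C)"
    using C by (simp add: irreducible_curve_def)
  have CA: "C \<subseteq> aspace {..<2}"
  proof -
    obtain A U where AU: "openin (affine_zariski to_ac {..<2}) U" "C = A \<inter> U"
      using C by (auto simp: irreducible_curve_def quasi_affine_def)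
    then show ?thesis using openin_subset[OF AU(1)] by (auto simp: topspace_affine_zariski[OF hom_to_ac])
  qed
  obtain v where v: "v \<in> {..2} \<rightarrow>\<^sub>E UNIV" "P = proj_rel 2 `` {v}" "v 2 = 0" "v 0 \<noteq> 0 \<or> v 1 \<noteq> 0"
    using P point_at_infinity_cases unfolding points_at_infinity_def by blast
  obtain w where w: "w \<in> {..2} \<rightarrow>\<^sub>E UNIV" "Q = proj_rel 2 `` {w}" "w 2 = 0" "w 0 \<noteq> 0 \<or> w 1 \<noteq> 0"
    using Q point_at_infinity_cases unfolding points_at_infinity_def by blast
  have fin: "finite {c. poly (top_form F) (kc c) = 0}"
    using finite_vimageI[OF poly_roots_finite[OF top_form_nonzero[OF F(1,2)]] inj_kc] by (simp add: vimage_def)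
  have slope: "finite {c. u 0 = to_ac (kc c) * u 1}" if "u 0 \<noteq> 0 \<or> u 1 \<noteq> 0" for u :: "nat \<Rightarrow> Ct alg_closure"
  proof -
    have "{c. u 0 = to_ac (kc c) * u 1} \<subseteq> (\<lambda>c. to_ac (kc c)) -` {u 0 / u 1}" using that by auto
    then show ?thesis using finite_vimageI[OF _ inj_to_ac_kc, of "{u 0 / u 1}"] finite_subset by blast
  qed
  \<comment> \<open>Three finite sets are avoided: the roots of the top form, and the slopes for
    which the line x = c y passes through P or Q.\<close>
  obtain c where c: "poly (top_form F) (kc c) \<noteq> 0" "v 0 \<noteq> to_ac (kc c) * v 1" "w 0 \<noteq> to_ac (kc c) * w 1"
    using exists_constant_avoiding[of "\<lambda>c. c" "{c. poly (top_form F) (kc c) = 0} \<union>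
      {c. v 0 = to_ac (kc c) * v 1} \<union> {c. w 0 = to_ac (kc c) * w 1}"] fin slope[OF v(4)] slope[OF w(4)] by auto
  define lv where "lv = v 0 - to_ac (kc c) * v 1"
  define lw where "lw = w 0 - to_ac (kc c) * w 1"
  have l: "lv \<noteq> 0" "lw \<noteq> 0" using c by (simp_all add: lv_def lw_def)
  have infP: "evalp to_ac (v 1 / lv) (map_poly (\<lambda>c. poly c 0) q) = 0"
    and infQ: "evalp to_ac (w 1 / lw) (map_poly (\<lambda>c. poly c 0) q) = 0" if "q \<in> chart_ideal C (kc c)" for q
    using chart_ideal_at_infinity[OF that _ v(1,3) lv_def l(1)] chart_ideal_at_infinity[OF that _ w(1,3) lw_def l(2)]
      P Q v(2) w(2) by (auto simp: points_at_infinity_def)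
  \<comment> \<open>The coordinate z determines a point at infinity, because v 0 is recovered as l +
    c v 1.\<close>
  have vw: "v 1 / lv \<noteq> w 1 / lw"
  proof
    assume eq: "v 1 / lv = w 1 / lw"
    define d where "d = lw / lv"
    have d: "d \<noteq> 0" using l by (simp add: d_def)
    have dl: "lw = d * lv" using l by (simp add: d_def)
    have "w 1 = w 1 / lw * lw" using l by simp
    then have w1: "w 1 = d * v 1" unfolding eq[symmetric] by (simp add: d_def)
    have "w 0 = lw + to_ac (kc c) * w 1" by (simp add: lw_def)
    also have "\<dots> = d * (lv + to_ac (kc c) * v 1)" unfolding w1 dl by (simp add: algebra_simps)
    finally have w0: "w 0 = d * v 0" by (simp add: lv_def)
    have "w = (\<lambda>i\<in>{..2}. d * v i)"
    proof
      fix i :: nat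
      show "w i = (\<lambda>i\<in>{..2}. d * v i) i"
      proof (cases "i \<le> 2")
        case True
        then consider "i = 0" | "i = 1" | "i = 2" by linarith
        then show ?thesis using w0 w1 v(3) w(3) by cases auto
      next
        case False
        then show ?thesis using w(1) by (auto simp: PiE_iff extensional_def)
      qed
    qed
    moreover have "\<exists>i\<le>2. v i \<noteq> 0" using v(4) by (metis one_le_numeral zero_le_numeral)
    ultimately have "Q = P" unfolding v(2) w(2) using proj_rel_class_scale[OF v(1) _ d] by simp
    then show False using PQ by simp
  qed
  let ?f = "chart_poly (kc c) F"
  have cf: "coeff ?f (total_degree F) = [:poly (top_form F) (kc c):]" by (rule chart_poly_coeff)
  have f0: "?f \<noteq> 0" using cf c(1) by auto
  have deg: "degree ?f = total_degree F"
    using cf c(1) by (intro antisym chart_poly_degree le_degree) auto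
  have "?f \<in> chart_ideal C (kc c)"
    unfolding chart_ideal_def
  proof (intro CollectI ballI impI)
    fix x assume x: "x \<in> C" "x 0 - to_ac (kc c) * x 1 \<noteq> 0"
    show "evalp (evalp to_ac (1 / (x 0 - to_ac (kc c) * x 1))) (x 1 / (x 0 - to_ac (kc c) * x 1)) ?f = 0"
      using eval_chart_poly[OF hom_to_ac F(1) refl x(2)] F(3)[OF x(1)] x(2) by simp
  qed
  \<comment> \<open>Members of the ideal vanish at the point P at infinity, where a unit cannot
    vanish. In particular the curve is not contained in the line x = c y.\<close>
  moreover have "q \<notin> chart_ideal C (kc c)" if unit: "is_unit q" for q
  proof
    assume q: "q \<in> chart_ideal C (kc c)"
    obtain r where "1 = q * r" using unit by (rule dvdE)
    define \<sigma> where "\<sigma> = map_poly (\<lambda>c::Ct poly. poly c 0)"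
    have h\<sigma>: "hom_fun \<sigma>" unfolding \<sigma>_def by (intro hom_fun_map_poly hom_fun_poly_at)
    note hE = hom_fun_comp[OF hom_fun_evalp[OF hom_to_ac, of "v 1 / lv"] h\<sigma>]
    have "evalp to_ac (v 1 / lv) (\<sigma> (q * r)) = 1"
      unfolding \<open>1 = q * r\<close>[symmetric] by (rule hom_fun_1[OF hE])
    then have "evalp to_ac (v 1 / lv) (\<sigma> q) * evalp to_ac (v 1 / lv) (\<sigma> r) = 1" unfolding hom_fun_mult[OF hE] .
    then show False using infP[OF q] unfolding \<sigma>_def by (metis mult_zero_left zero_neq_one)
  qed
  ultimately obtain p where p: "irreducible p" "p dvd ?f" "p \<in> chart_ideal C (kc c)"
    using irreducible_factor_in_prime[OF f0, of "chart_ideal C (kc c)"] chart_ideal_prime[OF irr CA] by blast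
  obtain p' where p': "?f = p * p'" using p(2) by (rule dvdE)
  \<comment> \<open>The leading coefficient of the factor divides a nonzero constant, so it can be
    scaled to 1.\<close>
  have "lead_coeff p * lead_coeff p' = [:poly (top_form F) (kc c):]"
    using cf deg unfolding p' lead_coeff_mult[symmetric] by simp
  then have "lead_coeff p dvd [:poly (top_form F) (kc c):]" by (metis dvd_triv_left)
  moreover have "is_unit [:poly (top_form F) (kc c):]" using c(1) by (simp add: is_unit_const_poly_iff dvd_field_iff)
  ultimately have "is_unit (lead_coeff p)" using dvd_trans by blast
  then obtain u where u: "1 = lead_coeff p * u" by (rule dvdE)
  have uu: "is_unit u" using u by (metis dvd_triv_right)
  define f where "f = [:u:] * p"
  have unit: "is_unit [:u:]" using uu by (simp add: is_unit_const_poly_iff)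
  have "irreducible f" unfolding f_def using p(1) irreducible_mult_unit_left[OF unit] by blast
  moreover have "lead_coeff f = 1" unfolding f_def lead_coeff_mult using u by (simp add: mult.commute)
  moreover have "f \<in> chart_ideal C (kc c)"
    using p(3) unfolding chart_ideal_def f_def
    by (simp add: hom_fun_mult[OF hom_fun_evalp[OF hom_fun_evalp[OF hom_to_ac]]] del: mult_pCons_left)
  ultimately show thesis using that[OF F(1,3) c(1) _ _ _ infP infQ vw] by blast
qed

section \<open>From chains to algebraically independent functions\<close>

lemma hom_mconst: "hom_fun (mconst :: 'k::comm_ring_1 \<Rightarrow> ('i, 'k) mpoly)"
  by (simp add: hom_fun_def mconst_def single_add mult_single)

lemma evalp_at_0: "hom_fun \<phi> \<Longrightarrow> evalp \<phi> 0 p = \<phi> (coeff p 0)"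
  by (cases p) (simp add: evalp_pCons)

lemma polynomial_split_X:
  fixes p :: "'a::idom poly"
  assumes "p \<noteq> 0"
  obtains k q where "p = [:0, 1:] ^ k * q" "coeff q 0 \<noteq> 0"
proof -
  obtain q where q: "p = [:- 0, 1:] ^ order 0 p * q" "\<not> [:- 0, 1:] dvd q" using order_decomp[OF assms] by blast
  have "poly q 0 \<noteq> 0" using q(2) poly_eq_0_iff_dvd by blast
  then show thesis using that[of "order 0 p" q] q(1) by (simp add: poly_0_coeff_0)
qed

text \<open>The function f1 vanishes on \<open>Z1\<close> but not on \<open>Z2\<close>, and f2
  vanishes on \<open>Z0\<close> but not on \<open>Z1\<close>. In a relation P(f2, f1) = 0 on
  \<open>Z2\<close>, powers of f1 cancel by primality, restriction to \<open>Z1\<close> leaves a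
  nontrivial relation for f2 alone, powers of f2 cancel, and restriction to \<open>Z0\<close> kills
  a nonzero constant term.\<close>

lemma chain_independent:
  fixes Z0 Z1 Z2 :: "('i \<Rightarrow> complex) set"
  defines "id_ev \<equiv> eval_mpoly (\<lambda>c::complex. c)"
  assumes I: "f1 \<in> mpolys_in I" "f2 \<in> mpolys_in I"
    and prime: "\<And>f g. f \<in> mpolys_in I \<Longrightarrow> g \<in> mpolys_in I \<Longrightarrow> \<forall>x\<in>Z2. id_ev x f * id_ev x g = 0 \<Longrightarrow>
        (\<forall>x\<in>Z2. id_ev x f = 0) \<or> (\<forall>x\<in>Z2. id_ev x g = 0)"
      "\<And>f g. f \<in> mpolys_in I \<Longrightarrow> g \<in> mpolys_in I \<Longrightarrow> \<forall>x\<in>Z1. id_ev x f * id_ev x g = 0 \<Longrightarrow>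
        (\<forall>x\<in>Z1. id_ev x f = 0) \<or> (\<forall>x\<in>Z1. id_ev x g = 0)"
    and sub: "Z0 \<noteq> {}" "Z0 \<subseteq> Z1" "Z1 \<subseteq> Z2"
    and f1: "\<not> (\<forall>x\<in>Z2. id_ev x f1 = 0)" "\<And>x. x \<in> Z1 \<Longrightarrow> id_ev x f1 = 0"
    and f2: "\<not> (\<forall>x\<in>Z1. id_ev x f2 = 0)" "\<And>x. x \<in> Z0 \<Longrightarrow> id_ev x f2 = 0"
    and P: "P \<noteq> 0"
  shows "\<exists>x\<in>Z2. evalp (evalp (\<lambda>c. c) (id_ev x f2)) (id_ev x f1) P \<noteq> 0"
proof (rule ccontr)
  assume "\<not> ?thesis"
  then have van: "\<And>x. x \<in> Z2 \<Longrightarrow> evalp (evalp (\<lambda>c. c) (id_ev x f2)) (id_ev x f1) P = 0" by blast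
  have hev: "hom_fun (id_ev x)" for x unfolding id_ev_def by (rule hom_fun_eval_mpoly[OF hom_fun_id])
  define m2 where "m2 = evalp (mconst :: complex \<Rightarrow> ('i, complex) mpoly) f2"
  have hm2: "hom_fun m2" unfolding m2_def by (rule hom_fun_evalp[OF hom_mconst])
  have ev2: "id_ev x (m2 r) = evalp (\<lambda>c. c) (id_ev x f2) r" for x r
    unfolding m2_def evalp_compose[OF hom_mconst hev] unfolding id_ev_def eval_mconst[OF hom_fun_id] ..
  have ev1: "id_ev x (evalp m2 f1 r) = evalp (evalp (\<lambda>c. c) (id_ev x f2)) (id_ev x f1) r" for x r
    unfolding evalp_compose[OF hm2 hev] ev2 ..
  have in2: "m2 r \<in> mpolys_in I" for r
    unfolding m2_def using I(2) mconst_in by (intro evalp_in_ring_set[OF hom_mconst ring_set_mpolys_in]) auto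
  have in1: "evalp m2 f1 r \<in> mpolys_in I" for r
    using I(1) in2 by (intro evalp_in_ring_set[OF hm2 ring_set_mpolys_in]) auto
  have pow: "g ^ k \<in> mpolys_in I" if "g \<in> mpolys_in I" for g :: "('i, complex) mpoly" and k
    using that by (rule ring_set_power[OF ring_set_mpolys_in])
  obtain k R where R: "P = [:0, 1:] ^ k * R" "coeff R 0 \<noteq> 0" by (rule polynomial_split_X[OF P])
  have "id_ev x (f1 ^ k) * id_ev x (evalp m2 f1 R) = 0" if "x \<in> Z2" for x
    using van[OF that] unfolding ev1[symmetric] R(1) hom_fun_mult[OF hom_fun_evalp[OF hm2]]
      hom_fun_power[OF hom_fun_evalp[OF hm2]] evalp_X[OF hm2] hom_fun_mult[OF hev] .
  moreover have "\<not> (\<forall>x\<in>Z2. id_ev x (f1 ^ k) = 0)" using f1(1) by (auto simp: hom_fun_power[OF hev])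
  ultimately have RZ: "\<forall>x\<in>Z2. id_ev x (evalp m2 f1 R) = 0"
    using prime(1)[OF pow[OF I(1), of k] in1[of R]] by blast
  have rZ: "id_ev x (m2 (coeff R 0)) = 0" if "x \<in> Z1" for x
  proof -
    have "id_ev x (evalp m2 f1 R) = 0" using RZ that sub(3) by blast
    then show ?thesis unfolding ev1 f1(2)[OF that] evalp_at_0[OF hom_fun_evalp[OF hom_fun_id]] ev2 .
  qed
  obtain j S where S: "coeff R 0 = [:0, 1:] ^ j * S" "coeff S 0 \<noteq> 0" by (rule polynomial_split_X[OF R(2)])
  have m2X: "m2 [:0, 1:] = f2" unfolding m2_def by (rule evalp_X[OF hom_mconst])
  have "id_ev x (f2 ^ j) * id_ev x (m2 S) = 0" if "x \<in> Z1" for x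
    using rZ[OF that] unfolding S(1) hom_fun_mult[OF hm2] hom_fun_power[OF hm2] m2X hom_fun_mult[OF hev] .
  moreover have "\<not> (\<forall>x\<in>Z1. id_ev x (f2 ^ j) = 0)" using f2(1) by (auto simp: hom_fun_power[OF hev])
  ultimately have SZ: "\<forall>x\<in>Z1. id_ev x (m2 S) = 0"
    using prime(2)[OF pow[OF I(2), of j] in2[of S]] by blast
  obtain z where z: "z \<in> Z0" using sub(1) by blast
  then have "id_ev z (m2 S) = 0" using SZ sub(2) by blast
  then have "coeff S 0 = 0" unfolding ev2 f2(2)[OF z] evalp_at_0[OF hom_fun_id] .
  then show False using S(2) by blast
qed

section \<open>The ultraproduct of the chosen points\<close>

lemma cls_eval_mpoly:
  "eval_mpoly (\<lambda>c. cls (\<lambda>q. E q c)) (\<lambda>i. cls (\<lambda>q. x q i)) f = cls (\<lambda>q. eval_mpoly (E q) (x q) f)"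
  by (simp add: eval_mpoly_def cls_sum cls_prod cls_mult cls_power)

lemma cls_evalp:
  assumes "\<And>q. hom_fun (E q)" "hom_fun (\<lambda>c. cls (\<lambda>q. E q c))"
  shows "evalp (\<lambda>c. cls (\<lambda>q. E q c)) (cls x) p = cls (\<lambda>q. evalp (E q) (x q) p)"
  unfolding evalp_altdef[OF assms(1) order_refl] evalp_altdef[OF assms(2) order_refl]
  by (simp add: cls_sum cls_mult cls_power)

lemma star_cst: "star.cst c = cls (\<lambda>_. kc c)"
  by (simp add: star.cst_def emb_def)

lemma star_t: "star.t = emb (to_fract [:0, 1:])"
  by (simp add: star.t_def)

theorem proposition1p1:
  fixes C :: "(nat \<Rightarrow> Ct alg_closure) set" and b :: nat
  assumes "irreducible_curve (to_ac :: Ct \<Rightarrow> Ct alg_closure) {..<2} C"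
    and "\<exists>P Q. P \<in> points_at_infinity (to_ac :: Ct \<Rightarrow> Ct alg_closure) 2 C \<and>
               Q \<in> points_at_infinity (to_ac :: Ct \<Rightarrow> Ct alg_closure) 2 C \<and> P \<noteq> Q"
    and "b \<ge> 1"
  shows "dim_bounded_integral_points 2 C b \<le> 1"
  unfolding dim_bounded_integral_points_def variety_dim_def
proof (rule krull_dim_le_1)
  let ?J = "{..<2::nat} \<times> {..<b}"
  let ?B = "bounded_integral_points 2 C b"
  let ?T = "affine_zariski (\<lambda>c::complex. c) ?J"
  let ?ev = "eval_mpoly (\<lambda>c::complex. c)"
  fix Z0 Z1 Z2 assume cl: "closedin (subtopology ?T ?B) Z0" "closedin (subtopology ?T ?B) Z1"
      "closedin (subtopology ?T ?B) Z2"
    and irr: "irreducible_top (subtopology (subtopology ?T ?B) Z0)"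
      "irreducible_top (subtopology (subtopology ?T ?B) Z1)"
      "irreducible_top (subtopology (subtopology ?T ?B) Z2)"
    and sub: "Z0 \<subset> Z1" "Z1 \<subset> Z2"
  have BJ: "?B \<subseteq> aspace ?J"
  proof
    fix y assume "y \<in> ?B"
    then obtain a where "y = (\<lambda>ij\<in>?J. coeff (a (fst ij)) (snd ij))" unfolding bounded_integral_points_def by blast
    then show "y \<in> aspace ?J" by (rule ssubst) (rule restrict_PiE_iff[THEN iffD2], blast)
  qed
  have ZB: "Z0 \<subseteq> ?B" "Z1 \<subseteq> ?B" "Z2 \<subseteq> ?B" using cl closedin_subset by fastforce+
  have ss: "subtopology (subtopology ?T ?B) Z = subtopology ?T Z" if "Z \<subseteq> ?B" for Z
    using that by (simp add: subtopology_subtopology Int_absorb1)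
  note prime = irreducible_zariski_iff[OF hom_fun_id order_trans[OF _ BJ], THEN iffD1]
  note pr0 = prime[OF ZB(1) irr(1)[unfolded ss[OF ZB(1)]]]
  note pr1 = prime[OF ZB(2) irr(2)[unfolded ss[OF ZB(2)]]]
  note pr2 = prime[OF ZB(3) irr(3)[unfolded ss[OF ZB(3)]]]
  obtain p1 where p1: "p1 \<in> Z2" "p1 \<notin> Z1" using sub(2) by blast
  obtain p0 where p0: "p0 \<in> Z1" "p0 \<notin> Z0" using sub(1) by blast
  obtain f1 where f1: "f1 \<in> mpolys_in ?J" "?ev p1 f1 \<noteq> 0" "\<And>x. x \<in> Z1 \<Longrightarrow> ?ev x f1 = 0"
    by (rule closed_separation[OF hom_fun_id cl(2) BJ subsetD[OF ZB(3) p1(1)] p1(2)]) (rule that)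
  obtain f2 where f2: "f2 \<in> mpolys_in ?J" "?ev p0 f2 \<noteq> 0" "\<And>x. x \<in> Z0 \<Longrightarrow> ?ev x f2 = 0"
    by (rule closed_separation[OF hom_fun_id cl(1) BJ subsetD[OF ZB(2) p0(1)] p0(2)]) (rule that)
  have indep: "\<exists>x\<in>Z2. evalp (evalp (\<lambda>c. c) (?ev x f2)) (?ev x f1) P \<noteq> 0" if "P \<noteq> 0" for P
  proof (rule chain_independent[OF f1(1) f2(1)])
    show "Z0 \<noteq> {}" using pr0 by blast
    show "Z0 \<subseteq> Z1" "Z1 \<subseteq> Z2" using sub by blast+
    show "\<not> (\<forall>x\<in>Z2. ?ev x f1 = 0)" "\<not> (\<forall>x\<in>Z1. ?ev x f2 = 0)" using f1(2) p1(1) f2(2) p0(1) by blast+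
    show "P \<noteq> 0" by (rule that)
  qed (use pr1 pr2 f1(3) f2(3) in blast)+
  \<comment> \<open>Independence provides a point for each polynomial separately, not one point for
    all of them; the ultrapower merges these points.\<close>
  have "\<forall>P. \<exists>y. P \<noteq> 0 \<longrightarrow> y \<in> Z2 \<and> evalp (evalp (\<lambda>c. c) (?ev y f2)) (?ev y f1) P \<noteq> 0"
    using indep by blast
  from choice[OF this] obtain \<zeta> where
    "\<forall>P. P \<noteq> 0 \<longrightarrow> \<zeta> P \<in> Z2 \<and> evalp (evalp (\<lambda>c. c) (?ev (\<zeta> P) f2)) (?ev (\<zeta> P) f1) P \<noteq> 0" ..
  then have \<zeta>: "\<And>P. P \<noteq> 0 \<Longrightarrow> \<zeta> P \<in> Z2"
    "\<And>P. P \<noteq> 0 \<Longrightarrow> evalp (evalp (\<lambda>c. c) (?ev (\<zeta> P) f2)) (?ev (\<zeta> P) f1) P \<noteq> 0" by blast+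
  \<comment> \<open>The index 0 needs some point of the set as its default value.\<close>
  define z where "z P = (if P = 0 then p1 else \<zeta> P)" for P
  have zB: "z P \<in> ?B" for P using \<zeta>(1)[of P] p1(1) ZB(3) by (auto simp: z_def)
  have "\<forall>P. \<exists>a. z P = (\<lambda>ij\<in>?J. coeff (a (fst ij)) (snd ij)) \<and> (\<forall>i<2. degree (a i) < b) \<and>
      (\<lambda>i\<in>{..<2}. to_ac (to_fract (a i))) \<in> C"
    using zB unfolding bounded_integral_points_def by blast
  from choice[OF this] obtain a :: "index \<Rightarrow> nat \<Rightarrow> complex poly" where
    a': "\<forall>P. z P = (\<lambda>ij\<in>?J. coeff (a P (fst ij)) (snd ij)) \<and> (\<forall>i<2. degree (a P i) < b) \<and>
      (\<lambda>i\<in>{..<2}. to_ac (to_fract (a P i))) \<in> C" ..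
  have a: "z P = (\<lambda>ij\<in>?J. coeff (a P (fst ij)) (snd ij))" "i < 2 \<Longrightarrow> degree (a P i) < b"
    "(\<lambda>i\<in>{..<2}. to_ac (to_fract (a P i))) \<in> C" for P i
    using spec[OF a', of P] by simp_all
  obtain P\<^sub>0 Q\<^sub>0 where PQ: "P\<^sub>0 \<in> points_at_infinity to_ac 2 C" "Q\<^sub>0 \<in> points_at_infinity to_ac 2 C" "P\<^sub>0 \<noteq> Q\<^sub>0"
    using assms(2) by blast
  obtain c f \<alpha> \<beta> F where F: "F \<in> mpolys_in {..<2}" "\<And>x. x \<in> C \<Longrightarrow> eval_mpoly to_ac x F = 0"
    "poly (top_form F) (kc c) \<noteq> 0" and f: "irreducible f" "lead_coeff f = 1" "f \<in> chart_ideal C (kc c)"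
    and roots: "evalp to_ac \<alpha> (map_poly (\<lambda>c. poly c 0) f) = 0" "evalp to_ac \<beta> (map_poly (\<lambda>c. poly c 0) f) = 0" "\<alpha> \<noteq> \<beta>"
    by (rule curve_chart[OF assms(1) PQ]) (rule that)
  define x where "x i = cls (\<lambda>P. to_fract (a P i))" for i :: nat
  have transfer: "eval_mpoly emb x G = 0"
    if G: "G \<in> mpolys_in {..<2}" "\<And>y. y \<in> C \<Longrightarrow> eval_mpoly to_ac y G = 0" for G
  proof -
    have "eval_mpoly (\<lambda>c. c) (\<lambda>i. to_fract (a P i)) G = 0" for P
    proof -
      have "to_ac (eval_mpoly (\<lambda>c. c) (\<lambda>i. to_fract (a P i)) G) = eval_mpoly to_ac (\<lambda>i. to_ac (to_fract (a P i))) G"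
        by (rule eval_mpoly_compose[OF hom_to_ac])
      also have "\<dots> = eval_mpoly to_ac (\<lambda>i\<in>{..<2}. to_ac (to_fract (a P i))) G"
        by (rule eval_mpoly_cong[OF G(1)]) simp
      also have "\<dots> = 0" by (rule G(2)[OF a(3)])
      finally show ?thesis by simp
    qed
    then show ?thesis
      using cls_eval_mpoly[of "\<lambda>_ c. c" "\<lambda>P i. to_fract (a P i)" G] by (simp add: x_def[abs_def] emb_def[abs_def] cls_0)
  qed
  \<comment> \<open>The bound b on the degrees is the same for all indices; therefore the class of
    the polynomials \<open>a P i\<close> is a polynomial in t whose coefficients are classes of
    constants.\<close>
  define p where "p i = (\<Sum>j\<le>b. monom (cls (\<lambda>P. kc (coeff (a P i) j))) j)" for i
  have p_over: "p i \<in> polys_over constants" for i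
    unfolding p_def using field_set_ring[OF field_set_constants]
    by (intro ring_set_sum[OF ring_set_polys_over] polys_over_monom ring_set_zero constantsI)
  have p_eval: "poly (p i) star.t = x i" if "i < 2" for i
  proof -
    have "(\<Sum>j\<le>b. monom (coeff (a P i) j) j) = a P i" for P
      using a(2)[OF that, of P] by (intro poly_as_sum_of_monoms') simp
    then show ?thesis unfolding p_def star_t poly_constants x_def by simp
  qed
  have p_coeff: "coeff (p i) j = cls (\<lambda>P. kc (coeff (a P i) j))" if "j < b" for i j
    using that by (simp add: p_def coeff_sum)
  have hk: "hom_fun kc" by (rule hom_kc)
  have kev: "eval_mpoly star.cst (\<lambda>ij. cls (\<lambda>P. kc (z P ij))) g = cls (\<lambda>P. kc (?ev (z P) g))" for g
    unfolding star_cst eval_mpoly_compose[OF hk] by (rule cls_eval_mpoly)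
  \<comment> \<open>The value of g at the coefficient vector of the merged point; being polynomial
    in the coefficients, it lies in every valuation ring over \<complex> containing them.\<close>
  define \<gamma> where "\<gamma> g = eval_mpoly star.cst (\<lambda>ij. cls (\<lambda>P. kc (z P ij))) g" for g
  have \<gamma>_eq: "\<gamma> g = cls (\<lambda>P. kc (?ev (z P) g))" for g unfolding \<gamma>_def by (rule kev)
  show False
  proof (rule star.no_independent_point[of "poly (p 0) star.t - star.cst c * poly (p 1) star.t" "p 0" c "p 1"
        "poly (p 1) star.t" f to_ac \<alpha> \<beta> "\<gamma> f2" "\<gamma> f1"])
    have l: "poly (p 0) star.t - star.cst c * poly (p 1) star.t = x 0 - emb (kc c) * x 1"
      by (simp add: p_eval star.cst_def)
    show "p 0 \<in> polys_over constants" "p 1 \<in> polys_over constants" by (rule p_over)+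
    show "irreducible f" "lead_coeff f = 1" by (rule f)+
    show "hom_fun (to_ac :: Ct \<Rightarrow> Ct alg_closure)" by (rule hom_to_ac)
    show "poly (p 1) star.t \<in> W"
      if W: "valuation_ring W" "range emb \<subseteq> W" "poly (p 0) star.t - star.cst c * poly (p 1) star.t \<in> W" for W
      using second_coordinate_integral[OF hom_emb F(1,3) transfer[OF F(1,2)] W(1,2)] W(3)
      unfolding l by (simp add: p_eval)
    show "evalp (evalp emb (inverse (poly (p 0) star.t - star.cst c * poly (p 1) star.t)))
        (poly (p 1) star.t / (poly (p 0) star.t - star.cst c * poly (p 1) star.t)) f = 0"
      if nz: "poly (p 0) star.t - star.cst c * poly (p 1) star.t \<noteq> 0"
    proof -
      define l where "l = x 0 - emb (kc c) * x 1"
      have l0: "l \<noteq> 0" using nz by (simp add: l_def p_eval star.cst_def)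
      note hm = hom_fun_eval_mpoly[OF hom_emb, of x]
      have in2: "(mvar 0 - mconst (kc c) * mvar 1) * homogenise (kc c) 1 f \<in> mpolys_in {..<2}"
        by (intro ring_set_mult[OF ring_set_mpolys_in] ring_set_diff[OF ring_set_mpolys_in] homogenise_in
            ring_set_one[OF ring_set_mpolys_in] mvar_in mconst_in) auto
      have "eval_mpoly emb x ((mvar 0 - mconst (kc c) * mvar 1) * homogenise (kc c) 1 f) = 0"
        by (rule transfer[OF in2 chart_ideal_equation[OF f(3)]])
      then have "l * (l ^ chart_bound f * evalp (evalp emb (1 / l)) (x 1 / l) f) = 0"
        unfolding hom_fun_mult[OF hm] hom_fun_diff[OF hm] eval_homogenise_scaled[where l = l, OF hom_emb l_def l0]
          hom_fun_1[OF hm] eval_mvar[OF hom_emb] eval_mconst[OF hom_emb] l_def[symmetric] .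
      then have "evalp (evalp emb (inverse l)) (x 1 / l) f = 0" using l0 by (simp add: inverse_eq_divide)
      then show ?thesis unfolding l_def by (simp add: p_eval star.cst_def)
    qed
    show "\<gamma> f2 \<in> V \<and> \<gamma> f1 \<in> V"
      if V: "valuation_ring V" "range star.cst \<subseteq> V" "\<And>i. coeff (p 0) i \<in> V" "\<And>i. coeff (p 1) i \<in> V" for V
    proof -
      have "cls (\<lambda>P. kc (z P ij)) \<in> V" if ij: "ij \<in> ?J" for ij
      proof -
        obtain i j where "ij = (i, j)" "i < 2" "j < b" using ij by auto
        moreover have "cls (\<lambda>P. kc (coeff (a P i) j)) \<in> V" if "i < 2" "j < b" for i j
          using p_coeff[OF that(2), of i] V(3)[of j] V(4)[of j] that(1) by (auto simp: less_2_cases_iff)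
        ultimately show ?thesis by (simp add: a(1))
      qed
      then show ?thesis
        unfolding \<gamma>_def using f1(1) f2(1) V(2)
        by (intro conjI eval_mpoly_in_ring_set[OF valuation_ring_ring[OF V(1)]])
    qed
    show "evalp (evalp star.cst (\<gamma> f2)) (\<gamma> f1) P \<noteq> 0" if P: "P \<noteq> 0" for P
    proof -
      define g where "g Q = evalp (evalp (\<lambda>c. c) (?ev (z Q) f2)) (?ev (z Q) f1) P" for Q
      have inner: "evalp star.cst (\<gamma> f2) = (\<lambda>r. cls (\<lambda>Q. kc (evalp (\<lambda>c. c) (?ev (z Q) f2) r)))"
      proof
        fix r
        show "evalp star.cst (\<gamma> f2) r = cls (\<lambda>Q. kc (evalp (\<lambda>c. c) (?ev (z Q) f2) r))"
          unfolding \<gamma>_eq evalp_compose[OF hom_fun_id hk] unfolding star_cst[abs_def]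
          by (rule cls_evalp[where E = "\<lambda>_. kc", OF hk star.hom_cst[unfolded star_cst[abs_def]]])
      qed
      have hin: "hom_fun (\<lambda>r. cls (\<lambda>Q. kc (evalp (\<lambda>c. c) (?ev (z Q) f2) r)))"
        unfolding inner[symmetric] by (rule hom_fun_evalp[OF star.hom_cst])
      have val: "evalp (evalp star.cst (\<gamma> f2)) (\<gamma> f1) P = cls (\<lambda>Q. kc (g Q))"
        unfolding inner unfolding \<gamma>_eq g_def evalp_compose[OF hom_fun_evalp[OF hom_fun_id] hk]
        by (rule cls_evalp[OF hom_fun_comp[OF hk hom_fun_evalp[OF hom_fun_id]] hin])
      \<comment> \<open>For an index Q = P R the point was chosen so that Q does not vanish there,
        hence neither does P; the multiples of P form a set of the filter.\<close>
      have nz: "eventually (\<lambda>Q. kc (g Q) \<noteq> 0) ultra"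
      proof (rule eventually_ultra_dvd[OF P])
        fix Q assume Q: "Q \<noteq> 0" "P dvd Q"
        obtain R where R: "Q = P * R" using Q(2) by (rule dvdE)
        have "z Q = \<zeta> Q" using Q(1) by (simp add: z_def)
        then have "evalp (evalp (\<lambda>c. c) (?ev (z Q) f2)) (?ev (z Q) f1) (P * R) \<noteq> 0"
          using \<zeta>(2)[OF Q(1)] R by simp
        then show "kc (g Q) \<noteq> 0"
          unfolding g_def hom_fun_mult[OF hom_fun_evalp[OF hom_fun_evalp[OF hom_fun_id]]] by auto
      qed
      have "\<not> eventually (\<lambda>Q. kc (g Q) = 0) ultra"
      proof
        assume "eventually (\<lambda>Q. kc (g Q) = 0) ultra"
        then have "eventually (\<lambda>Q. False) ultra" using nz by (rule eventually_elim2) blast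
        then show False using ultra(2) by (simp add: trivial_limit_def)
      qed
      then show ?thesis unfolding val cls_0[symmetric] cls_eq_iff .
    qed
  qed (rule refl roots)+
qed

end
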